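(* Let $\beta_c>0$ be defined by $e^{-2\beta_c}=\tanh\beta_c=\sqrt2-1$. The free energy density satisfies \[ -\beta f(\beta)=\begin{cases}\ln(2\cosh^2\beta)+\sum_{r=1}^\infty f^\circ_r(\tanh\beta), & \beta\in(0,\beta_c),\\[2pt] 2\beta+\sum_{r=1}^\infty f^\circ_r(e^{-2\beta}), & \beta\in(\beta_c,\infty),\end{cases} \] where the series converge absolutely. In particular, since $f^\circ_r(x)=f^\circ_r(1)x^r$, $f$ is real-analytic on $(0,\beta_c)\cup(\beta_c,\infty)$.
   Context: A finite rectangle $G=(V,E)$ in $\mathbb Z^2$: $V$ = all points of $\mathbb Z^2$ in a rectangle $[a,b]\times[c,d]$, $E$ = pairs at $L^1$-distance $1$; $\partial G$ = vertices of $V$ with a neighbour in $\mathbb Z^2\setminus V$. Ising model: for $\sigma\in\Omega_G^{\mathrm b}$, where $\Omega_G^{\mathrm f}=\{-1,1\}^V$ (free) and $\Omega_G^+=\{\sigma:\sigma_u=1\ \forall u\in\partial G\}$ (plus), $P^{\mathrm b}_{G,\beta}(\sigma)=\frac1{Z^{\mathrm b}_{G,\beta}}\prod_{uv\in E}e^{\beta\sigma_u\sigma_v}$, $Z^{\mathrm b}_{G,\beta}=\sum_{\sigma\in\Omega^{\mathrm b}_G}\prod_{uv\in E}e^{\beta\sigma_u\sigma_v}$. The free energy density is $f(\beta)=\lim_{G\to\mathbb Z^2}-\frac{1}{\beta|V|}\ln Z^{\mathrm b}_{G,\beta}$ (limit along rectangles eventually containing every finite set; it exists and is independent of $\mathrm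 b$). Loops in $\mathbb Z^2$ (standard embedding): a path $(v_0,\dots,v_{r-1})$ has consecutive vertices adjacent and $v_{i+2}\ne v_i$; closed if all rotations are paths; a loop is a closed path lexicographically smallest among rotations of itself and its reversal. $m(\ell)$ = steps / smallest period; winding angle $\alpha(\ell)$ = sum over $i$ mod $r$ of turning angles in $(-\pi,\pi)$ from $v_{i+1}-v_i$ to $v_{i+2}-v_{i+1}$; $\operatorname{sgn}(\ell)=-e^{i\alpha(\ell)/2}$; with all edge weights equal to $x$, $w(\ell;x)=\frac{\operatorname{sgn}(\ell)}{m(\ell)}x^r$. $\mathcal L^\circ_r(\mathbb Z^2)$ = loops of $r$ steps with $v_0=o=(0,0)$, and $f^\circ_r(x)=\sum_{\ell\in\mathcal L^\circ_r(\mathbb Z^2)}w(\ell;x)$. *)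

theory Defs
  imports Complex_Main "HOL-Library.FuncSet"
begin

type_synonym vtx = "int \<times> int"

definition adj :: "vtx \<Rightarrow> vtx \<Rightarrow> bool" where
  "adj u v \<longleftrightarrow> \<bar>fst u - fst v\<bar> + \<bar>snd u - snd v\<bar> = 1"

definition pt_less :: "vtx \<Rightarrow> vtx \<Rightarrow> bool" where
  "pt_less u v \<longleftrightarrow> fst u < fst v \<or> (fst u = fst v \<and> snd u < snd v)"

type_synonym rect = "int \<times> int \<times> int \<times> int"

definition rectV :: "rect \<Rightarrow> vtx set" where
  "rectV R = (case R of (a, b, c, d) \<Rightarrow> {a..b} \<times> {c..d})"

text \<open>Each edge {u,v} is listed once, as the pair (u,v) with u lexicographically smaller.\<close>
definition rectE :: "rect \<Rightarrow> (vtx \<times> vtx) set" where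
  "rectE R = {(u, v). u \<in> rectV R \<and> v \<in> rectV R \<and> adj u v \<and> pt_less u v}"

definition rect_boundary :: "rect \<Rightarrow> vtx set" where
  "rect_boundary R = {u \<in> rectV R. \<exists>w. adj u w \<and> w \<notin> rectV R}"

datatype bcond = Free | Plus

definition Omega :: "bcond \<Rightarrow> rect \<Rightarrow> (vtx \<Rightarrow> int) set" where
  "Omega bc R = {\<sigma> \<in> rectV R \<rightarrow>\<^sub>E {-1, 1}.
                    bc = Plus \<longrightarrow> (\<forall>u \<in> rect_boundary R. \<sigma> u = 1)}"

definition Zpart :: "bcond \<Rightarrow> rect \<Rightarrow> real \<Rightarrow> real" where
  "Zpart bc R \<beta> = (\<Sum>\<sigma> \<in> Omega bc R. \<Prod>(u, v) \<in> rectE R. exp (\<beta> * of_int (\<sigma> u * \<sigma> v)))"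

definition fe_finite :: "bcond \<Rightarrow> real \<Rightarrow> rect \<Rightarrow> real" where
  "fe_finite bc \<beta> R = - (1 / (\<beta> * real (card (rectV R)))) * ln (Zpart bc R \<beta>)"

definition rect_filter :: "rect filter" where
  "rect_filter = (INF F \<in> {F :: vtx set. finite F}. principal {R. F \<subseteq> rectV R})"

definition is_path :: "vtx list \<Rightarrow> bool" where
  "is_path l \<longleftrightarrow> (\<forall>i. Suc i < length l \<longrightarrow> adj (l ! i) (l ! Suc i)) \<and>
                 (\<forall>i. i + 2 < length l \<longrightarrow> l ! (i + 2) \<noteq> l ! i)"

text \<open>Closed paths: indices taken cyclically mod r (for r >= 3 this is the same as
  "all rotations are paths"; it also excludes the degenerate r = 1, 2 cases).\<close>
definition is_closed :: "vtx list \<Rightarrow> bool" where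
  "is_closed l \<longleftrightarrow> l \<noteq> [] \<and>
     (\<forall>i < length l. adj (l ! i) (l ! ((i + 1) mod length l)) \<and>
                     l ! ((i + 2) mod length l) \<noteq> l ! i)"

definition list_lex_le :: "vtx list \<Rightarrow> vtx list \<Rightarrow> bool" where
  "list_lex_le l w \<longleftrightarrow> l = w \<or> (l, w) \<in> lexord {(u, v). pt_less u v}"

definition is_loop :: "vtx list \<Rightarrow> bool" where
  "is_loop l \<longleftrightarrow> is_closed l \<and>
     (\<forall>k < length l. list_lex_le l (rotate k l) \<and> list_lex_le l (rotate k (rev l)))"

definition smallest_period :: "vtx list \<Rightarrow> nat" where
  "smallest_period l = (LEAST p. 0 < p \<and> p dvd length l \<and> rotate p l = l)"

definition mult_loop :: "vtx list \<Rightarrow> nat" where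
  "mult_loop l = length l div smallest_period l"

definition cvec :: "vtx \<Rightarrow> vtx \<Rightarrow> complex" where
  "cvec u v = Complex (of_int (fst v - fst u)) (of_int (snd v - snd u))"

definition turn_angle :: "vtx \<Rightarrow> vtx \<Rightarrow> vtx \<Rightarrow> real" where
  "turn_angle u v w = Arg (cvec v w * cnj (cvec u v))"

definition winding :: "vtx list \<Rightarrow> real" where
  "winding l = (\<Sum>i < length l. turn_angle (l ! i) (l ! ((i + 1) mod length l))
                                   (l ! ((i + 2) mod length l)))"

definition sgn_loop :: "vtx list \<Rightarrow> complex" where
  "sgn_loop l = - exp (\<i> * complex_of_real (winding l / 2))"

definition loop_weight :: "vtx list \<Rightarrow> real \<Rightarrow> complex" where
  "loop_weight l x = sgn_loop l / of_nat (mult_loop l) * complex_of_real (x ^ length l)"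

definition loops_at_origin :: "nat \<Rightarrow> vtx list set" where
  "loops_at_origin r = {l. length l = r \<and> is_loop l \<and> l ! 0 = (0, 0)}"

definition fcirc :: "nat \<Rightarrow> real \<Rightarrow> complex" where
  "fcirc r x = (\<Sum>l \<in> loops_at_origin r. loop_weight l x)"

definition real_analytic_on :: "real set \<Rightarrow> (real \<Rightarrow> real) \<Rightarrow> bool" where
  "real_analytic_on S f \<longleftrightarrow> (\<forall>x \<in> S. \<exists>\<delta> > 0. \<exists>c :: nat \<Rightarrow> real.
      \<forall>y. \<bar>y - x\<bar> < \<delta> \<longrightarrow> (\<lambda>n. c n * (y - x) ^ n) sums f y)"

end

theory Submission
  imports Defs "HOL-Complex_Analysis.Complex_Analysis"
begin

text \<open>
  For a finite set of lattice edges let \<open>S(t)\<close> be the generating polynomial of its even subgraphs; both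
  partition functions are elementary factors times some \<open>S(t)\<close>, with \<open>t = tanh \<beta>\<close> (free) or
  \<open>t = exp (- 2 \<beta>)\<close> (plus, on the dual rectangle).

  Let \<open>\<Lambda>\<close> be the Kac--Ward transition matrix on directed edges, in a gauge in which its entries are
  \<open>0, 1, -1\<close>. Its powers satisfy \<open>t S'/S = - 1/2 (\<Sum>r\<ge>1. t^r tr \<Lambda>^r)\<close>: for a directed edge \<open>e\<close> the vector
  \<open>S (I - t \<Lambda>)\<^sup>-\<^sup>1 e\<close> is written down explicitly as a signed sum over subgraphs with two odd vertices
  (a lattice fermion). The sign of a subgraph counts its edges crossing horizontal cut lines to the right
  of the two odd vertices, so no planar topology enters; the linear equations hold because
  the coboundary of a horizontal ray meets a subgraph in as many edges, modulo 2, as the ray has odd vertices.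

  Since \<open>\<parallel>\<Lambda>\<parallel> \<le> 1 + sqrt 2\<close>, the expansion of \<open>ln S\<close> converges for \<open>t < sqrt 2 - 1\<close>, and dominated convergence
  passes to infinite volume, where the trace per site counts rooted closed paths with their signs. A loop of
  \<open>r\<close> steps and multiplicity \<open>m\<close> accounts for \<open>2 r / m\<close> of these. At the critical point the limit exists because
  the finite volume pressures are uniformly Lipschitz in \<open>\<beta>\<close>.
\<close>

text \<open>Inverting I - t \<Lambda> explicitly replaces the determinant identity of Kac and Ward,
  whose usual proof must cancel the weights of overlapping loops. Only the diagonal of the inverse
  matters: its entry at a directed edge is the probability, under the weight t^|F| on even subgraphs
  F, that F avoids the edge, and summing over edges yields S'/S. A sum over subgraphs with odd
  vertices u0 and v, as a function of v alone, carries no turning phases. It is therefore resolved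
  over the four half-edges at v, with a sign counting the occupied half-edges met before the chosen
  one. Parity at v turns the phases into a finite check, and moving v along an edge costs a factor t
  and a universal sign. No path through the subgraph is ever selected. The norm bound is uniform in
  the graph, and 1 / (1 + sqrt 2) = sqrt 2 - 1 is the value at \<beta>_c of both tanh \<beta> and
  exp (- 2 \<beta>), so the two expansions miss only \<beta>_c. Each is exact for one boundary
  condition; a comparison with an error of the order of the boundary carries it to the
  other.\<close>

declare split_paired_All [simp del] split_paired_Ex [simp del]

section \<open>The inverse of the Kac--Ward matrix\<close>

datatype dir = East | North | West | South

lemma UNIV_dir: "UNIV = {East, North, West, South}"
  using dir.exhaust by auto

instance dir :: finite
  by standard (simp add: UNIV_dir)

lemma all_dir: "(\<forall>k. P k) \<longleftrightarrow> P East \<and> P North \<and> P West \<and> P South"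
  by (metis dir.exhaust)

lemma sum_dir: "(\<Sum>k\<in>UNIV. f k) = f East + (f North + (f West + (f South :: 'a::comm_monoid_add)))"
  by (simp add: UNIV_dir)

fun opp :: "dir \<Rightarrow> dir" where
  "opp East = West" | "opp North = South" | "opp West = East" | "opp South = North"

lemma opp_opp [simp]: "opp (opp k) = k"
  by (cases k) auto

lemma opp_neq [simp]: "opp k \<noteq> k" "k \<noteq> opp k"
  by (cases k; simp)+

fun stp :: "vtx \<Rightarrow> dir \<Rightarrow> vtx" where
  "stp (x, y) East = (x + 1, y)"
| "stp (x, y) North = (x, y + 1)"
| "stp (x, y) West = (x - 1, y)"
| "stp (x, y) South = (x, y - 1)"

lemma stp_opp [simp]: "stp (stp v k) (opp k) = v"
  by (cases v; cases k) auto

lemma stp_opp' [simp]: "stp (stp v (opp k)) k = v"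
  by (cases v; cases k) auto

lemma stp_neq [simp]: "stp v k \<noteq> v" "v \<noteq> stp v k"
  by (cases v; cases k; simp)+

text \<open>The pair lists the left or lower end first, as \<open>rectE\<close> does, so both
  directions of travel give the same element.\<close>

fun ed :: "vtx \<Rightarrow> dir \<Rightarrow> vtx \<times> vtx" where
  "ed v East = (v, stp v East)"
| "ed v North = (v, stp v North)"
| "ed v West = (stp v West, v)"
| "ed v South = (stp v South, v)"

lemma ed_opp: "ed (stp v k) (opp k) = ed v k"
  by (cases v; cases k) auto

lemma ed_eq_iff: "ed v k = ed w j \<longleftrightarrow> (v = w \<and> k = j) \<or> (w = stp v k \<and> j = opp k)"
  by (cases v; cases w; cases k; cases j) auto

text \<open>The Kac--Ward phase \<open>exp (\<i> \<angle>(d, d') / 2)\<close> in the gauge in which it is real.\<close>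
fun kwc :: "dir \<Rightarrow> dir \<Rightarrow> real" where
  "kwc East East = 1" | "kwc East North = 1" | "kwc East West = 0" | "kwc East South = -1"
| "kwc North East = 1" | "kwc North North = 1" | "kwc North West = 1" | "kwc North South = 0"
| "kwc West East = 0" | "kwc West North = 1" | "kwc West West = 1" | "kwc West South = 1"
| "kwc South East = -1" | "kwc South North = 0" | "kwc South West = 1" | "kwc South South = 1"

text \<open>Membership is recorded as a sign so that counting modulo 2 becomes multiplication:
  \<open>par\<close> is then the degree parity at a vertex and \<open>gam\<close> a crossing
  parity.\<close>

definition chi :: "(vtx \<times> vtx) set \<Rightarrow> vtx \<Rightarrow> dir \<Rightarrow> real" where
  "chi F v k = (if ed v k \<in> F then -1 else 1)"

definition par :: "(dir \<Rightarrow> real) \<Rightarrow> real" where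
  "par c = c East * c North * c West * c South"

text \<open>Parity of the occupied half-edges that precede \<open>k\<close> when the directions are
  read counterclockwise from East. The reading is cut open between South and East, which is where
  \<open>kwc\<close> carries its signs.\<close>

fun bef :: "(dir \<Rightarrow> real) \<Rightarrow> dir \<Rightarrow> real" where
  "bef c East = 1"
| "bef c North = c East"
| "bef c West = c East * c North"
| "bef c South = c East * c North * c West"

fun eps :: "dir \<Rightarrow> real" where
  "eps East = 1" | "eps North = 1" | "eps West = -1" | "eps South = -1"

text \<open>Crossing parity of \<open>F\<close> with the horizontal ray that starts to the right of
  \<open>v\<close>, half a unit below its row. The cut at \<open>X\<close> keeps the product finite
  and loses no edge in \<open>kw_graph\<close>.\<close>

definition gam :: "int \<Rightarrow> (vtx \<times> vtx) set \<Rightarrow> vtx \<Rightarrow> real" where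
  "gam X F v = (\<Prod>x'\<in>{fst v<..X}. chi F (x', snd v) South)"

lemma chi_cases: "chi F v k = 1 \<or> chi F v k = -1"
  by (simp add: chi_def)

lemma chi_opp: "chi F (stp v k) (opp k) = chi F v k"
  by (simp add: chi_def ed_opp)

lemma chi_insert: "chi (insert (ed u d) F) v k =
    (if (v = u \<and> k = d) \<or> (v = stp u d \<and> k = opp d) then -1 else chi F v k)"
  unfolding chi_def by (auto simp: ed_eq_iff)

text \<open>If the half-edge \<open>opp d\<close> is occupied, an even number of the other three is
  occupied and their signed contributions cancel. If it is empty, that number is odd and one
  contribution survives, with the sign on the left. Only four signs occur, so the odd patterns are
  simply checked for each \<open>d\<close>.\<close>

lemma vertex_relation_local:
  assumes "\<And>k. c k = 1 \<or> c k = -1" and "par c = -1"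
  shows "eps (opp d) * (if c (opp d) = 1 then bef c (opp d) else 0) =
         (\<Sum>d'\<in>UNIV. kwc d d' * (if c d' = -1 then bef c d' else 0))"
  using assms(1)[of East] assms(1)[of North] assms(1)[of West] assms(1)[of South] assms(2)
  by (cases d; elim disjE; simp add: sum_dir par_def)

lemma prod_pm: "(\<And>i. i \<in> A \<Longrightarrow> f i = 1 \<or> f i = (-1::real)) \<Longrightarrow> prod f A = 1 \<or> prod f A = -1"
proof (induction A rule: infinite_finite_induct)
  case (insert a A)
  then have "f a = 1 \<or> f a = -1" "prod f A = 1 \<or> prod f A = -1" by auto
  then show ?case using insert(1,2) by (elim disjE) simp_all
qed auto

lemma gam_cases: "gam X F v = 1 \<or> gam X F v = -1"
  unfolding gam_def by (rule prod_pm) (rule chi_cases)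

lemma bef_cases:
  assumes "\<And>k. c k = 1 \<or> c k = -1"
  shows "bef c k = 1 \<or> bef c k = -1"
  using assms[of East] assms[of North] assms[of West] by (cases k) (elim disjE; simp)+

lemma gam_step: "x < X \<Longrightarrow> gam X F (x, y) = chi F (x + 1, y) South * gam X F (x + 1, y)"
proof -
  assume "x < X"
  then have "{x<..X} = insert (x+1) {x+1<..X}" by auto
  then show ?thesis unfolding gam_def by simp
qed

section \<open>Parity along horizontal rays\<close>

locale kw_graph =
  fixes E :: "(vtx \<times> vtx) set" and X :: int
  assumes finE: "finite E" and rangeE: "\<And>p. p \<in> E \<Longrightarrow> \<exists>v k. p = ed v k"
    and bound: "\<And>v k. ed v k \<in> E \<Longrightarrow> fst v \<le> X"
begin

text \<open>Multiply the degree signs along row \<open>y\<close> to the right of \<open>x\<close>. A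
  horizontal edge between two of these vertices occurs twice and drops out; what survives is the
  edge entering at the left end and the vertical edges below and above, which are the two ray
  parities. Nothing leaves at the right end because of \<open>bound\<close>, so the induction starts
  there.\<close>

lemma coboundary:
  assumes F: "F \<subseteq> E"
  shows "chi F (x, y) East * gam X F (x, y) * gam X F (x, y + 1) = (\<Prod>x'\<in>{x<..X}. par (chi F (x', y)))"
proof (induction "nat (X - x)" arbitrary: x)
  case 0
  then have "x \<ge> X" by simp
  then have "ed (x+1,y) West \<notin> F" using bound[of "(x+1,y)" West] F by auto
  then show ?case using \<open>x \<ge> X\<close> by (simp add: gam_def chi_def)
next
  case (Suc n)
  then have xX: "x < X" by simp
  then have s: "{x<..X} = insert (x+1) {x+1<..X}" by auto
  have IH: "chi F (x+1, y) East * gam X F (x+1, y) * gam X F (x+1, y + 1) = (\<Prod>x'\<in>{x+1<..X}. par (chi F (x', y)))"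
    using Suc by (intro Suc.hyps(1)) auto
  have w: "chi F (x, y) East = chi F (x+1,y) West" using chi_opp[of F "(x,y)" East] by simp
  have n: "chi F (x+1, y+1) South = chi F (x+1,y) North" using chi_opp[of F "(x+1,y)" North] by simp
  have "(\<Prod>x'\<in>{x<..X}. par (chi F (x', y))) = par (chi F (x+1,y)) * (chi F (x+1, y) East * gam X F (x+1, y) * gam X F (x+1, y + 1))"
    unfolding s IH by simp
  moreover have "chi F (x+1,y) East * chi F (x+1,y) East = 1"
    using chi_cases[of F "(x+1,y)" East] by (elim disjE) simp_all
  ultimately show ?case unfolding gam_step[OF xX] w n par_def by (simp add: mult.assoc mult.left_commute)
qed

end

section \<open>Subgraphs with a source half-edge and one odd vertex\<close>

locale kw_source = kw_graph +
  fixes u0 :: vtx and d0 :: dir and t :: real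
  assumes srcE: "ed u0 d0 \<in> E"
begin

text \<open>The half of the source edge at \<open>u0\<close> counts as occupied although the whole
  edge is excluded in \<open>Conf\<close>. With this convention \<open>v\<close> is the only odd
  vertex of a configuration, also for \<open>v = u0\<close>.\<close>

definition tchi :: "(vtx \<times> vtx) set \<Rightarrow> vtx \<Rightarrow> dir \<Rightarrow> real" where
  "tchi F v k = (if v = u0 \<and> k = d0 then -1 else chi F v k)"

text \<open>A vertical step of the odd vertex changes a sign when \<open>u0\<close> lies between the
  rays of its two ends or when the step crosses the ray of \<open>u0\<close>. Away from
  \<open>u0\<close> the order of the two vertices, by rows and then by columns, flips in just these
  cases and compensates.\<close>

definition sig :: "vtx \<Rightarrow> real" where
  "sig v = (if snd v > snd u0 \<or> (snd v = snd u0 \<and> fst v > fst u0) then -1 else 1)"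

definition sg :: "(vtx \<times> vtx) set \<Rightarrow> vtx \<Rightarrow> real" where
  "sg F v = gam X F v * gam X F u0 * bef (chi F u0) d0 * sig v"

definition Conf :: "vtx \<Rightarrow> (vtx \<times> vtx) set set" where
  "Conf v = {F. F \<subseteq> E - {ed u0 d0} \<and> (\<forall>w. par (tchi F w) = (if w = v then -1 else 1))}"

lemma tchi_cases: "tchi F v k = 1 \<or> tchi F v k = -1"
  using chi_cases by (auto simp: tchi_def)

lemma par_tchi: "ed u0 d0 \<notin> F \<Longrightarrow> par (tchi F w) = par (chi F w) * (if w = u0 then -1 else 1)"
proof -
  assume "ed u0 d0 \<notin> F"
  then have 1: "chi F u0 d0 = 1" by (simp add: chi_def)
  show ?thesis
  proof (cases "w = u0")
    case True
    with 1 show ?thesis unfolding par_def tchi_def by (cases d0) simp_all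
  qed (simp add: par_def tchi_def)
qed

text \<open>The assumption on \<open>v\<close> keeps it off the ray, so \<open>u0\<close> is the
  only vertex there that can have odd degree.\<close>

lemma coboundary_source:
  assumes F: "F \<in> Conf v" and v: "\<not> (snd v = y \<and> x < fst v)"
  shows "chi F (x, y) East * gam X F (x, y) * gam X F (x, y + 1) =
    (if snd u0 = y \<and> x < fst u0 then -1 else 1)"
proof -
  have FE: "F \<subseteq> E" and e: "ed u0 d0 \<notin> F" and p: "\<And>w. par (tchi F w) = (if w = v then -1 else 1)"
    using F by (auto simp: Conf_def)
  have q: "par (chi F w) = (if w = v then -1 else 1) * (if w = u0 then -1 else 1)" for w
    using p[of w] par_tchi[OF e, of w] by (auto split: if_splits)
  have "(\<Prod>x'\<in>{x<..X}. par (chi F (x', y))) = (\<Prod>x'\<in>{x<..X}. if x' = fst u0 then (if snd u0 = y then -1 else 1) else 1)"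
    using v by (intro prod.cong refl) (auto simp: q)
  also have "\<dots> = (if snd u0 = y \<and> x < fst u0 then -1 else 1)"
    using bound[OF srcE] by (subst prod.delta) auto
  finally show ?thesis using coboundary[OF FE] by simp
qed

lemma gam_insert:
  assumes "ed u d \<notin> F" "fst u \<le> X"
  shows "gam X (insert (ed u d) F) w = gam X F w *
    (if fst w < fst u \<and> ((d = South \<and> snd u = snd w) \<or> (d = North \<and> snd u + 1 = snd w)) then -1 else 1)"
proof -
  obtain x y where u: "u = (x, y)" by force
  have "chi (insert (ed u d) F) (x', snd w) South = chi F (x', snd w) South *
      (if x' = x then (if (d = South \<and> y = snd w) \<or> (d = North \<and> y + 1 = snd w) then -1 else 1) else 1)" for x'
    using assms(1) unfolding chi_insert
    by (cases d) (auto simp: u chi_def)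
  then have "gam X (insert (ed u d) F) w = gam X F w * (\<Prod>x'\<in>{fst w<..X}. (if x' = x then (if (d = South \<and> y = snd w) \<or> (d = North \<and> y + 1 = snd w) then -1 else 1) else 1))"
    unfolding gam_def by (simp add: prod.distrib)
  also have "(\<Prod>x'\<in>{fst w<..X}. (if x' = x then (if (d = South \<and> y = snd w) \<or> (d = North \<and> y + 1 = snd w) then -1 else 1) else (1::real)))
     = (if fst w < x \<and> ((d = South \<and> y = snd w) \<or> (d = North \<and> y + 1 = snd w)) then -1 else 1)"
    using assms(2) u by (subst prod.delta) auto
  finally show ?thesis by (simp add: u)
qed

text \<open>The strict counterclockwise order from East through which \<open>bef\<close>
  runs.\<close>

fun bfr :: "dir \<Rightarrow> dir \<Rightarrow> bool" where
  "bfr East k = (k \<noteq> East)"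
| "bfr North k = (k = West \<or> k = South)"
| "bfr West k = (k = South)"
| "bfr South k = False"

lemma bef_insert:
  assumes "ed u d \<notin> F"
  shows "bef (chi (insert (ed u d) F) w) k = bef (chi F w) k *
    (if (w = u \<and> bfr d k) \<or> (w = stp u d \<and> bfr (opp d) k) then -1 else 1)"
proof -
  have 1: "chi F u d = 1" "chi F (stp u d) (opp d) = 1" using assms by (auto simp: chi_def ed_opp)
  define c where "c = chi (insert (ed u d) F) w"
  have c: "c j = (if (w = u \<and> j = d) \<or> (w = stp u d \<and> j = opp d) then -1 else chi F w j)" for j
    by (simp add: c_def chi_insert)
  consider "w = u" | "w = stp u d" "w \<noteq> u" | "w \<noteq> u" "w \<noteq> stp u d" by blast
  then have "bef c k = bef (chi F w) k *
    (if (w = u \<and> bfr d k) \<or> (w = stp u d \<and> bfr (opp d) k) then -1 else 1)"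
  proof cases
    case 1
    with \<open>chi F u d = 1\<close> show ?thesis by (cases k; cases d; simp add: c)
  next
    case 2
    with \<open>chi F (stp u d) (opp d) = 1\<close> show ?thesis by (cases k; cases d; simp add: c)
  next
    case 3
    then show ?thesis by (cases k; simp add: c)
  qed
  then show ?thesis by (simp add: c_def)
qed

lemma bef_tchi_insert: "bef (tchi (insert (ed u d) F) u) d = bef (tchi F u) d"
proof -
  have "tchi (insert (ed u d) F) u k = (if k = d then -1 else tchi F u k)" for k
    by (simp add: tchi_def chi_insert)
  then show ?thesis by (cases d) simp_all
qed

lemma chi_src:
  assumes "F \<in> Conf v" shows "chi F u0 d0 = 1"
  using assms by (auto simp: Conf_def chi_def)

lemma tchi_eq: "F \<in> Conf v \<Longrightarrow> tchi F w k = chi F w k * (if w = u0 \<and> k = d0 then -1 else 1)"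
  using chi_src[of F v] by (auto simp: tchi_def)

text \<open>Erasing the edge moves the odd vertex from \<open>u\<close> to the other end, and the
  ratio of the two signs must not depend on \<open>F\<close>. For a horizontal step the two rays lie
  on one line and differ by the South half-edge of the right-hand end, which parity at that end
  trades for its other half-edges. For a vertical step the two rays enclose a piece of one row,
  whose coboundary is known. The two directions of the source edge are excluded.\<close>

lemma edge_sign:
  assumes g: "ed u d \<in> E" and ne: "(u, d) \<noteq> (u0, d0)" "(u, d) \<noteq> (stp u0 d0, opp d0)"
    and F: "F \<in> Conf (stp u d)" "ed u d \<notin> F"
  shows "bef (tchi (insert (ed u d) F) u) d * sg (insert (ed u d) F) u =
         eps (opp d) * bef (tchi F (stp u d)) (opp d) * sg F (stp u d)"
proof -
  define v where "v = stp u d"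
  obtain x y where u: "u = (x, y)" by force
  obtain x0 y0 where u0: "u0 = (x0, y0)" by force
  have uX: "fst u \<le> X" and vX: "fst v \<le> X"
    using bound[OF g] bound[of v "opp d"] g by (auto simp: v_def ed_opp)
  \<comment> \<open>The change of the two factors attached to \<open>u0\<close>: the inserted edge
    may cross the ray of \<open>u0\<close>, or end at \<open>u0\<close> in a direction that precedes
    \<open>d0\<close>.\<close>
  define r where "r = (if fst u0 < fst u \<and> ((d = South \<and> snd u = snd u0) \<or> (d = North \<and> snd u + 1 = snd u0)) then -1 else (1::real))
      * (if (u0 = u \<and> bfr d d0) \<or> (u0 = stp u d \<and> bfr (opp d) d0) then -1 else 1)"
  have sgI: "sg (insert (ed u d) F) u = gam X F u * gam X F u0 * bef (chi F u0) d0 * r * sig u"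
    unfolding sg_def gam_insert[OF F(2) uX] bef_insert[OF F(2)] r_def by simp
  have par: "par (tchi F w) = (if w = v then -1 else 1)" for w
    using F(1) by (simp add: Conf_def v_def)
  have tv: "tchi F v (opp d) = 1" "tchi F u d = 1"
    using ne F(2) unfolding tchi_def v_def chi_def ed_opp by auto
  have key: "bef (tchi F u) d * gam X F u * r * sig u = eps (opp d) * bef (tchi F v) (opp d) * gam X F v * sig v"
  proof (cases d)
    case East
    have v: "v = (x+1, y)" by (simp add: v_def East u)
    have "gam X F u = chi F v South * gam X F v"
      using vX unfolding u v by (intro gam_step) auto
    moreover have "- (tchi F v East * tchi F v North) = tchi F v South"
      using par[of v] tv(1) tchi_cases[of F v South] unfolding par_def East by (elim disjE) simp_all
    moreover have "r * sig u = (if v = u0 \<and> South = d0 then -1 else 1) * sig v"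
      using ne unfolding r_def sig_def unfolding u v u0 East by (cases d0) auto
    ultimately show ?thesis unfolding East tchi_eq[OF F(1)] by (simp add: mult_ac)
  next
    case West
    have v: "v = (x-1, y)" by (simp add: v_def West u)
    have 1: "gam X F v = chi F u South * gam X F u"
      using uX gam_step[of "x-1" X F y] unfolding u v by auto
    have 2: "tchi F u East * tchi F u North = tchi F u South"
      using par[of u] tv(2) tchi_cases[of F u South] unfolding par_def West v_def by (elim disjE) simp_all
    have 3: "(if u = u0 \<and> South = d0 then -1 else 1) * r * sig u = sig v"
      using ne unfolding r_def sig_def unfolding u v u0 West by (cases d0) auto
    have "bef (tchi F u) d * gam X F u * r * sig u = tchi F u South * gam X F u * (r * sig u)"
      using 2 by (simp add: West)
    also have "\<dots> = chi F u South * gam X F u * ((if u = u0 \<and> South = d0 then -1 else 1) * r * sig u)"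
      unfolding tchi_eq[OF F(1)] by simp
    finally show ?thesis unfolding 3 using 1 by (simp add: West)
  next
    case North
    have v: "v = (x, y+1)" by (simp add: v_def North u)
    have 1: "chi F u East * gam X F u * gam X F v = (if y0 = y \<and> x < x0 then -1 else 1)"
      using coboundary_source[OF F(1), of y x, folded v_def] unfolding u v u0 by simp
    have 2: "- (tchi F v East * tchi F v North * tchi F v West) = 1"
      using par[of v] tv(1) unfolding par_def North by simp
    have 3: "(if y0 = y \<and> x < x0 then -1 else 1) * ((if u = u0 \<and> East = d0 then -1 else 1) * r * sig u) = sig v"
      using ne unfolding r_def sig_def unfolding u v u0 North by (cases d0) auto
    have "bef (tchi F u) d * gam X F u * r * sig u
       = (chi F u East * gam X F u * gam X F v) * ((if u = u0 \<and> East = d0 then -1 else 1) * r * sig u) * gam X F v"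
      unfolding North using gam_cases[of X F v] tchi_eq[OF F(1), of u East] by (auto simp: mult_ac)
    also have "\<dots> = (- (tchi F v East * tchi F v North * tchi F v West)) * gam X F v * sig v"
      unfolding 1 3 2 by simp
    finally show ?thesis by (simp add: North)
  next
    case South
    have v: "v = (x, y-1)" by (simp add: v_def South u)
    have 1: "chi F v East * gam X F v * gam X F u = (if y0 = y - 1 \<and> x < x0 then -1 else 1)"
      using coboundary_source[OF F(1), of "y - 1" x, folded v_def] unfolding u v u0 by simp
    have 2: "tchi F u East * tchi F u North * tchi F u West = 1"
      using par[of u] tv(2) unfolding par_def South v_def by simp
    have 3: "(if y0 = y - 1 \<and> x < x0 then -1 else 1) * (r * sig u) = (if v = u0 \<and> East = d0 then -1 else 1) * sig v"
      using ne unfolding r_def sig_def unfolding u v u0 South by (cases d0) auto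
    have "bef (tchi F u) d * gam X F u * r * sig u = gam X F u * (r * sig u)"
      using 2 by (simp add: South)
    also have "\<dots> = (chi F v East * gam X F v * gam X F u) * (r * sig u) * (chi F v East * gam X F v)"
      using gam_cases[of X F v] chi_cases[of F v East] by (auto simp: mult_ac)
    also have "\<dots> = (if v = u0 \<and> East = d0 then -1 else 1) * sig v * (chi F v East * gam X F v)"
      unfolding 1 3 by simp
    finally show ?thesis unfolding South tchi_eq[OF F(1)] by (simp add: mult_ac)
  qed
  show ?thesis unfolding bef_tchi_insert sgI v_def[symmetric]
    using arg_cong[OF key, of "\<lambda>z. z * gam X F u0 * bef (chi F u0) d0"]
    by (simp add: sg_def mult_ac)
qed

text \<open>The computation is that of \<open>edge_sign\<close> with the two odd vertices adjacent,
  so that the factors at \<open>u0\<close> and at its neighbour cancel against each other. The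
  remaining -1 is the fermionic sign of a closed curve; it is the origin of the minus sign in front
  of the traces.\<close>

lemma source_sign:
  assumes F: "F \<in> Conf (stp u0 d0)"
  shows "eps (opp d0) * bef (tchi F (stp u0 d0)) (opp d0) * sg F (stp u0 d0) = -1"
proof -
  define v where "v = stp u0 d0"
  obtain x0 y0 where u0: "u0 = (x0, y0)" by force
  have e: "ed u0 d0 \<notin> F" using F by (auto simp: Conf_def)
  have vX: "fst u0 \<le> X" "fst v \<le> X"
    using bound[OF srcE] bound[of v "opp d0"] srcE by (auto simp: v_def ed_opp)
  have par: "par (chi F w) = (if w = v \<or> w = u0 then -1 else 1)" for w
    using F par_tchi[OF e, of w] by (auto simp: Conf_def v_def)
  have 0: "chi F v (opp d0) = 1" "chi F u0 d0 = 1"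
    using e unfolding v_def chi_def ed_opp by auto
  have tv: "bef (tchi F v) k = bef (chi F v) k" for k
    unfolding tchi_def v_def by (cases k) simp_all
  have pv: "par (chi F v) = -1" "par (chi F u0) = -1" using par by auto
  have gg: "gam X F w * gam X F w = 1" "chi F w k * chi F w k = 1" for w k
    using gam_cases[of X F w] chi_cases[of F w k] by auto
  have "eps (opp d0) * bef (chi F v) (opp d0) * (gam X F v * gam X F u0 * bef (chi F u0) d0 * sig v) = -1"
  proof (cases d0)
    case East
    have v: "v = (x0+1, y0)" by (simp add: v_def East u0)
    have "gam X F u0 = chi F v South * gam X F v"
      using vX unfolding u0 v by (intro gam_step) auto
    moreover have "chi F v East * chi F v North = - chi F v South"
      using pv(1) 0(1) chi_cases[of F v South] unfolding par_def East by (elim disjE) simp_all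
    moreover have "sig v = -1" unfolding sig_def by (simp add: v u0)
    ultimately show ?thesis using gg(2)[of v South] gg(1)[of v] by (simp add: East) (simp add: mult_ac)
  next
    case West
    have v: "v = (x0-1, y0)" by (simp add: v_def West u0)
    have "gam X F v = chi F u0 South * gam X F u0"
      using vX(1) gam_step[of "x0-1" X F y0] unfolding u0 v by auto
    moreover have "chi F u0 East * chi F u0 North = - chi F u0 South"
      using pv(2) 0(2) chi_cases[of F u0 South] unfolding par_def West by (elim disjE) simp_all
    moreover have "sig v = 1" unfolding sig_def by (simp add: v u0)
    ultimately show ?thesis using gg(2)[of u0 South] gg(1)[of u0] by (simp add: West) (simp add: mult_ac)
  next
    case North
    have v: "v = (x0, y0+1)" by (simp add: v_def North u0)
    have "chi F u0 East * gam X F u0 * gam X F v = 1"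
      using coboundary_source[OF F, of y0 x0, folded v_def] unfolding v u0 by simp
    moreover have "chi F v East * chi F v North * chi F v West = -1"
      using pv(1) 0(1) unfolding par_def North by simp
    moreover have "sig v = -1" unfolding sig_def by (simp add: v u0)
    ultimately show ?thesis by (simp add: North) (simp add: mult_ac)
  next
    case South
    have v: "v = (x0, y0-1)" by (simp add: v_def South u0)
    have "chi F v East * gam X F v * gam X F u0 = 1"
      using coboundary_source[OF F, of "y0-1" x0, folded v_def] unfolding v u0 by simp
    moreover have "chi F u0 East * chi F u0 North * chi F u0 West = -1"
      using pv(2) 0(2) unfolding par_def South by simp
    moreover have "sig v = 1" unfolding sig_def by (simp add: v u0)
    ultimately show ?thesis by (simp add: South)
  qed
  then show ?thesis unfolding v_def[symmetric] tv sg_def .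
qed

section \<open>The lattice fermion and its linear equations\<close>

definition amp :: "vtx \<Rightarrow> dir \<Rightarrow> real" where
  "amp v k = (\<Sum>F\<in>Conf v. if tchi F v k = -1 then bef (tchi F v) k * sg F v * t ^ card F else 0)"

definition inc :: "vtx \<Rightarrow> dir \<Rightarrow> real" where
  "inc v k = eps k * (\<Sum>F\<in>Conf v. if tchi F v k = 1 then bef (tchi F v) k * sg F v * t ^ card F else 0)"

lemma finite_Conf: "finite (Conf v)"
  unfolding Conf_def by (rule finite_subset[of _ "Pow E"]) (use finE in auto)

lemma finite_in_Conf: "F \<in> Conf v \<Longrightarrow> finite F"
  unfolding Conf_def using finE finite_subset by blast

lemma vertex_relation: "inc v (opp d) = (\<Sum>d'\<in>UNIV. kwc d d' * amp v d')"
proof -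
  have "inc v (opp d) = (\<Sum>F\<in>Conf v. (eps (opp d) * (if tchi F v (opp d) = 1 then bef (tchi F v) (opp d) else 0)) * (sg F v * t ^ card F))"
    unfolding inc_def sum_distrib_left by (intro sum.cong) (auto simp: mult_ac)
  also have "\<dots> = (\<Sum>F\<in>Conf v. (\<Sum>d'\<in>UNIV. kwc d d' * (if tchi F v d' = -1 then bef (tchi F v) d' else 0)) * (sg F v * t ^ card F))"
  proof (intro sum.cong refl)
    fix F assume "F \<in> Conf v"
    then have "par (tchi F v) = -1" by (simp add: Conf_def)
    from vertex_relation_local[OF tchi_cases this]
    show "(eps (opp d) * (if tchi F v (opp d) = 1 then bef (tchi F v) (opp d) else 0)) * (sg F v * t ^ card F) =
      (\<Sum>d'\<in>UNIV. kwc d d' * (if tchi F v d' = -1 then bef (tchi F v) d' else 0)) * (sg F v * t ^ card F)"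
      by simp
  qed
  also have "\<dots> = (\<Sum>F\<in>Conf v. \<Sum>d'\<in>UNIV. kwc d d' * (if tchi F v d' = -1 then bef (tchi F v) d' * sg F v * t ^ card F else 0))"
    unfolding sum_distrib_right by (intro sum.cong refl) auto
  also have "\<dots> = (\<Sum>d'\<in>UNIV. kwc d d' * amp v d')"
    unfolding amp_def sum_distrib_left by (rule sum.swap)
  finally show ?thesis .
qed

lemma par_upd:
  assumes "c' = (\<lambda>k. if k = d then - c k else c k)"
  shows "par c' = - par c"
  unfolding assms par_def by (cases d) simp_all

lemma par_insert:
  assumes g: "ed u d \<notin> F" "ed u d \<noteq> ed u0 d0"
  shows "par (tchi (insert (ed u d) F) w) = par (tchi F w) * (if w = u \<or> w = stp u d then -1 else 1)"
proof -
  have 1: "tchi F u d = 1" "tchi F (stp u d) (opp d) = 1"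
    using g by (auto simp: tchi_def chi_def ed_opp)
  have ne: "\<not> (u = u0 \<and> d = d0)" "\<not> (stp u d = u0 \<and> opp d = d0)"
    using g(2) ed_opp[of u d] by auto
  have c: "tchi (insert (ed u d) F) w k = (if (w = u \<and> k = d) \<or> (w = stp u d \<and> k = opp d) then - tchi F w k else tchi F w k)" for k
  proof (cases "(w = u \<and> k = d) \<or> (w = stp u d \<and> k = opp d)")
    case True
    then have "tchi F w k = 1" using 1 by blast
    moreover have "chi (insert (ed u d) F) w k = -1" unfolding chi_insert using True by simp
    ultimately show ?thesis using True by (simp add: tchi_def)
  next
    case False
    then show ?thesis by (simp only: tchi_def chi_insert if_False)
  qed
  consider "w = u" | "w = stp u d" "w \<noteq> u" | "w \<noteq> u" "w \<noteq> stp u d" by blast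
  then show ?thesis
  proof cases
    case 1
    then have "tchi (insert (ed u d) F) w = (\<lambda>k. if k = d then - tchi F w k else tchi F w k)"
      by (intro ext, subst c) auto
    from par_upd[OF this] 1 show ?thesis by simp
  next
    case 2
    then have "tchi (insert (ed u d) F) w = (\<lambda>k. if k = opp d then - tchi F w k else tchi F w k)"
      by (intro ext, subst c) auto
    from par_upd[OF this] 2 show ?thesis by simp
  next
    case 3
    then have "tchi (insert (ed u d) F) w = tchi F w" by (intro ext, subst c) auto
    with 3 show ?thesis by simp
  qed
qed

lemma Conf_insert_iff:
  assumes "ed u d \<in> E" "ed u d \<notin> F" "ed u d \<noteq> ed u0 d0"
  shows "insert (ed u d) F \<in> Conf u \<longleftrightarrow> F \<in> Conf (stp u d)"
proof -
  have "par (tchi (insert (ed u d) F) w) = (if w = u then -1 else 1) \<longleftrightarrow>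
      par (tchi F w) = (if w = stp u d then -1 else 1)" for w
    unfolding par_insert[OF assms(2,3)] by auto
  then show ?thesis using assms unfolding Conf_def by auto
qed

text \<open>Erasing the occupied edge is a bijection between the configurations with odd vertex
  \<open>u\<close> that use it and those with odd vertex \<open>stp u d\<close> that do not. One
  edge less gives the factor \<open>t\<close>, and \<open>edge_sign\<close> matches the
  signs.\<close>

lemma amp_edge:
  assumes g: "ed u d \<in> E" and ne: "(u, d) \<noteq> (u0, d0)" "(u, d) \<noteq> (stp u0 d0, opp d0)"
  shows "amp u d = t * inc (stp u d) (opp d)"
proof -
  define g where "g = ed u d"
  have ge: "g \<noteq> ed u0 d0" using ne by (auto simp: g_def ed_eq_iff)
  have gE: "g \<in> E" using g by (simp add: g_def)
  have t1: "tchi F u d = -1 \<longleftrightarrow> g \<in> F" "tchi F (stp u d) (opp d) = 1 \<longleftrightarrow> g \<notin> F" for F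
    using ge ed_opp[of u d] unfolding tchi_def chi_def g_def by auto
  have "amp u d = (\<Sum>F\<in>{F\<in>Conf u. g \<in> F}. bef (tchi F u) d * sg F u * t ^ card F)"
    unfolding amp_def t1 by (rule sum.inter_filter[symmetric]) (rule finite_Conf)
  also have "\<dots> = (\<Sum>F\<in>{F\<in>Conf (stp u d). g \<notin> F}. t * (eps (opp d) * (bef (tchi F (stp u d)) (opp d) * sg F (stp u d) * t ^ card F)))"
  proof (rule sum.reindex_bij_witness[of _ "insert g" "\<lambda>F. F - {g}"])
    fix F assume F: "F \<in> {F\<in>Conf u. g \<in> F}"
    then have i: "insert g (F - {g}) = F" by auto
    show "insert g (F - {g}) = F" by (rule i)
    have "F - {g} \<in> Conf (stp u d)"
      using Conf_insert_iff[of u d "F - {g}"] gE ge F unfolding g_def[symmetric] i by auto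
    then show FC: "F - {g} \<in> {F\<in>Conf (stp u d). g \<notin> F}" by auto
    have "card F = Suc (card (F - {g}))"
      using F finite_in_Conf[of F u] by (metis (no_types, lifting) card_Suc_Diff1 mem_Collect_eq)
    then show "t * (eps (opp d) * (bef (tchi (F - {g}) (stp u d)) (opp d) * sg (F - {g}) (stp u d) * t ^ card (F - {g})))
       = bef (tchi F u) d * sg F u * t ^ card F"
      using edge_sign[OF g ne, of "F - {g}"] FC unfolding g_def[symmetric] i by (simp add: mult_ac)
  next
    fix F assume F: "F \<in> {F\<in>Conf (stp u d). g \<notin> F}"
    then show "insert g F - {g} = F" by auto
    show "insert g F \<in> {F\<in>Conf u. g \<in> F}"
      using Conf_insert_iff[of u d F] gE ge F unfolding g_def[symmetric] by auto
  qed
  also have "\<dots> = t * inc (stp u d) (opp d)"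
    unfolding inc_def t1 sum_distrib_left sum.inter_filter[OF finite_Conf]
    by (intro sum.cong refl) auto
  finally show ?thesis .
qed

definition phi :: "vtx \<Rightarrow> dir \<Rightarrow> real" where
  "phi u d = inc (stp u d) (opp d)"

end

definition evens :: "(vtx \<times> vtx) set \<Rightarrow> (vtx \<times> vtx) set set" where
  "evens E = {F. F \<subseteq> E \<and> (\<forall>v. par (chi F v) = 1)}"

definition evenpoly :: "(vtx \<times> vtx) set \<Rightarrow> real \<Rightarrow> real" where
  "evenpoly E t = (\<Sum>F\<in>evens E. t ^ card F)"

context kw_source
begin

lemma Conf_source: "Conf u0 = {F \<in> evens E. ed u0 d0 \<notin> F}"
proof -
  have "(par (tchi F w) = (if w = u0 then -1 else 1)) = (par (chi F w) = 1)" if "ed u0 d0 \<notin> F" for F w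
    unfolding par_tchi[OF that] by auto
  then have 1: "(\<forall>w. par (tchi F w) = (if w = u0 then -1 else 1)) = (\<forall>w. par (chi F w) = 1)" if "ed u0 d0 \<notin> F" for F
    using that by presburger
  show ?thesis
  proof (rule set_eqI)
    fix F
    show "F \<in> Conf u0 \<longleftrightarrow> F \<in> {F \<in> evens E. ed u0 d0 \<notin> F}"
    proof (cases "ed u0 d0 \<in> F")
      case False
      then have "F \<subseteq> E - {ed u0 d0} \<longleftrightarrow> F \<subseteq> E" by blast
      with False show ?thesis unfolding Conf_def evens_def mem_Collect_eq 1[OF False] by simp
    qed (auto simp: Conf_def)
  qed
qed

lemma par_chi_insert_source:
  assumes "ed u0 d0 \<notin> F"
  shows "par (chi (insert (ed u0 d0) F) w) = 1 \<longleftrightarrow> par (tchi F w) = (if w = stp u0 d0 then -1 else 1)"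
proof -
  have 1: "chi F u0 d0 = 1" "chi F (stp u0 d0) (opp d0) = 1"
    using assms by (auto simp: chi_def ed_opp)
  consider "w = stp u0 d0" | "w \<noteq> stp u0 d0" by blast
  then show ?thesis
  proof cases
    case 1
    then have "chi (insert (ed u0 d0) F) w = (\<lambda>k. if k = opp d0 then - tchi F w k else tchi F w k)"
      using \<open>chi F (stp u0 d0) (opp d0) = 1\<close> by (intro ext) (simp add: chi_insert tchi_def)
    from par_upd[OF this] 1 show ?thesis by auto
  next
    case 2
    then have "chi (insert (ed u0 d0) F) w = tchi F w"
      by (auto simp: chi_insert tchi_def fun_eq_iff)
    with 2 show ?thesis by simp
  qed
qed

text \<open>Adding the source edge completes these configurations to the even subgraphs through it,
  all with the sign of \<open>source_sign\<close>. Summed over the edges, the right side is minus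
  the derivative of \<open>evenpoly E\<close>.\<close>

lemma phi_source: "phi u0 d0 = - (\<Sum>F\<in>{F \<in> evens E. ed u0 d0 \<in> F}. t ^ (card F - 1))"
proof -
  define e where "e = ed u0 d0"
  have tv: "tchi F (stp u0 d0) (opp d0) = 1" if "F \<in> Conf (stp u0 d0)" for F
    using that unfolding tchi_def chi_def Conf_def by (auto simp: ed_opp)
  have "phi u0 d0 = (\<Sum>F\<in>Conf (stp u0 d0). (eps (opp d0) * bef (tchi F (stp u0 d0)) (opp d0) * sg F (stp u0 d0)) * t ^ card F)"
    unfolding phi_def inc_def sum_distrib_left by (intro sum.cong refl) (simp add: tv)
  also have "\<dots> = - (\<Sum>F\<in>Conf (stp u0 d0). t ^ card F)"
    by (simp add: source_sign sum_negf)
  also have "(\<Sum>F\<in>Conf (stp u0 d0). t ^ card F) = (\<Sum>F\<in>{F \<in> evens E. e \<in> F}. t ^ (card F - 1))"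
  proof (rule sum.reindex_bij_witness[of _ "\<lambda>F. F - {e}" "insert e"])
    fix F assume F: "F \<in> Conf (stp u0 d0)"
    then have eF: "e \<notin> F" by (auto simp: Conf_def e_def)
    then show "insert e F - {e} = F" by auto
    show "insert e F \<in> {F \<in> evens E. e \<in> F}"
      using F srcE par_chi_insert_source[of F] eF unfolding evens_def Conf_def e_def by auto
    show "t ^ (card (insert e F) - 1) = t ^ card F"
      using eF finite_in_Conf[OF F] by simp
  next
    fix F assume F: "F \<in> {F \<in> evens E. e \<in> F}"
    then show i: "insert e (F - {e}) = F" by auto
    show "F - {e} \<in> Conf (stp u0 d0)"
      using F par_chi_insert_source[of "F - {e}"] unfolding evens_def Conf_def e_def[symmetric] i by auto
  qed
  finally show ?thesis by (simp add: e_def)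
qed

text \<open>When the odd vertex returns to \<open>u0\<close> every sign occurs squared, so the
  amplitude counts the even subgraphs that avoid the source edge. Those through the edge make up the
  rest of \<open>evenpoly E t\<close>, which \<open>phi_source\<close> identifies.\<close>

lemma amp_source: "amp u0 d0 = evenpoly E t + t * phi u0 d0"
proof -
  have fin: "finite (evens E)" unfolding evens_def by (rule finite_subset[of _ "Pow E"]) (use finE in auto)
  have tv: "tchi F u0 d0 = -1" for F by (simp add: tchi_def)
  have b: "bef (tchi F u0) d0 = bef (chi F u0) d0" for F
    unfolding tchi_def by (cases d0) simp_all
  have "amp u0 d0 = (\<Sum>F\<in>Conf u0. t ^ card F)"
    unfolding amp_def
  proof (intro sum.cong refl)
    fix F :: "(vtx \<times> vtx) set"
    have "gam X F u0 * gam X F u0 = 1" using gam_cases[of X F u0] by auto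
    moreover have "bef (chi F u0) d0 * bef (chi F u0) d0 = 1"
      using bef_cases[of "chi F u0" d0, OF chi_cases] by auto
    ultimately show "(if tchi F u0 d0 = -1 then bef (tchi F u0) d0 * sg F u0 * t ^ card F else 0) = t ^ card F"
      unfolding tv b sg_def by (simp add: sig_def mult_ac)
  qed
  also have "\<dots> = evenpoly E t - (\<Sum>F\<in>{F \<in> evens E. ed u0 d0 \<in> F}. t ^ card F)"
  proof -
    have "evens E = {F \<in> evens E. ed u0 d0 \<notin> F} \<union> {F \<in> evens E. ed u0 d0 \<in> F}" by auto
    then have "evenpoly E t = (\<Sum>F\<in>{F \<in> evens E. ed u0 d0 \<notin> F} \<union> {F \<in> evens E. ed u0 d0 \<in> F}. t ^ card F)"
      by (simp only: evenpoly_def)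
    also have "\<dots> = (\<Sum>F\<in>{F \<in> evens E. ed u0 d0 \<notin> F}. t ^ card F) + (\<Sum>F\<in>{F \<in> evens E. ed u0 d0 \<in> F}. t ^ card F)"
      using fin by (intro sum.union_disjoint) auto
    finally show ?thesis by (simp add: Conf_source)
  qed
  also have "(\<Sum>F\<in>{F \<in> evens E. ed u0 d0 \<in> F}. t ^ card F) = - (t * phi u0 d0)"
    unfolding phi_source sum_distrib_left minus_minus mult_minus_right
  proof (intro sum.cong refl)
    fix F assume F: "F \<in> {F \<in> evens E. ed u0 d0 \<in> F}"
    then have "finite F" "F \<noteq> {}" using finE finite_subset unfolding evens_def by blast+
    then have "card F = Suc (card F - 1)" by (simp add: card_gt_0_iff)
    then show "t ^ card F = t * t ^ (card F - 1)" by (metis power_Suc)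
  qed
  finally show ?thesis by simp
qed

text \<open>Together with \<open>vertex_relation\<close> this reads amp = t \<Lambda> amp + S e,
  where S is \<open>evenpoly E t\<close> and e the unit vector at the source: \<open>amp\<close> is
  the column S (I - t \<Lambda>)^-1 e, and \<open>phi\<close> is its image under \<Lambda>.\<close>

lemma amp_eq: "amp u d = (if ed u d \<in> E then t * phi u d + (if u = u0 \<and> d = d0 then evenpoly E t else 0) else 0)"
proof -
  consider "ed u d \<notin> E" | "u = u0" "d = d0" | "u = stp u0 d0" "d = opp d0"
    | "ed u d \<in> E" "(u, d) \<noteq> (u0, d0)" "(u, d) \<noteq> (stp u0 d0, opp d0)" by auto
  then show ?thesis
  proof cases
    case 1
    then have "\<not> (u = u0 \<and> d = d0)" using srcE by auto
    then have "tchi F u d = 1" if "F \<in> Conf u" for F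
      using that 1 unfolding tchi_def chi_def Conf_def by auto
    then have "amp u d = 0" unfolding amp_def by (intro sum.neutral) auto
    with 1 show ?thesis by simp
  next
    case 2
    then show ?thesis using srcE amp_source by simp
  next
    \<comment> \<open>For the reversed source both sides vanish: the edge is never in a
      configuration, so \<open>amp\<close> has no terms, while the half-edge at \<open>u0\<close>
      always counts as occupied, so \<open>phi\<close> has none.\<close>
    case 3
    have "tchi F u d = 1" if "F \<in> Conf u" for F
      using that 3 ed_opp[of u0 d0] unfolding tchi_def chi_def Conf_def by auto
    then have "amp u d = 0" unfolding amp_def by (intro sum.neutral) auto
    moreover have "phi u d = 0"
      unfolding phi_def inc_def 3 by (simp add: tchi_def)
    ultimately show ?thesis using 3 by auto
  next
    case 4
    then show ?thesis using amp_edge[of u d] by (auto simp: phi_def)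
  qed
qed

lemma phi_eq: "phi u d = (\<Sum>d'\<in>UNIV. kwc d d' * (if ed (stp u d) d' \<in> E then
    t * phi (stp u d) d' + (if stp u d = u0 \<and> d' = d0 then evenpoly E t else 0) else 0))"
  using vertex_relation[of "stp u d" d] unfolding amp_eq phi_def[symmetric] .

end

section \<open>The loop expansion of the even subgraph polynomial\<close>

text \<open>The cutoff to \<open>D\<close> acts on the directed edge that is entered. Each row has
  at most four entries, so the same formula with \<open>D = UNIV\<close> is the operator of the
  whole lattice, without any question of summability.\<close>

definition kwop :: "(vtx \<times> dir) set \<Rightarrow> (vtx \<times> dir \<Rightarrow> real) \<Rightarrow> vtx \<times> dir \<Rightarrow> real" where
  "kwop D f = (\<lambda>(u, d). \<Sum>d'\<in>UNIV. kwc d d' * (if (stp u d, d') \<in> D then f (stp u d, d') else 0))"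

definition dlt :: "vtx \<times> dir \<Rightarrow> vtx \<times> dir \<Rightarrow> real" where
  "dlt p q = (if q = p then 1 else 0)"

definition kwtr :: "(vtx \<times> dir) set \<Rightarrow> nat \<Rightarrow> real" where
  "kwtr D r = (\<Sum>p\<in>D. (kwop D ^^ r) (dlt p) p)"

definition dedges :: "(vtx \<times> vtx) set \<Rightarrow> (vtx \<times> dir) set" where
  "dedges E = {(v, k). ed v k \<in> E}"

text \<open>\<open>K\<close> selects one direction out of each opposite pair. Taking East and North,
  then West and South, shows that sums over directed edges run through every edge twice.\<close>

lemma bij_betw_half:
  assumes E: "\<And>p. p \<in> E \<Longrightarrow> \<exists>v k. p = ed v k" and K: "\<And>k. k \<in> K \<longleftrightarrow> opp k \<notin> K"
  shows "bij_betw (\<lambda>(v, k). ed v k) {p \<in> dedges E. snd p \<in> K} E"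
  unfolding bij_betw_def
proof
  show "inj_on (\<lambda>(v, k). ed v k) {p \<in> dedges E. snd p \<in> K}"
  proof (rule inj_onI)
    fix p q assume pq: "p \<in> {p \<in> dedges E. snd p \<in> K}" "q \<in> {p \<in> dedges E. snd p \<in> K}"
      "(\<lambda>(v, k). ed v k) p = (\<lambda>(v, k). ed v k) q"
    obtain v k w j where eq: "p = (v, k)" "q = (w, j)" by (cases p; cases q) blast
    have "k \<in> K" "j \<in> K" using pq by (auto simp: eq)
    then have "j \<noteq> opp k" using K[of k] by auto
    then show "p = q" using pq(3) by (auto simp: ed_eq_iff eq)
  qed
  show "(\<lambda>(v, k). ed v k) ` {p \<in> dedges E. snd p \<in> K} = E"
  proof (intro equalityI subsetI)
    fix e assume e: "e \<in> E"
    then obtain v k where vk: "e = ed v k" using E by blast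
    show "e \<in> (\<lambda>(v, k). ed v k) ` {p \<in> dedges E. snd p \<in> K}"
    proof (cases "k \<in> K")
      case True
      then show ?thesis using vk e by (intro image_eqI[of _ _ "(v, k)"]) (auto simp: dedges_def)
    next
      case False
      then have "opp k \<in> K" using K[of "opp k"] by simp
      then show ?thesis using vk e by (intro image_eqI[of _ _ "(stp v k, opp k)"]) (auto simp: dedges_def ed_opp)
    qed
  qed (auto simp: dedges_def)
qed

lemma dedges_split: "dedges E = {p \<in> dedges E. snd p \<in> {East, North}} \<union> {p \<in> dedges E. snd p \<in> {West, South}}"
  using UNIV_dir by auto

lemma kwop_add: "kwop D (\<lambda>p. a * f p + b * g p) = (\<lambda>p. a * kwop D f p + b * kwop D g p)"
  unfolding kwop_def
  by (rule ext) (auto simp: sum_dir algebra_simps)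

text \<open>With \<open>B = kwc - 1\<close> one has \<open>B\<^sup>2 = 2\<close>, hence \<open>\<parallel>kwc\<parallel> = 1 + sqrt 2\<close>; the difference of the two sides
  times \<open>sqrt 2\<close> is \<open>\<parallel>(sqrt 2 - B) a\<parallel>\<^sup>2\<close>.\<close>
lemma kwc_norm: "(\<Sum>d\<in>UNIV. (\<Sum>d'\<in>UNIV. kwc d d' * a d')\<^sup>2) \<le> (1 + sqrt 2)\<^sup>2 * (\<Sum>d\<in>UNIV. (a d)\<^sup>2)"
proof -
  define q where "q = sqrt (2::real)"
  have q: "q * q = 2" and q0: "q > 0" by (auto simp: q_def)
  define e n w z where d: "e = a East" "n = a North" "w = a West" "z = a South"
  have "(q * e - n + z)^2 + (q * n - e - w)^2 + (q * w - n - z)^2 + (q * z - w + e)^2 =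
     q * ((1+q)^2 * (e^2+n^2+w^2+z^2) - ((e+n-z)^2 + (e+n+w)^2 + (n+w+z)^2 + (w+z-e)^2))"
  proof -
    have "(1 + q)\<^sup>2 = 3 + 2 * q" using q by (simp add: power2_eq_square algebra_simps)
    moreover have qq: "q * (q * x) = 2 * x" for x using q by (metis mult.assoc)
    ultimately show ?thesis by (simp only:) (simp add: power2_eq_square algebra_simps, simp add: qq)
  qed
  moreover have "0 \<le> (q * e - n + z)^2 + (q * n - e - w)^2 + (q * w - n - z)^2 + (q * z - w + e)^2" by simp
  ultimately have "0 \<le> q * ((1+q)^2 * (e^2+n^2+w^2+z^2) - ((e+n-z)^2 + (e+n+w)^2 + (n+w+z)^2 + (w+z-e)^2))"
    by simp
  then have "(e+n-z)^2 + (e+n+w)^2 + (n+w+z)^2 + (w+z-e)^2 \<le> (1+q)^2 * (e^2+n^2+w^2+z^2)"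
    using q0 by (simp add: zero_le_mult_iff)
  then show ?thesis unfolding sum_dir q_def[symmetric] d[symmetric] by (simp add: algebra_simps d)
qed

lemma inj_stp: "inj_on (\<lambda>(u, d). (stp u d, d)) A"
  by (rule inj_onI) (metis (no_types, lifting) Pair_inject case_prod_conv stp_opp surj_pair)

text \<open>Group the directed edges by their head: at each vertex the operator is a copy of the
  four by four matrix \<open>kwc\<close>, and the relabelling of (u, d) by its head and direction is
  injective. Hence the bound of \<open>kwc_norm\<close> passes to any \<open>D\<close>, with a
  constant that does not depend on \<open>D\<close>.\<close>

lemma kwop_norm:
  assumes "finite A" "finite D"
  shows "(\<Sum>p\<in>A. (kwop D f p)\<^sup>2) \<le> (1 + sqrt 2)\<^sup>2 * (\<Sum>p\<in>D. (f p)\<^sup>2)"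
proof -
  define a where "a v d = (if (v, d) \<in> D then f (v, d) else 0)" for v d
  define g where "g = (\<lambda>(v, d). (\<Sum>d'\<in>UNIV. kwc d d' * a v d')\<^sup>2)"
  define W where "W = (\<lambda>(u, d). stp u d) ` A"
  have fW: "finite W" using assms by (simp add: W_def)
  have "(\<Sum>p\<in>A. (kwop D f p)\<^sup>2) = (\<Sum>p\<in>A. g ((\<lambda>(u, d). (stp u d, d)) p))"
  proof (intro sum.cong refl)
    fix p :: "vtx \<times> dir"
    show "(kwop D f p)\<^sup>2 = g ((\<lambda>(u, d). (stp u d, d)) p)"
      by (cases p) (simp add: kwop_def g_def a_def)
  qed
  also have "\<dots> = (\<Sum>p\<in>(\<lambda>(u, d). (stp u d, d)) ` A. g p)"
    by (subst sum.reindex[OF inj_stp]) simp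
  also have "\<dots> \<le> (\<Sum>p\<in>W \<times> UNIV. g p)"
    using fW by (intro sum_mono2) (auto simp: g_def W_def)
  also have "\<dots> = (\<Sum>v\<in>W. \<Sum>d\<in>UNIV. (\<Sum>d'\<in>UNIV. kwc d d' * a v d')\<^sup>2)"
    by (simp add: g_def sum.cartesian_product)
  also have "\<dots> \<le> (\<Sum>v\<in>W. (1 + sqrt 2)\<^sup>2 * (\<Sum>d\<in>UNIV. (a v d)\<^sup>2))"
    by (intro sum_mono kwc_norm)
  also have "\<dots> = (1 + sqrt 2)\<^sup>2 * (\<Sum>p\<in>W \<times> UNIV. if p \<in> D then (f p)\<^sup>2 else 0)"
    unfolding sum_distrib_left[symmetric] sum.cartesian_product a_def
    by (intro arg_cong2[where f = "(*)"] refl sum.cong) auto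
  also have "(\<Sum>p\<in>W \<times> UNIV. if p \<in> D then (f p)\<^sup>2 else 0) = (\<Sum>p\<in>{p\<in>W \<times> UNIV. p \<in> D}. (f p)\<^sup>2)"
    using fW by (intro sum.inter_filter[symmetric]) auto
  also have "\<dots> \<le> (\<Sum>p\<in>D. (f p)\<^sup>2)"
    using assms by (intro sum_mono2) auto
  finally show ?thesis by (simp add: mult_left_mono)
qed

lemma kwop_pow_norm:
  assumes "finite D"
  shows "(\<Sum>p\<in>D. ((kwop D ^^ r) f p)\<^sup>2) \<le> ((1 + sqrt 2) ^ r)\<^sup>2 * (\<Sum>p\<in>D. (f p)\<^sup>2)"
proof (induction r)
  case (Suc r)
  have "(\<Sum>p\<in>D. ((kwop D ^^ Suc r) f p)\<^sup>2) \<le> (1 + sqrt 2)\<^sup>2 * (\<Sum>p\<in>D. ((kwop D ^^ r) f p)\<^sup>2)"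
    using kwop_norm[OF assms assms, of "(kwop D ^^ r) f"] by simp
  also have "\<dots> \<le> (1 + sqrt 2)\<^sup>2 * (((1 + sqrt 2) ^ r)\<^sup>2 * (\<Sum>p\<in>D. (f p)\<^sup>2))"
    by (intro mult_left_mono Suc) auto
  finally show ?case by (simp add: power_mult_distrib mult_ac)
qed simp

lemma kwop_pow_bound:
  assumes "finite D" "p \<in> D"
  shows "\<bar>(kwop D ^^ r) f p\<bar> \<le> (1 + sqrt 2) ^ r * sqrt (\<Sum>p\<in>D. (f p)\<^sup>2)"
proof -
  have "((kwop D ^^ r) f p)\<^sup>2 \<le> (\<Sum>p\<in>D. ((kwop D ^^ r) f p)\<^sup>2)"
    using assms by (intro member_le_sum) auto
  also note kwop_pow_norm[OF assms(1)]
  finally have "sqrt (((kwop D ^^ r) f p)\<^sup>2) \<le> sqrt (((1 + sqrt 2) ^ r)\<^sup>2 * (\<Sum>p\<in>D. (f p)\<^sup>2))"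
    by (rule real_sqrt_le_mono)
  then show ?thesis by (simp add: real_sqrt_mult)
qed

lemma kwop_dlt_bound:
  assumes "finite D" "p \<in> D"
  shows "\<bar>(kwop D ^^ r) (dlt p) p\<bar> \<le> (1 + sqrt 2) ^ r"
proof -
  have "(\<Sum>q\<in>D. (dlt p q)\<^sup>2) = (\<Sum>q\<in>D. if q = p then 1 else 0)"
    by (intro sum.cong) (auto simp: dlt_def)
  also have "\<dots> = 1" using assms by simp
  finally show ?thesis using kwop_pow_bound[OF assms, of r "dlt p"] by simp
qed

lemma kwtr_bound: "finite D \<Longrightarrow> \<bar>kwtr D r\<bar> \<le> card D * (1 + sqrt 2) ^ r"
  unfolding kwtr_def
  by (rule order_trans[OF sum_abs])
     (use kwop_dlt_bound[of D _ r] in \<open>auto intro!: sum_bounded_above[where K="(1 + sqrt 2) ^ r", simplified]\<close>)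

context kw_source
begin

lemma phi_fixpoint: "(\<lambda>(u, d). phi u d) =
   kwop (dedges E) (\<lambda>p. t * (\<lambda>(u, d). phi u d) p + evenpoly E t * dlt (u0, d0) p)"
  by (rule ext) (auto simp: kwop_def dedges_def dlt_def phi_eq[of _ _] intro!: sum.cong)

text \<open>Neumann series with its exact remainder. Invertibility of I - t \<Lambda> is never
  invoked: the remainder is controlled by the norm bound and tends to zero for
  \<open>t * (1 + sqrt 2) < 1\<close>.\<close>

lemma phi_iterate: "(\<lambda>(u, d). phi u d) =
   (\<lambda>p. (\<Sum>r<n. evenpoly E t * t ^ r * (kwop (dedges E) ^^ Suc r) (dlt (u0, d0)) p)
     + t ^ n * (kwop (dedges E) ^^ n) (\<lambda>(u, d). phi u d) p)"
proof (induction n)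
  case (Suc n)
  define K where "K = kwop (dedges E)"
  define f where "f = (\<lambda>(u, d). phi u d)"
  have lin: "(K ^^ n) (\<lambda>p. a * f p + b * g p) = (\<lambda>p. a * (K ^^ n) f p + b * (K ^^ n) g p)" for f g a b
    by (induction n) (simp_all add: K_def kwop_add)
  have "(K ^^ n) f = (K ^^ n) (K (\<lambda>p. t * f p + evenpoly E t * dlt (u0, d0) p))"
    using phi_fixpoint unfolding f_def K_def by simp
  also have "\<dots> = K ((K ^^ n) (\<lambda>p. t * f p + evenpoly E t * dlt (u0, d0) p))"
    by (metis funpow_swap1)
  also have "\<dots> = (\<lambda>p. t * (K ^^ Suc n) f p + evenpoly E t * (K ^^ Suc n) (dlt (u0, d0)) p)"
    unfolding lin by (simp add: K_def kwop_add)
  finally have step: "(K ^^ n) f = (\<lambda>p. t * (K ^^ Suc n) f p + evenpoly E t * (K ^^ Suc n) (dlt (u0, d0)) p)" .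
  have "t ^ n * (K ^^ n) f p = evenpoly E t * t ^ n * (K ^^ Suc n) (dlt (u0, d0)) p + t ^ Suc n * (K ^^ Suc n) f p" for p
    using fun_cong[OF step, of p] by (simp add: algebra_simps del: funpow.simps)
  note step' = this
  have IH: "f p = (\<Sum>r<n. evenpoly E t * t ^ r * (K ^^ Suc r) (dlt (u0, d0)) p) + t ^ n * (K ^^ n) f p" for p
    using fun_cong[OF Suc, of p] unfolding K_def f_def .
  show ?case unfolding K_def[symmetric] f_def[symmetric]
  proof (rule ext)
    fix p
    show "f p = (\<Sum>r<Suc n. evenpoly E t * t ^ r * (K ^^ Suc r) (dlt (u0, d0)) p) + t ^ Suc n * (K ^^ Suc n) f p"
      using IH[of p] step'[of p] unfolding sum.lessThan_Suc by linarith
  qed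
qed simp

end

lemma (in kw_graph) finite_dedges: "finite (dedges E)"
proof -
  have "dedges E \<subseteq> (fst ` E \<union> snd ` E) \<times> UNIV"
  proof
    fix p assume "p \<in> dedges E"
    then obtain v k where "p = (v, k)" "ed v k \<in> E" by (auto simp: dedges_def)
    then show "p \<in> (fst ` E \<union> snd ` E) \<times> UNIV" by (cases k) force+
  qed
  then show ?thesis by (rule finite_subset) (use finE in auto)
qed

lemma (in kw_source) phi_sums:
  assumes t: "0 \<le> t" "t * (1 + sqrt 2) < 1"
  shows "(\<lambda>r. evenpoly E t * t ^ r * (kwop (dedges E) ^^ Suc r) (dlt (u0, d0)) (u0, d0)) sums phi u0 d0"
proof -
  define f where "f = (\<lambda>(u, d). phi u d)"
  define C where "C = sqrt (\<Sum>p\<in>dedges E. (f p)\<^sup>2)"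
  define q where "q = t * (1 + sqrt 2)"
  have pin: "(u0, d0) \<in> dedges E" using srcE by (simp add: dedges_def)
  have a: "(\<lambda>n. q ^ n * C) \<longlonglongrightarrow> 0"
    using t LIMSEQ_power_zero[of q] tendsto_mult_left_zero[of "\<lambda>n. q ^ n" sequentially C] by (simp add: q_def)
  have b: "norm (t ^ n * (kwop (dedges E) ^^ n) f (u0, d0)) \<le> q ^ n * C" for n
    using mult_left_mono[OF kwop_pow_bound[OF finite_dedges pin, of n f], of "t ^ n"] t
    by (simp add: abs_mult q_def power_mult_distrib C_def mult_ac)
  have 0: "(\<lambda>n. t ^ n * (kwop (dedges E) ^^ n) f (u0, d0)) \<longlonglongrightarrow> 0"
    by (rule Lim_null_comparison[OF always_eventually a]) (use b in blast)
  have f0: "f (u0, d0) = phi u0 d0" by (simp add: f_def)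
  have "(\<Sum>r<n. evenpoly E t * t ^ r * (kwop (dedges E) ^^ Suc r) (dlt (u0, d0)) (u0, d0))
     = phi u0 d0 - t ^ n * (kwop (dedges E) ^^ n) f (u0, d0)" for n
    using fun_cong[OF phi_iterate[of n, folded f_def], of "(u0, d0)"] unfolding f0 by linarith
  then show ?thesis unfolding sums_def using tendsto_diff[OF tendsto_const 0, of "phi u0 d0"] by simp
qed

section \<open>The logarithmic derivative of the even subgraph polynomial\<close>

context kw_graph
begin

lemma finite_evens: "finite (evens E)"
  unfolding evens_def by (rule finite_subset[of _ "Pow E"]) (use finE in auto)

lemma sum_dedges: "(\<Sum>(v, k)\<in>dedges E. g (ed v k)) = 2 * (\<Sum>e\<in>E. g e :: real)"
proof -
  have half: "(\<Sum>p\<in>{p \<in> dedges E. snd p \<in> K}. g ((\<lambda>(v, k). ed v k) p)) = sum g E"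
    if "\<And>k. k \<in> K \<longleftrightarrow> opp k \<notin> K" for K
    by (rule sum.reindex_bij_betw[OF bij_betw_half[OF rangeE that]])
  have "(\<Sum>p\<in>dedges E. g ((\<lambda>(v, k). ed v k) p)) =
      (\<Sum>p\<in>{p \<in> dedges E. snd p \<in> {East, North}}. g ((\<lambda>(v, k). ed v k) p))
    + (\<Sum>p\<in>{p \<in> dedges E. snd p \<in> {West, South}}. g ((\<lambda>(v, k). ed v k) p))"
    by (subst dedges_split, rule sum.union_disjoint) (use finite_dedges in auto)
  also have "\<dots> = sum g E + sum g E"
    by (intro arg_cong2[where f="(+)"] half; case_tac k; simp)
  finally show ?thesis by (simp add: case_prod_unfold)
qed

lemma evenpoly_pos: "t \<ge> 0 \<Longrightarrow> evenpoly E t > 0"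
proof -
  assume t: "t \<ge> 0"
  have "{} \<in> evens E" by (simp add: evens_def chi_def par_def)
  then have "t ^ card ({} :: (vtx \<times> vtx) set) \<le> evenpoly E t"
    unfolding evenpoly_def using finite_evens t by (intro member_le_sum) auto
  then show ?thesis by simp
qed

lemma evenpoly_0: "evenpoly E 0 = 1"
proof -
  have "{} \<in> evens E" by (simp add: evens_def chi_def par_def)
  moreover have "(0::real) ^ card F = (if F = {} then 1 else 0)" if "F \<in> evens E" for F
    using that finite_subset[OF _ finE, of F] by (auto simp: evens_def)
  ultimately show ?thesis unfolding evenpoly_def using finite_evens by (simp cong: sum.cong)
qed

text \<open>The derivative is arranged edge by edge, because the inner sum for one edge is what
  \<open>phi_source\<close> delivers at that edge.\<close>

lemma evenpoly_deriv:
  "(evenpoly E has_field_derivative (\<Sum>e\<in>E. \<Sum>F\<in>{F \<in> evens E. e \<in> F}. t ^ (card F - 1))) (at t)"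
proof -
  have "(evenpoly E has_field_derivative (\<Sum>F\<in>evens E. real (card F) * t ^ (card F - Suc 0))) (at t)"
    unfolding evenpoly_def[abs_def] by (auto intro!: derivative_eq_intros)
  also have "(\<Sum>F\<in>evens E. real (card F) * t ^ (card F - Suc 0)) = (\<Sum>F\<in>evens E. \<Sum>e\<in>E. if e \<in> F then t ^ (card F - 1) else 0)"
  proof (intro sum.cong refl)
    fix F assume F: "F \<in> evens E"
    then have "(\<Sum>e\<in>E. if e \<in> F then t ^ (card F - 1) else 0) = (\<Sum>e\<in>{e\<in>E. e \<in> F}. t ^ (card F - 1))"
      using finE by (intro sum.inter_filter[symmetric])
    also have "{e\<in>E. e \<in> F} = F" using F by (auto simp: evens_def)
    finally show "real (card F) * t ^ (card F - Suc 0) = (\<Sum>e\<in>E. if e \<in> F then t ^ (card F - 1) else 0)" by simp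
  qed
  also have "\<dots> = (\<Sum>e\<in>E. \<Sum>F\<in>{F \<in> evens E. e \<in> F}. t ^ (card F - 1))"
    unfolding sum.inter_filter[OF finite_evens] by (rule sum.swap)
  finally show ?thesis .
qed

text \<open>Every directed edge serves once as the source, and the diagonal entries add up to the
  trace. The two directions of an edge give the same value, hence the factor 1/2.\<close>

lemma evenpoly_log_deriv:
  assumes t: "0 \<le> t" "t * (1 + sqrt 2) < 1"
  shows "(\<lambda>r. - (t ^ r * kwtr (dedges E) (Suc r) / 2)) sums
    ((\<Sum>e\<in>E. \<Sum>F\<in>{F \<in> evens E. e \<in> F}. t ^ (card F - 1)) / evenpoly E t)"
proof -
  define S where "S = evenpoly E t"
  define g where "g e = (\<Sum>F\<in>{F \<in> evens E. e \<in> F}. t ^ (card F - 1))" for e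
  have S0: "S > 0" unfolding S_def using t(1) by (rule evenpoly_pos)
  have "(\<lambda>r. S * t ^ r * (kwop (dedges E) ^^ Suc r) (dlt p) p) sums (- g (ed (fst p) (snd p)))"
    if "p \<in> dedges E" for p
  proof -
    obtain u d where p: "p = (u, d)" by (cases p)
    interpret kw_source E X u d t
      by unfold_locales (use that p in \<open>auto simp: dedges_def\<close>)
    show ?thesis using phi_sums[OF t] phi_source by (simp add: p g_def S_def)
  qed
  then have "(\<lambda>r. \<Sum>p\<in>dedges E. S * t ^ r * (kwop (dedges E) ^^ Suc r) (dlt p) p) sums (\<Sum>p\<in>dedges E. - g (ed (fst p) (snd p)))"
    by (intro sums_sum)
  also have "(\<lambda>r. \<Sum>p\<in>dedges E. S * t ^ r * (kwop (dedges E) ^^ Suc r) (dlt p) p) = (\<lambda>r. S * (t ^ r * kwtr (dedges E) (Suc r)))"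
    unfolding kwtr_def by (simp add: sum_distrib_left mult_ac)
  also have "(\<Sum>p\<in>dedges E. - g (ed (fst p) (snd p))) = - 2 * (\<Sum>e\<in>E. g e)"
    using sum_dedges[of g] by (simp add: sum_negf case_prod_unfold)
  finally have "(\<lambda>r. - (1 / (2 * S)) * (S * (t ^ r * kwtr (dedges E) (Suc r)))) sums (- (1 / (2 * S)) * (- 2 * (\<Sum>e\<in>E. g e)))"
    by (rule sums_mult)
  then show ?thesis using S0 unfolding S_def[symmetric] g_def[symmetric] by (simp add: field_simps)
qed

text \<open>Both sides vanish at 0 and have the same derivative on the interval from 0 to 1 / (1 +
  sqrt 2). The logarithm is harmless there since \<open>evenpoly\<close> has nonnegative
  coefficients and constant term 1.\<close>

theorem ln_evenpoly:
  assumes t: "0 \<le> t" "t * (1 + sqrt 2) < 1"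
  shows "(\<lambda>r. - (t ^ Suc r * kwtr (dedges E) (Suc r) / (2 * real (Suc r)))) sums ln (evenpoly E t)"
proof -
  define c where "c n = (if n = 0 then 0 else - (kwtr (dedges E) n / (2 * real n)))" for n
  define G where "G x = (\<Sum>n. c n * x ^ n)" for x
  define R where "R = 1 / (1 + sqrt (2::real))"
  define T where "T = {0..<R}"
  have q: "1 + sqrt (2::real) > 0" by (simp add: add_pos_nonneg)
  have inT: "x \<in> T \<longleftrightarrow> 0 \<le> x \<and> x * (1 + sqrt 2) < 1" for x
    using q by (auto simp: T_def R_def field_simps)
  have cb: "\<bar>c n\<bar> \<le> card (dedges E) * (1 + sqrt 2) ^ n" for n
  proof (cases "n = 0")
    case False
    then have "\<bar>c n\<bar> = \<bar>kwtr (dedges E) n\<bar> / (2 * real n)" by (simp add: c_def)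
    also have "\<dots> \<le> \<bar>kwtr (dedges E) n\<bar>"
      using False divide_left_mono[of 1 "2 * real n" "\<bar>kwtr (dedges E) n\<bar>"] by simp
    finally show ?thesis using kwtr_bound[OF finite_dedges, of n] by linarith
  qed (simp add: c_def)
  have summ: "summable (\<lambda>n. c n * x ^ n)" if "x \<in> T" for x
  proof (rule summable_comparison_test')
    show "summable (\<lambda>n. card (dedges E) * (x * (1 + sqrt 2)) ^ n)"
      using that q by (intro summable_mult summable_geometric) (auto simp: inT abs_mult)
    show "norm (c n * x ^ n) \<le> card (dedges E) * (x * (1 + sqrt 2)) ^ n" if "n \<ge> 0" for n
      using mult_right_mono[OF cb, of "x ^ n"] \<open>x \<in> T\<close> by (simp add: abs_mult inT power_mult_distrib mult_ac)
  qed
  have G: "(G has_field_derivative (\<Sum>n. diffs c n * x ^ n)) (at x)" if xT: "x \<in> T" for x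
  proof -
    \<comment> \<open>Termwise differentiation at \<open>x\<close> needs convergence at a point of
      larger modulus; the interval \<open>T\<close> is open on the right to provide it.\<close>
    obtain y where y: "x < y" "y < R" using xT dense[of x R] unfolding T_def by auto
    then have "y \<in> T" using xT by (auto simp: T_def)
    show ?thesis unfolding G_def
      by (rule termdiffs_strong[OF summ[OF \<open>y \<in> T\<close>]]) (use xT y in \<open>auto simp: T_def\<close>)
  qed
  have df: "diffs c n = - (kwtr (dedges E) (Suc n) / 2)" for n
    unfolding diffs_def c_def by (simp add: field_simps del: of_nat_Suc)
  have "((\<lambda>x. ln (evenpoly E x) - G x) has_field_derivative 0) (at x within T)" if x: "x \<in> T" for x
  proof -
    have pos: "evenpoly E x > 0" using x by (intro evenpoly_pos) (simp add: inT)
    define S' where "S' = (\<Sum>e\<in>E. \<Sum>F\<in>{F \<in> evens E. e \<in> F}. x ^ (card F - 1))"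
    have "(\<Sum>n. diffs c n * x ^ n) = S' / evenpoly E x"
      using evenpoly_log_deriv[of x] x unfolding df S'_def by (simp add: inT sums_iff mult_ac)
    with G[OF x] have "(G has_field_derivative S' / evenpoly E x) (at x)" by simp
    moreover have "((\<lambda>x. ln (evenpoly E x)) has_field_derivative S' / evenpoly E x) (at x)"
      using DERIV_chain2[OF DERIV_ln_divide[OF pos] evenpoly_deriv] by (simp add: S'_def)
    ultimately show ?thesis using DERIV_diff has_field_derivative_at_within by fastforce
  qed
  moreover have "convex T" by (simp add: T_def)
  ultimately obtain k where k: "\<And>x. x \<in> T \<Longrightarrow> ln (evenpoly E x) - G x = k"
    using has_field_derivative_zero_constant[of T "\<lambda>x. ln (evenpoly E x) - G x"] by blast
  have "0 \<in> T" using q by (simp add: inT)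
  moreover have "G 0 = 0" unfolding G_def using suminf_finite[of "{0}" "\<lambda>n. c n * 0 ^ n"] by (simp add: c_def power_0_left)
  ultimately have "k = 0" using k[of 0] by (simp add: evenpoly_0)
  have tT: "t \<in> T" using t by (simp add: inT)
  then have "ln (evenpoly E t) = G t" using k[OF tT] \<open>k = 0\<close> by simp
  then have "(\<lambda>n. c n * t ^ n) sums ln (evenpoly E t)"
    using summ[OF tT] by (simp add: G_def summable_sums)
  then have "(\<lambda>n. c (Suc n) * t ^ Suc n) sums (ln (evenpoly E t) - c 0 * t ^ 0)"
    by (subst sums_Suc_iff) simp
  then show ?thesis by (simp add: c_def mult_ac del: of_nat_Suc power_Suc)
qed

end

section \<open>High and low temperature expansions\<close>

lemma adj_pt_less_iff: "adj u v \<and> pt_less u v \<longleftrightarrow> v = stp u East \<or> v = stp u North"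
proof -
  obtain x y x' y' where "u = (x, y)" "v = (x', y')" by (cases u; cases v) blast
  then show ?thesis by (auto simp: adj_def pt_less_def)
qed

lemma ed_in_rectE: "ed v k \<in> rectE R \<longleftrightarrow> v \<in> rectV R \<and> stp v k \<in> rectV R"
proof -
  have 1: "(u, stp u East) \<in> rectE R \<longleftrightarrow> u \<in> rectV R \<and> stp u East \<in> rectV R"
    "(u, stp u North) \<in> rectE R \<longleftrightarrow> u \<in> rectV R \<and> stp u North \<in> rectV R" for u
    using adj_pt_less_iff[of u "stp u East"] adj_pt_less_iff[of u "stp u North"] by (auto simp: rectE_def)
  show ?thesis
  proof (cases k)
    case West
    have "stp (stp v West) East = v" using stp_opp[of v West] by simp
    then show ?thesis using 1(1)[of "stp v West"] by (auto simp: West)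
  next
    case South
    have "stp (stp v South) North = v" using stp_opp[of v South] by simp
    then show ?thesis using 1(2)[of "stp v South"] by (auto simp: South)
  qed (use 1 in simp_all)
qed

lemma rectE_ed: "p \<in> rectE R \<Longrightarrow> \<exists>v k. p = ed v k \<and> (k = East \<or> k = North)"
proof -
  assume p: "p \<in> rectE R"
  obtain u v where "p = (u, v)" by (cases p)
  with p have "v = stp u East \<or> v = stp u North" using adj_pt_less_iff by (auto simp: rectE_def)
  with \<open>p = (u, v)\<close> have "p = ed u East \<or> p = ed u North" by auto
  then show ?thesis by blast
qed

lemma finite_rectV [simp]: "finite (rectV R)"
  by (cases R) (simp add: rectV_def)

lemma finite_rectE [simp]: "finite (rectE R)"
  by (rule finite_subset[of _ "rectV R \<times> rectV R"]) (auto simp: rectE_def)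

lemma in_rectV: "(x, y) \<in> rectV (a, b, c, d) \<longleftrightarrow> a \<le> x \<and> x \<le> b \<and> c \<le> y \<and> y \<le> d"
  by (auto simp: rectV_def)

lemma kw_graph_rectE: "kw_graph (rectE (a, b, c, d)) b"
proof
  fix v k assume "ed v k \<in> rectE (a, b, c, d)"
  then show "fst v \<le> b" unfolding ed_in_rectE by (cases v) (simp add: in_rectV)
next
  show "finite (rectE (a, b, c, d))" by simp
  show "\<exists>v k. p = ed v k" if "p \<in> rectE (a, b, c, d)" for p
    using rectE_ed[OF that] by blast
qed

lemma kw_graph_rect: "kw_graph (rectE R) (fst (snd R))"
  using kw_graph_rectE by (cases R) simp

text \<open>An edge contributes one factor for each end, and its ends are the tails of its two
  directed versions. This turns a product over edges into one that can be sorted by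
  vertices.\<close>

lemma prod_dedges:
  assumes E: "\<And>p. p \<in> E \<Longrightarrow> \<exists>v k. p = ed v k" and fin: "finite (dedges E)"
  shows "(\<Prod>p\<in>dedges E. f (fst p)) = (\<Prod>(u, v)\<in>E. f u * f v :: 'a :: comm_monoid_mult)"
proof -
  have half: "(\<Prod>p\<in>{p \<in> dedges E. snd p \<in> K}. g ((\<lambda>(v, k). ed v k) p)) = prod g E"
    if "\<And>k. k \<in> K \<longleftrightarrow> opp k \<notin> K" for K and g :: "vtx \<times> vtx \<Rightarrow> 'a"
    by (rule prod.reindex_bij_betw[OF bij_betw_half[OF E that]])
  have "(\<Prod>p\<in>dedges E. f (fst p)) = (\<Prod>p\<in>{p \<in> dedges E. snd p \<in> {East, North}}. f (fst p)) * (\<Prod>p\<in>{p \<in> dedges E. snd p \<in> {West, South}}. f (fst p))"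
    by (subst dedges_split, rule prod.union_disjoint) (use fin in auto)
  also have "(\<Prod>p\<in>{p \<in> dedges E. snd p \<in> {East, North}}. f (fst p)) = (\<Prod>p\<in>{p \<in> dedges E. snd p \<in> {East, North}}. (f \<circ> fst) ((\<lambda>(v, k). ed v k) p))"
    by (intro prod.cong) auto
  also have "\<dots> = (\<Prod>p\<in>E. (f \<circ> fst) p)" by (rule half) (case_tac k; simp)
  also have "(\<Prod>p\<in>{p \<in> dedges E. snd p \<in> {West, South}}. f (fst p)) = (\<Prod>p\<in>{p \<in> dedges E. snd p \<in> {West, South}}. (f \<circ> snd) ((\<lambda>(v, k). ed v k) p))"
    by (intro prod.cong) auto
  also have "\<dots> = (\<Prod>p\<in>E. (f \<circ> snd) p)" by (rule half) (case_tac k; simp)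
  finally show ?thesis by (simp add: prod.distrib case_prod_unfold)
qed

text \<open>The sum over spins factorises over the vertices. At a vertex the spins 1 and -1
  contribute 1 and the degree sign, so the factor is 2 at even degree and 0 at odd degree.\<close>

lemma spin_sum:
  assumes F: "F \<subseteq> rectE R"
  shows "(\<Sum>\<sigma>\<in>rectV R \<rightarrow>\<^sub>E {-1, 1 :: int}. \<Prod>(u, v)\<in>F. real_of_int (\<sigma> u * \<sigma> v)) =
    (if F \<in> evens (rectE R) then 2 ^ card (rectV R) else 0)"
proof -
  interpret kw_graph "rectE R" "fst (snd R)" by (rule kw_graph_rect)
  have FV: "dedges F \<subseteq> rectV R \<times> UNIV"
  proof
    fix p assume p: "p \<in> dedges F"
    obtain v k where "p = (v, k)" by (cases p)
    with p F ed_in_rectE[of v k R] show "p \<in> rectV R \<times> UNIV" by (auto simp: dedges_def)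
  qed
  then have finD: "finite (dedges F)" by (rule finite_subset) simp
  define g where "g w s = (\<Prod>k\<in>UNIV. if ed w k \<in> F then real_of_int s else 1)" for w s
  have g: "(\<Prod>(u, v)\<in>F. real_of_int (\<sigma> u * \<sigma> v)) = (\<Prod>w\<in>rectV R. g w (\<sigma> w))" for \<sigma> :: "vtx \<Rightarrow> int"
  proof -
    have "(\<Prod>(u, v)\<in>F. real_of_int (\<sigma> u * \<sigma> v)) = (\<Prod>p\<in>dedges F. real_of_int (\<sigma> (fst p)))"
      using prod_dedges[of F "\<lambda>v. real_of_int (\<sigma> v)"] F finD rangeE by fastforce
    also have "\<dots> = (\<Prod>p\<in>{p \<in> rectV R \<times> UNIV. p \<in> dedges F}. real_of_int (\<sigma> (fst p)))"
      using FV by (intro prod.cong) auto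
    also have "\<dots> = (\<Prod>p\<in>rectV R \<times> UNIV. if p \<in> dedges F then real_of_int (\<sigma> (fst p)) else 1)"
      by (rule prod.inter_filter) simp
    also have "\<dots> = (\<Prod>w\<in>rectV R. g w (\<sigma> w))"
      by (simp add: g_def prod.cartesian_product dedges_def case_prod_unfold)
    finally show ?thesis .
  qed
  have g2: "g w (-1) = par (chi F w)" "g w 1 = 1" for w
    by (simp_all add: g_def par_def chi_def UNIV_dir)
  have par_cases: "par (chi F w) = 1 \<or> par (chi F w) = -1" for w
    unfolding par_def using chi_cases[of F w East] chi_cases[of F w North] chi_cases[of F w West] chi_cases[of F w South]
    by (elim disjE) simp_all
  have "(\<Sum>\<sigma>\<in>rectV R \<rightarrow>\<^sub>E {-1, 1 :: int}. \<Prod>(u, v)\<in>F. real_of_int (\<sigma> u * \<sigma> v))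
     = (\<Prod>w\<in>rectV R. \<Sum>s\<in>{-1, 1}. g w s)"
    unfolding g by (rule prod_sum_PiE[symmetric]) auto
  also have "\<dots> = (\<Prod>w\<in>rectV R. 1 + par (chi F w))" by (simp add: g2 add.commute)
  also have "\<dots> = (if F \<in> evens (rectE R) then 2 ^ card (rectV R) else 0)"
  proof (cases "\<forall>w\<in>rectV R. par (chi F w) = 1")
    case True
    have "par (chi F w) = 1" for w
    proof (cases "w \<in> rectV R")
      case False
      then have "ed w k \<notin> F" for k using F ed_in_rectE by blast
      then have "chi F w k = 1" for k by (simp add: chi_def)
      then show ?thesis by (simp add: par_def)
    qed (use True in blast)
    then show ?thesis using F True by (simp add: evens_def)
  next
    case False
    then obtain w where w: "w \<in> rectV R" "par (chi F w) = -1" using par_cases by blast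
    have "F \<notin> evens (rectE R)"
    proof
      assume "F \<in> evens (rectE R)"
      then have "par (chi F w) = 1" by (simp add: evens_def)
      with w show False by simp
    qed
    then show ?thesis using w by (auto intro!: bexI[of _ w])
  qed
  finally show ?thesis .
qed

lemma finite_Omega [simp]: "finite (Omega bc R)"
  unfolding Omega_def by (rule finite_subset[of _ "rectV R \<rightarrow>\<^sub>E {-1, 1}"]) (auto intro!: finite_PiE)

lemma Omega_Free: "Omega Free R = rectV R \<rightarrow>\<^sub>E {-1, 1}"
  by (auto simp: Omega_def)

lemma rectE_D: "(u, v) \<in> rectE R \<Longrightarrow> u \<in> rectV R \<and> v \<in> rectV R"
  by (auto simp: rectE_def)

lemma spin_cases: "\<sigma> \<in> Omega bc R \<Longrightarrow> u \<in> rectV R \<Longrightarrow> \<sigma> u = 1 \<or> \<sigma> u = -1"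
  using PiE_mem[of \<sigma> "rectV R" "\<lambda>_. {-1, 1}" u] by (auto simp: Omega_def)

lemma spin_prod_cases: "\<sigma> \<in> Omega bc R \<Longrightarrow> (u, v) \<in> rectE R \<Longrightarrow> \<sigma> u * \<sigma> v = 1 \<or> \<sigma> u * \<sigma> v = -1"
  using spin_cases[of \<sigma> bc R u] spin_cases[of \<sigma> bc R v] rectE_D[of u v R] by auto

text \<open>For s = 1 or s = -1 one has exp (\<beta> s) = cosh \<beta> (1 + s tanh \<beta>).
  Expanding the product over the edges and summing over the spins leaves only the even
  subgraphs.\<close>

theorem high_temperature:
  "Zpart Free R \<beta> = 2 ^ card (rectV R) * cosh \<beta> ^ card (rectE R) * evenpoly (rectE R) (tanh \<beta>)"
proof -
  interpret kw_graph "rectE R" "fst (snd R)" by (rule kw_graph_rect)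
  let ?E = "rectE R"
  have ex: "exp (\<beta> * real_of_int (\<sigma> u * \<sigma> v)) = cosh \<beta> * (tanh \<beta> * real_of_int (\<sigma> u * \<sigma> v) + 1)"
    if "\<sigma> \<in> Omega Free R" "(u, v) \<in> ?E" for \<sigma> u v
  proof -
    have "cosh \<beta> * tanh \<beta> = sinh \<beta>" by (simp add: tanh_def)
    then have 1: "cosh \<beta> * (tanh \<beta> * r + 1) = cosh \<beta> + sinh \<beta> * r" for r
      by (simp add: algebra_simps)
    show ?thesis unfolding 1 using spin_prod_cases[OF that] cosh_plus_sinh[of \<beta>] cosh_minus_sinh[of \<beta>]
      by (elim disjE) (simp_all del: of_int_mult)
  qed
  have "Zpart Free R \<beta> = (\<Sum>\<sigma>\<in>Omega Free R. \<Prod>e\<in>?E. cosh \<beta> * (tanh \<beta> * real_of_int (\<sigma> (fst e) * \<sigma> (snd e)) + 1))"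
    unfolding Zpart_def by (intro sum.cong prod.cong) (auto simp: ex simp del: of_int_mult)
  also have "\<dots> = cosh \<beta> ^ card ?E * (\<Sum>\<sigma>\<in>Omega Free R. \<Sum>F\<in>Pow ?E. tanh \<beta> ^ card F * (\<Prod>(u, v)\<in>F. real_of_int (\<sigma> u * \<sigma> v)))"
    by (simp add: prod.distrib prod_add sum_distrib_left case_prod_unfold)
  also have "(\<Sum>\<sigma>\<in>Omega Free R. \<Sum>F\<in>Pow ?E. tanh \<beta> ^ card F * (\<Prod>(u, v)\<in>F. real_of_int (\<sigma> u * \<sigma> v))) =
     (\<Sum>F\<in>Pow ?E. tanh \<beta> ^ card F * (if F \<in> evens ?E then 2 ^ card (rectV R) else 0))"
    by (subst sum.swap, intro sum.cong refl) (simp add: Omega_Free sum_distrib_left[symmetric] spin_sum del: of_int_mult)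
  also have "\<dots> = (\<Sum>F\<in>{F \<in> Pow ?E. F \<in> evens ?E}. tanh \<beta> ^ card F * 2 ^ card (rectV R))"
    by (subst sum.inter_filter) (auto intro!: sum.cong)
  also have "{F \<in> Pow ?E. F \<in> evens ?E} = evens ?E" by (auto simp: evens_def)
  finally show ?thesis by (simp add: evenpoly_def sum_distrib_right[symmetric] mult_ac)
qed

section \<open>Comparison of temperatures and of boundary conditions\<close>

definition energy :: "rect \<Rightarrow> (vtx \<Rightarrow> int) \<Rightarrow> real" where
  "energy R \<sigma> = (\<Sum>(u, v)\<in>rectE R. real_of_int (\<sigma> u * \<sigma> v))"

lemma Zpart_energy: "Zpart bc R \<beta> = (\<Sum>\<sigma>\<in>Omega bc R. exp (\<beta> * energy R \<sigma>))"
  unfolding Zpart_def energy_def by (simp add: exp_sum sum_distrib_left case_prod_unfold)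

lemma Omega_const: "(\<lambda>u\<in>rectV R. 1) \<in> Omega bc R"
  by (auto simp: Omega_def rect_boundary_def)

lemma Zpart_pos: "Zpart bc R \<beta> > 0"
  unfolding Zpart_energy using Omega_const[of R bc] by (intro sum_pos) auto

lemma energy_bound: "\<sigma> \<in> Omega bc R \<Longrightarrow> \<bar>energy R \<sigma>\<bar> \<le> card (rectE R)"
  unfolding energy_def
proof (rule order_trans[OF sum_abs])
  assume s: "\<sigma> \<in> Omega bc R"
  have "(\<Sum>e\<in>rectE R. \<bar>case e of (u, v) \<Rightarrow> real_of_int (\<sigma> u * \<sigma> v)\<bar>) \<le> (\<Sum>e\<in>rectE R. 1)"
  proof (intro sum_mono)
    fix e assume "e \<in> rectE R"
    then show "\<bar>case e of (u, v) \<Rightarrow> real_of_int (\<sigma> u * \<sigma> v)\<bar> \<le> 1"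
      using spin_prod_cases[OF s, of "fst e" "snd e"] by (cases e) (auto simp del: of_int_mult)
  qed
  then show "(\<Sum>e\<in>rectE R. \<bar>case e of (u, v) \<Rightarrow> real_of_int (\<sigma> u * \<sigma> v)\<bar>) \<le> card (rectE R)" by simp
qed

lemma Zpart_lipschitz: "ln (Zpart bc R \<beta>) \<le> ln (Zpart bc R \<gamma>) + \<bar>\<beta> - \<gamma>\<bar> * card (rectE R)"
proof -
  have "Zpart bc R \<beta> \<le> exp (\<bar>\<beta> - \<gamma>\<bar> * card (rectE R)) * Zpart bc R \<gamma>"
    unfolding Zpart_energy sum_distrib_left
  proof (intro sum_mono)
    fix \<sigma> assume s: "\<sigma> \<in> Omega bc R"
    have "(\<beta> - \<gamma>) * energy R \<sigma> \<le> \<bar>(\<beta> - \<gamma>) * energy R \<sigma>\<bar>" by simp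
    also have "\<dots> \<le> \<bar>\<beta> - \<gamma>\<bar> * card (rectE R)"
      unfolding abs_mult by (intro mult_left_mono energy_bound[OF s]) auto
    finally show "exp (\<beta> * energy R \<sigma>) \<le> exp (\<bar>\<beta> - \<gamma>\<bar> * card (rectE R)) * exp (\<gamma> * energy R \<sigma>)"
      by (simp add: exp_add[symmetric] algebra_simps)
  qed
  then have "ln (Zpart bc R \<beta>) \<le> ln (exp (\<bar>\<beta> - \<gamma>\<bar> * card (rectE R)) * Zpart bc R \<gamma>)"
    by (intro ln_mono) (auto simp: Zpart_pos)
  then show ?thesis using Zpart_pos[of bc R \<gamma>] by (simp add: ln_mult)
qed

lemma Zpart_Plus_le: "Zpart Plus R \<beta> \<le> Zpart Free R \<beta>"
  unfolding Zpart_energy by (rule sum_mono2) (simp, auto simp: Omega_def)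

lemma finite_boundary [simp]: "finite (rect_boundary R)"
  by (rule finite_subset[of _ "rectV R"]) (auto simp: rect_boundary_def)

lemma card_boundary_edges:
  "card {e \<in> rectE R. fst e \<in> rect_boundary R \<or> snd e \<in> rect_boundary R} \<le> 4 * card (rect_boundary R)"
proof -
  have "{e \<in> rectE R. fst e \<in> rect_boundary R \<or> snd e \<in> rect_boundary R} \<subseteq> (\<lambda>(v, k). ed v k) ` (rect_boundary R \<times> UNIV)"
  proof
    fix e assume e: "e \<in> {e \<in> rectE R. fst e \<in> rect_boundary R \<or> snd e \<in> rect_boundary R}"
    then obtain v k where vk: "e = ed v k" "k = East \<or> k = North" using rectE_ed by blast
    then have "fst e = v" "snd e = stp v k" by auto
    with e have "v \<in> rect_boundary R \<or> stp v k \<in> rect_boundary R" by auto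
    then show "e \<in> (\<lambda>(v, k). ed v k) ` (rect_boundary R \<times> UNIV)"
    proof
      assume "stp v k \<in> rect_boundary R"
      then show ?thesis using vk by (intro image_eqI[of _ _ "(stp v k, opp k)"]) (auto simp: ed_opp)
    qed (use vk in \<open>auto intro!: image_eqI[of _ _ "(v, k)"]\<close>)
  qed
  then have "card {e \<in> rectE R. fst e \<in> rect_boundary R \<or> snd e \<in> rect_boundary R} \<le> card ((\<lambda>(v, k). ed v k) ` (rect_boundary R \<times> UNIV))"
    by (intro card_mono) auto
  also have "\<dots> \<le> card (rect_boundary R \<times> (UNIV :: dir set))" by (intro card_image_le) auto
  also have "\<dots> = 4 * card (rect_boundary R)" by (simp add: card_cartesian_product UNIV_dir)
  finally show ?thesis .
qed

text \<open>Overwrite the boundary spins by 1. At most four edges meet each boundary vertex and each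
  loses at most 2 in energy, which gives 8 \<beta>; forgetting the old boundary spins gives ln 2 per
  vertex.\<close>

lemma Zpart_Free_le:
  assumes b: "\<beta> \<ge> 0"
  shows "ln (Zpart Free R \<beta>) \<le> ln (Zpart Plus R \<beta>) + (ln 2 + 8 * \<beta>) * card (rect_boundary R)"
proof -
  let ?B = "rect_boundary R"
  define pl where "pl \<sigma> = (\<lambda>u. if u \<in> ?B then 1 else \<sigma> u :: int)" for \<sigma>
  have BV: "?B \<subseteq> rectV R" by (auto simp: rect_boundary_def)
  have pl: "pl \<sigma> \<in> Omega Plus R" if "\<sigma> \<in> Omega Free R" for \<sigma>
    using that BV by (fastforce simp: Omega_def pl_def PiE_def Pi_def extensional_def)
  have en: "energy R \<sigma> \<le> energy R (pl \<sigma>) + 8 * card ?B" if s: "\<sigma> \<in> Omega Free R" for \<sigma>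
  proof -
    have "energy R \<sigma> \<le> (\<Sum>e\<in>rectE R. real_of_int (pl \<sigma> (fst e) * pl \<sigma> (snd e)) + (if fst e \<in> ?B \<or> snd e \<in> ?B then 2 else 0))"
      unfolding energy_def case_prod_unfold
    proof (intro sum_mono)
      fix e assume e: "e \<in> rectE R"
      then have e': "(fst e, snd e) \<in> rectE R" by simp
      show "real_of_int (\<sigma> (fst e) * \<sigma> (snd e)) \<le> real_of_int (pl \<sigma> (fst e) * pl \<sigma> (snd e)) + (if fst e \<in> ?B \<or> snd e \<in> ?B then 2 else 0)"
      proof (cases "fst e \<in> ?B \<or> snd e \<in> ?B")
        case True
        then show ?thesis using spin_prod_cases[OF s e'] spin_prod_cases[OF pl[OF s] e']
          by (elim disjE) (simp_all only: if_True, simp_all)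
      next
        case False
        then show ?thesis by (simp add: pl_def)
      qed
    qed
    also have "\<dots> = energy R (pl \<sigma>) + (\<Sum>e\<in>{e \<in> rectE R. fst e \<in> ?B \<or> snd e \<in> ?B}. 2)"
      unfolding sum.distrib energy_def case_prod_unfold by (subst sum.inter_filter) simp_all
    also have "\<dots> \<le> energy R (pl \<sigma>) + 8 * card ?B"
      using card_boundary_edges[of R] by simp
    finally show ?thesis .
  qed
  \<comment> \<open>Overwriting alone is not injective; keeping the old boundary spins as a second
    component makes it so, and there are 2 to the power \<open>card ?B\<close> of them.\<close>
  have inj: "inj_on (\<lambda>\<sigma>. (pl \<sigma>, restrict \<sigma> ?B)) (Omega Free R)"
  proof (rule inj_onI, rule ext)
    fix \<sigma> \<tau> u assume "(pl \<sigma>, restrict \<sigma> ?B) = (pl \<tau>, restrict \<tau> ?B)"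
    then have "pl \<sigma> u = pl \<tau> u" "restrict \<sigma> ?B u = restrict \<tau> ?B u" by auto
    then show "\<sigma> u = \<tau> u" by (auto simp: pl_def split: if_splits)
  qed
  have "Zpart Free R \<beta> \<le> (\<Sum>\<sigma>\<in>Omega Free R. exp (8 * \<beta> * card ?B) * exp (\<beta> * energy R (pl \<sigma>)))"
    unfolding Zpart_energy
  proof (intro sum_mono)
    fix \<sigma> assume "\<sigma> \<in> Omega Free R"
    from mult_left_mono[OF en[OF this] b]
    show "exp (\<beta> * energy R \<sigma>) \<le> exp (8 * \<beta> * card ?B) * exp (\<beta> * energy R (pl \<sigma>))"
      by (simp add: exp_add[symmetric] algebra_simps)
  qed
  also have "\<dots> = exp (8 * \<beta> * card ?B) * (\<Sum>p\<in>(\<lambda>\<sigma>. (pl \<sigma>, restrict \<sigma> ?B)) ` Omega Free R. exp (\<beta> * energy R (fst p)))"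
    by (simp add: sum.reindex[OF inj] sum_distrib_left)
  also have "\<dots> \<le> exp (8 * \<beta> * card ?B) * (\<Sum>p\<in>Omega Plus R \<times> (?B \<rightarrow>\<^sub>E {-1, 1 :: int}). exp (\<beta> * energy R (fst p)))"
  proof (intro mult_left_mono sum_mono2)
    show "(\<lambda>\<sigma>. (pl \<sigma>, restrict \<sigma> ?B)) ` Omega Free R \<subseteq> Omega Plus R \<times> (?B \<rightarrow>\<^sub>E {-1, 1 :: int})"
      using pl BV spin_cases[of _ Free R] by fastforce
  qed (auto intro!: finite_cartesian_product finite_PiE)
  also have "(\<Sum>p\<in>Omega Plus R \<times> (?B \<rightarrow>\<^sub>E {-1, 1 :: int}). exp (\<beta> * energy R (fst p))) = 2 ^ card ?B * Zpart Plus R \<beta>"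
    unfolding Zpart_energy sum.cartesian_product' by (simp add: card_PiE sum_distrib_left)
  finally have "Zpart Free R \<beta> \<le> exp (8 * \<beta> * card ?B) * (2 ^ card ?B * Zpart Plus R \<beta>)" .
  then have "ln (Zpart Free R \<beta>) \<le> ln (exp (8 * \<beta> * card ?B) * (2 ^ card ?B * Zpart Plus R \<beta>))"
    by (intro ln_mono) (auto simp: Zpart_pos)
  then show ?thesis using Zpart_pos[of Plus R \<beta>] by (simp add: ln_mult ln_realpow algebra_simps)
qed

text \<open>The dual edge of \<open>((x,y), (x+1,y))\<close>, whose end points stand for the unit squares with lower left corners
  \<open>(x,y)\<close> and \<open>(x+1,y)\<close>, is the common side \<open>((x+1,y), (x+1,y+1))\<close> of the two squares.\<close>
definition dual_edge :: "vtx \<times> vtx \<Rightarrow> vtx \<times> vtx" where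
  "dual_edge e = (snd e, stp (snd e) (if fst (fst e) < fst (snd e) then North else East))"

definition disagree :: "(vtx \<Rightarrow> int) \<Rightarrow> vtx \<times> vtx \<Rightarrow> bool" where
  "disagree \<sigma> e \<longleftrightarrow> \<sigma> (fst e) \<noteq> \<sigma> (snd e)"

section \<open>Contours of plus configurations on the dual rectangle\<close>

locale low_temp =
  fixes a b c d :: int
  assumes ab: "a < b" and cd: "c < d"
begin

abbreviation "R \<equiv> (a, b, c, d)"
abbreviation "R' \<equiv> (a, b - 1, c, d - 1)"

definition contour :: "(vtx \<Rightarrow> int) \<Rightarrow> (vtx \<times> vtx) set" where
  "contour \<sigma> = {e \<in> rectE R'. disagree \<sigma> (dual_edge e)}"

text \<open>The spin is recovered by climbing column \<open>x\<close> from the bottom side, where it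
  is plus. The step from height y' to y' + 1 changes the spin when the contour joins the squares to
  its left and right, that is, when it uses the West edge of the square (x, y').\<close>

definition spin_of :: "(vtx \<times> vtx) set \<Rightarrow> vtx \<Rightarrow> int" where
  "spin_of F = (\<lambda>(x, y)\<in>rectV R. if (\<Prod>y'\<in>{c..<y}. chi F (x, y') West) = 1 then 1 else -1)"

lemma boundary_iff: "(x, y) \<in> rect_boundary R \<longleftrightarrow> (x, y) \<in> rectV R \<and> (x = a \<or> x = b \<or> y = c \<or> y = d)"
proof
  assume "(x, y) \<in> rect_boundary R"
  then obtain w where "(x, y) \<in> rectV R" "adj (x, y) w" "w \<notin> rectV R" by (auto simp: rect_boundary_def)
  then show "(x, y) \<in> rectV R \<and> (x = a \<or> x = b \<or> y = c \<or> y = d)"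
    by (cases w) (auto simp: in_rectV adj_def)
next
  assume *: "(x, y) \<in> rectV R \<and> (x = a \<or> x = b \<or> y = c \<or> y = d)"
  have "adj (x, y) (x - 1, y)" "adj (x, y) (x + 1, y)" "adj (x, y) (x, y - 1)" "adj (x, y) (x, y + 1)"
    by (auto simp: adj_def)
  moreover have "(x - 1, y) \<notin> rectV R \<or> (x + 1, y) \<notin> rectV R \<or> (x, y - 1) \<notin> rectV R \<or> (x, y + 1) \<notin> rectV R"
    using * by (auto simp: in_rectV)
  ultimately show "(x, y) \<in> rect_boundary R" using * unfolding rect_boundary_def by blast
qed

lemma Plus_iff: "\<sigma> \<in> Omega Plus R \<longleftrightarrow> \<sigma> \<in> rectV R \<rightarrow>\<^sub>E {-1, 1} \<and> (\<forall>x y. (x, y) \<in> rectV R \<and> (x = a \<or> x = b \<or> y = c \<or> y = d) \<longrightarrow> \<sigma> (x, y) = 1)"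
  unfolding Omega_def by (auto simp: boundary_iff split_paired_All Ball_def)

lemma Plus_1: "\<sigma> \<in> Omega Plus R \<Longrightarrow> (x, y) \<in> rectV R \<Longrightarrow> x = a \<or> x = b \<or> y = c \<or> y = d \<Longrightarrow> \<sigma> (x, y) = 1"
  unfolding Plus_iff by blast

lemma dual_edge_simps:
  "dual_edge ((x, y), (x + 1, y)) = ((x + 1, y), (x + 1, y + 1))"
  "dual_edge ((x, y), (x, y + 1)) = ((x, y + 1), (x + 1, y + 1))"
  by (simp_all add: dual_edge_def)

lemma inj_dual_edge: "inj_on dual_edge (rectE R')"
proof (rule inj_onI)
  fix p q assume p: "p \<in> rectE R'" and q: "q \<in> rectE R'" and eq: "dual_edge p = dual_edge q"
  obtain x y k where 1: "p = ed (x, y) k" "k = East \<or> k = North" using rectE_ed[OF p] by (metis surj_pair)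
  obtain x' y' k' where 2: "q = ed (x', y') k'" "k' = East \<or> k' = North" using rectE_ed[OF q] by (metis surj_pair)
  show "p = q" using eq 1 2 by (elim disjE) (auto simp: dual_edge_simps)
qed

lemma in_R': "((x, y), (x + 1, y)) \<in> rectE R' \<longleftrightarrow> a \<le> x \<and> x + 2 \<le> b \<and> c \<le> y \<and> y + 1 \<le> d"
  "((x, y), (x, y + 1)) \<in> rectE R' \<longleftrightarrow> a \<le> x \<and> x + 1 \<le> b \<and> c \<le> y \<and> y + 2 \<le> d"
  using ed_in_rectE[of "(x, y)" East R'] ed_in_rectE[of "(x, y)" North R'] by (auto simp: in_rectV)

text \<open>Edges along the outer sides of \<open>R\<close> are dual to nothing in
  \<open>R'\<close>, but both of their spins are plus, so no disagreement is lost.\<close>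

lemma disagree_edges:
  assumes s: "\<sigma> \<in> Omega Plus R"
  shows "{e \<in> rectE R. disagree \<sigma> e} = dual_edge ` contour \<sigma>"
proof (intro equalityI subsetI)
  fix e assume "e \<in> dual_edge ` contour \<sigma>"
  then obtain p where p: "p \<in> rectE R'" "disagree \<sigma> (dual_edge p)" "e = dual_edge p" by (auto simp: contour_def)
  obtain x y k where 1: "p = ed (x, y) k" "k = East \<or> k = North" using rectE_ed[OF p(1)] by (metis surj_pair)
  have "dual_edge p \<in> rectE R"
    using 1 p(1) ed_in_rectE[of "(x+1, y)" North R] ed_in_rectE[of "(x, y+1)" East R]
    by (elim disjE) (simp_all add: dual_edge_simps in_R' in_rectV)
  with p show "e \<in> {e \<in> rectE R. disagree \<sigma> e}" by simp
next
  fix e assume "e \<in> {e \<in> rectE R. disagree \<sigma> e}"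
  then have e: "e \<in> rectE R" "disagree \<sigma> e" by auto
  obtain x y k where 1: "e = ed (x, y) k" "k = East \<or> k = North" using rectE_ed[OF e(1)] by (metis surj_pair)
  from 1(2) show "e \<in> dual_edge ` contour \<sigma>"
  proof
    assume k: "k = East"
    then have V: "(x, y) \<in> rectV R" "(x + 1, y) \<in> rectV R" using e(1) 1 ed_in_rectE[of "(x, y)" East R] by auto
    have "\<sigma> (x, y) \<noteq> \<sigma> (x + 1, y)" using e(2) 1 k by (simp add: disagree_def)
    then have "y \<noteq> c" "y \<noteq> d" using Plus_1[OF s V(1)] Plus_1[OF s V(2)] by auto
    then have "((x, y - 1), (x, y)) \<in> contour \<sigma>"
      using V e(2) 1 k in_R'(2)[of x "y - 1"] dual_edge_simps(2)[of x "y - 1"]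
      by (auto simp: contour_def in_rectV)
    then show ?thesis using 1 k dual_edge_simps(2)[of x "y - 1"] by (intro image_eqI[of _ _ "((x, y - 1), (x, y))"]) auto
  next
    assume k: "k = North"
    then have V: "(x, y) \<in> rectV R" "(x, y + 1) \<in> rectV R" using e(1) 1 ed_in_rectE[of "(x, y)" North R] by auto
    have "\<sigma> (x, y) \<noteq> \<sigma> (x, y + 1)" using e(2) 1 k by (simp add: disagree_def)
    then have "x \<noteq> a" "x \<noteq> b" using Plus_1[OF s V(1)] Plus_1[OF s V(2)] by auto
    then have "((x - 1, y), (x, y)) \<in> contour \<sigma>"
      using V e(2) 1 k in_R'(1)[of "x - 1" y] dual_edge_simps(1)[of "x - 1" y]
      by (auto simp: contour_def in_rectV)
    then show ?thesis using 1 k dual_edge_simps(1)[of "x - 1" y] by (intro image_eqI[of _ _ "((x - 1, y), (x, y))"]) auto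
  qed
qed

lemma Plus_real:
  assumes "\<sigma> \<in> Omega Plus R" "v \<in> rectV R" shows "real_of_int (\<sigma> v) * real_of_int (\<sigma> v) = 1"
  using spin_cases[OF assms] by auto

text \<open>The four sides of a unit square. Where a side lies on the boundary of \<open>R\<close>
  there is no dual edge, and the product of the two spins is 1 by the plus condition, so the formula
  persists.\<close>

lemma chi_contour:
  assumes s: "\<sigma> \<in> Omega Plus R" and v: "(x, y) \<in> rectV R'"
  shows "chi (contour \<sigma>) (x, y) East = real_of_int (\<sigma> (x+1, y)) * real_of_int (\<sigma> (x+1, y+1))"
    and "chi (contour \<sigma>) (x, y) North = real_of_int (\<sigma> (x, y+1)) * real_of_int (\<sigma> (x+1, y+1))"
    and "chi (contour \<sigma>) (x, y) West = real_of_int (\<sigma> (x, y)) * real_of_int (\<sigma> (x, y+1))"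
    and "chi (contour \<sigma>) (x, y) South = real_of_int (\<sigma> (x, y)) * real_of_int (\<sigma> (x+1, y))"
proof -
  have V: "(x, y) \<in> rectV R" "(x+1, y) \<in> rectV R" "(x, y+1) \<in> rectV R" "(x+1, y+1) \<in> rectV R"
    using v by (auto simp: in_rectV)
  note sp = V[THEN spin_cases[OF s]]
  have e: "(if p \<noteq> q then -1 else 1) = real_of_int p * real_of_int q" if "p = 1 \<or> p = -1" "q = 1 \<or> q = -1" for p q :: int
    using that by (elim disjE) auto
  have in': "a \<le> x" "x + 1 \<le> b" "c \<le> y" "y + 1 \<le> d" using v by (auto simp: in_rectV)
  show "chi (contour \<sigma>) (x, y) East = real_of_int (\<sigma> (x+1, y)) * real_of_int (\<sigma> (x+1, y+1))"
  proof (cases "x + 2 \<le> b")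
    case True
    then show ?thesis unfolding e[OF sp(2) sp(4), symmetric]
      using in' by (simp add: chi_def contour_def in_R' dual_edge_simps disagree_def)
  next
    case False
    then have "x + 1 = b" using in' by simp
    then have "\<sigma> (x+1, y) = 1" "\<sigma> (x+1, y+1) = 1" using Plus_1[OF s V(2)] Plus_1[OF s V(4)] by blast+
    moreover have "ed (x, y) East \<notin> contour \<sigma>" using False by (simp add: contour_def in_R')
    ultimately show ?thesis by (simp add: chi_def)
  qed
  show "chi (contour \<sigma>) (x, y) North = real_of_int (\<sigma> (x, y+1)) * real_of_int (\<sigma> (x+1, y+1))"
  proof (cases "y + 2 \<le> d")
    case True
    then show ?thesis unfolding e[OF sp(3) sp(4), symmetric]
      using in' by (simp add: chi_def contour_def in_R' dual_edge_simps disagree_def)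
  next
    case False
    then have "y + 1 = d" using in' by simp
    then have "\<sigma> (x, y+1) = 1" "\<sigma> (x+1, y+1) = 1" using Plus_1[OF s V(3)] Plus_1[OF s V(4)] by blast+
    moreover have "ed (x, y) North \<notin> contour \<sigma>" using False by (simp add: contour_def in_R')
    ultimately show ?thesis by (simp add: chi_def)
  qed
  show "chi (contour \<sigma>) (x, y) West = real_of_int (\<sigma> (x, y)) * real_of_int (\<sigma> (x, y+1))"
  proof (cases "a < x")
    case True
    then show ?thesis unfolding e[OF sp(1) sp(3), symmetric]
      using in' in_R'(1)[of "x - 1" y] dual_edge_simps(1)[of "x - 1" y] by (simp add: chi_def contour_def disagree_def)
  next
    case False
    then have "x = a" using in' by simp
    then show ?thesis using Plus_1[OF s V(1)] Plus_1[OF s V(3)] False in_R'(1)[of "x - 1" y] by (simp add: chi_def contour_def)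
  qed
  show "chi (contour \<sigma>) (x, y) South = real_of_int (\<sigma> (x, y)) * real_of_int (\<sigma> (x+1, y))"
  proof (cases "c < y")
    case True
    then show ?thesis unfolding e[OF sp(1) sp(2), symmetric]
      using in' in_R'(2)[of x "y - 1"] dual_edge_simps(2)[of x "y - 1"] by (simp add: chi_def contour_def disagree_def)
  next
    case False
    then have "y = c" using in' by simp
    then show ?thesis using Plus_1[OF s V(1)] Plus_1[OF s V(2)] False in_R'(2)[of x "y - 1"] by (simp add: chi_def contour_def)
  qed
qed

text \<open>Each corner of a square belongs to two of its sides, so in the product of the four sides
  every spin occurs squared.\<close>

lemma contour_even:
  assumes s: "\<sigma> \<in> Omega Plus R"
  shows "contour \<sigma> \<in> evens (rectE R')"
proof -
  have "par (chi (contour \<sigma>) v) = 1" for v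
  proof (cases "v \<in> rectV R'")
    case True
    obtain x y where v: "v = (x, y)" by (cases v)
    have V: "(x, y) \<in> rectV R" "(x+1, y) \<in> rectV R" "(x, y+1) \<in> rectV R" "(x+1, y+1) \<in> rectV R"
      using True by (auto simp: in_rectV v)
    note sq = V[THEN Plus_real[OF s]]
    show ?thesis unfolding v par_def chi_contour[OF s True[unfolded v]]
      using spin_cases[OF s V(1)] spin_cases[OF s V(2)] spin_cases[OF s V(3)] spin_cases[OF s V(4)]
      by (elim disjE) simp_all
  next
    case False
    then have "ed v k \<notin> contour \<sigma>" for k unfolding contour_def using ed_in_rectE by blast
    then have "chi (contour \<sigma>) v k = 1" for k by (simp add: chi_def)
    then show ?thesis by (simp add: par_def)
  qed
  then show ?thesis by (auto simp: evens_def contour_def)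
qed

lemma spin_of_real:
  assumes "(x, y) \<in> rectV R"
  shows "real_of_int (spin_of F (x, y)) = (\<Prod>y'\<in>{c..<y}. chi F (x, y') West)"
proof -
  have "(\<Prod>y'\<in>{c..<y}. chi F (x, y') West) = 1 \<or> (\<Prod>y'\<in>{c..<y}. chi F (x, y') West) = -1"
    by (rule prod_pm) (rule chi_cases)
  then show ?thesis using assms by (auto simp: spin_of_def)
qed

context
  fixes F assumes F: "F \<in> evens (rectE R')"
begin

lemma chi_outside: "(x, y) \<notin> rectV R' \<or> stp (x, y) k \<notin> rectV R' \<Longrightarrow> chi F (x, y) k = 1"
  using F ed_in_rectE[of "(x, y)" k R'] by (auto simp: chi_def evens_def)

text \<open>The argument of \<open>coboundary\<close>, for the stack of squares in column
  \<open>x\<close> below height \<open>y\<close>. Evenness at these squares removes the edges inside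
  the stack; what survives are its left edges, its right edges and the edge at its top. Nothing
  leaves below because \<open>c\<close> is the lowest row.\<close>

lemma column_ratio:
  assumes y: "c \<le> y"
  shows "(\<Prod>y'\<in>{c..<y}. chi F (x, y') West) * (\<Prod>y'\<in>{c..<y}. chi F (x + 1, y') West) = chi F (x, y) South"
  using y
proof (induction "nat (y - c)" arbitrary: y)
  case 0
  then have "y = c" by simp
  then show ?case using chi_outside[of x y South] by (simp add: in_rectV)
next
  case (Suc n)
  then have y: "c < y" by simp
  have IH: "(\<Prod>y'\<in>{c..<y - 1}. chi F (x, y') West) * (\<Prod>y'\<in>{c..<y - 1}. chi F (x + 1, y') West) = chi F (x, y - 1) South"
    using Suc y by (intro Suc.hyps(1)) auto
  have ins: "{c..<y} = insert (y - 1) {c..<y - 1}" using y by auto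
  have "(\<Prod>y'\<in>{c..<y}. chi F (x, y') West) * (\<Prod>y'\<in>{c..<y}. chi F (x + 1, y') West) =
    chi F (x, y - 1) West * chi F (x + 1, y - 1) West * chi F (x, y - 1) South"
    unfolding IH[symmetric] ins by simp
  also have "chi F (x + 1, y - 1) West = chi F (x, y - 1) East" using chi_opp[of F "(x, y - 1)" East] by simp
  also have "chi F (x, y - 1) West * chi F (x, y - 1) East * chi F (x, y - 1) South = chi F (x, y - 1) North"
  proof -
    have "par (chi F (x, y - 1)) = 1" using F by (simp add: evens_def)
    then show ?thesis using chi_cases[of F "(x, y - 1)" North] unfolding par_def by (elim disjE) (simp_all add: mult_ac)
  qed
  also have "chi F (x, y - 1) North = chi F (x, y) South" using chi_opp[of F "(x, y - 1)" North] by simp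
  finally show ?case .
qed

text \<open>This puts plus spins on the top side: no edge of \<open>R'\<close> reaches height
  \<open>d\<close>, so by \<open>column_ratio\<close> neighbouring columns agree there, and the
  leftmost column meets no edge at all.\<close>

lemma column_top: "a \<le> x \<Longrightarrow> (\<Prod>y'\<in>{c..<d}. chi F (x, y') West) = 1"
proof (induction "nat (x - a)" arbitrary: x)
  case 0
  then have "x = a" by simp
  then have "chi F (x, y') West = 1" for y' using chi_outside[of x y' West] by (simp add: in_rectV)
  then show ?case by simp
next
  case (Suc n)
  have IH: "(\<Prod>y'\<in>{c..<d}. chi F (x - 1, y') West) = 1"
    using Suc by (intro Suc.hyps(1)) auto
  have "chi F (x - 1, d) South = 1" by (rule chi_outside) (simp add: in_rectV)
  then show ?case using column_ratio[of d "x - 1"] cd IH by simp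
qed

lemma spin_of_Plus: "spin_of F \<in> Omega Plus R"
  unfolding Plus_iff
proof (intro conjI allI impI)
  show "spin_of F \<in> rectV R \<rightarrow>\<^sub>E {- 1, 1}" by (auto simp: spin_of_def split: if_splits)
  fix x y assume *: "(x, y) \<in> rectV R \<and> (x = a \<or> x = b \<or> y = c \<or> y = d)"
  then have V: "(x, y) \<in> rectV R" by blast
  have "(\<Prod>y'\<in>{c..<y}. chi F (x, y') West) = 1"
  proof (cases "y = d")
    case True
    then show ?thesis using column_top V by (simp add: in_rectV)
  next
    case False
    then consider "x = a \<or> x = b" | "y = c" using * by blast
    then show ?thesis
    proof cases
      case 1
      then have "chi F (x, y') West = 1" for y' using chi_outside[of x y' West] by (auto simp: in_rectV)
      then show ?thesis by simp
    qed simp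
  qed
  then show "spin_of F (x, y) = 1" using spin_of_real[OF V, of F] by simp
qed

lemma contour_spin_of: "contour (spin_of F) = F"
proof -
  have "chi (contour (spin_of F)) (x, y) k = chi F (x, y) k" if k: "k = East \<or> k = North" for x y k
  proof (cases "(x, y) \<in> rectV R'")
    case False
    then have "ed (x, y) k \<notin> contour (spin_of F)" unfolding contour_def using ed_in_rectE by blast
    then show ?thesis using chi_outside[of x y k] False by (simp add: chi_def)
  next
    case True
    have V: "(x, y) \<in> rectV R" "(x+1, y) \<in> rectV R" "(x, y+1) \<in> rectV R" "(x+1, y+1) \<in> rectV R"
      using True by (auto simp: in_rectV)
    have y: "c \<le> y" using True by (simp add: in_rectV)
    have ins: "{c..<y + 1} = insert y {c..<y}" using y by auto
    have pp: "(\<Prod>y'\<in>{c..<y}. chi F (x+1, y') West) * (\<Prod>y'\<in>{c..<y}. chi F (x+1, y') West) = 1"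
      using prod_pm[of "{c..<y}" "\<lambda>y'. chi F (x+1, y') West"] chi_cases by fastforce
    from k show ?thesis
    proof
      assume k: "k = East"
      have "chi F (x+1, y) West = chi F (x, y) East" using chi_opp[of F "(x, y)" East] by simp
      then show ?thesis unfolding k chi_contour(1)[OF spin_of_Plus True] spin_of_real[OF V(2)] spin_of_real[OF V(4)] ins
        using pp by (simp add: mult.left_commute)
    next
      assume k: "k = North"
      have "chi F (x, y+1) South = chi F (x, y) North" using chi_opp[of F "(x, y)" North] by simp
      then show ?thesis unfolding k chi_contour(2)[OF spin_of_Plus True] spin_of_real[OF V(3)] spin_of_real[OF V(4)]
        using column_ratio[of "y + 1" x] y by simp
    qed
  qed
  then have *: "ed (x, y) k \<in> contour (spin_of F) \<longleftrightarrow> ed (x, y) k \<in> F" if "k = East \<or> k = North" for x y k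
    using that unfolding chi_def by (metis one_neq_neg_one)
  have sub: "contour (spin_of F) \<subseteq> rectE R'" "F \<subseteq> rectE R'"
    using F by (auto simp: contour_def evens_def)
  show ?thesis
  proof (rule set_eqI)
    fix p
    show "p \<in> contour (spin_of F) \<longleftrightarrow> p \<in> F"
    proof (cases "p \<in> rectE R'")
      case True
      then obtain x y k where "p = ed (x, y) k" "k = East \<or> k = North" using rectE_ed by (metis surj_pair)
      then show ?thesis using * by blast
    qed (use sub in blast)
  qed
qed

end

lemma spin_of_contour:
  assumes s: "\<sigma> \<in> Omega Plus R"
  shows "spin_of (contour \<sigma>) = \<sigma>"
proof
  fix v :: vtx
  obtain x y where v: "v = (x, y)" by (cases v)
  show "spin_of (contour \<sigma>) v = \<sigma> v"
  proof (cases "v \<in> rectV R")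
    case False
    moreover have "\<sigma> v = undefined" using False s by (auto simp: Omega_def PiE_def extensional_def)
    ultimately show ?thesis by (simp add: spin_of_def)
  next
    case True
    have E: "contour \<sigma> \<in> evens (rectE R')" by (rule contour_even[OF s])
    have V: "(x, y') \<in> rectV R" if "y' \<in> {c..d}" for y' using True that by (auto simp: v in_rectV)
    have W: "chi (contour \<sigma>) (x, y') West = real_of_int (\<sigma> (x, y')) * real_of_int (\<sigma> (x, y'+1))" if y': "y' \<in> {c..<d}" for y'
    proof (cases "x = b")
      case True
      then show ?thesis using chi_outside[OF E, of x y' West] Plus_1[OF s V] y' by (simp add: in_rectV)
    next
      case False
      then have "(x, y') \<in> rectV R'" using V[of y'] y' by (auto simp: in_rectV)
      then show ?thesis by (rule chi_contour(3)[OF s])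
    qed
    have "(\<Prod>y'\<in>{c..<y}. chi (contour \<sigma>) (x, y') West) = real_of_int (\<sigma> (x, y))" if "c \<le> y" "y \<le> d" for y
      using that
    proof (induction "nat (y - c)" arbitrary: y)
      case 0
      then have "y = c" by simp
      then show ?case using Plus_1[OF s V[of c]] cd by simp
    next
      case (Suc n)
      then have y: "c < y" by simp
      have IH: "(\<Prod>y'\<in>{c..<y - 1}. chi (contour \<sigma>) (x, y') West) = real_of_int (\<sigma> (x, y - 1))"
        using Suc y by (intro Suc.hyps(1)) auto
      have ins: "{c..<y} = insert (y - 1) {c..<y - 1}" using y by auto
      show ?case unfolding ins using IH W[of "y - 1"] Plus_real[OF s V[of "y - 1"]] y Suc.prems
        by (simp add: mult_ac)
    qed
    then have "(\<Prod>y'\<in>{c..<y}. chi (contour \<sigma>) (x, y') West) = real_of_int (\<sigma> (x, y))"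
      using True by (simp add: v in_rectV)
    then show ?thesis using spin_of_real[of x y "contour \<sigma>"] True by (simp add: v)
  qed
qed

text \<open>Relative to the all-plus configuration every disagreeing edge costs a factor exp (- 2
  \<beta>). Contours and plus configurations determine each other, so the sum over spins is a sum
  over even subgraphs of the dual rectangle.\<close>

theorem low_temperature:
  "Zpart Plus R \<beta> = exp \<beta> ^ card (rectE R) * evenpoly (rectE R') (exp (- 2 * \<beta>))"
proof -
  have "Zpart Plus R \<beta> = (\<Sum>\<sigma>\<in>Omega Plus R. exp \<beta> ^ card (rectE R) * exp (- 2 * \<beta>) ^ card (contour \<sigma>))"
    unfolding Zpart_def
  proof (intro sum.cong refl)
    fix \<sigma> assume s: "\<sigma> \<in> Omega Plus R"
    have "(\<Prod>(u, v)\<in>rectE R. exp (\<beta> * real_of_int (\<sigma> u * \<sigma> v))) = (\<Prod>e\<in>rectE R. exp \<beta> * (if disagree \<sigma> e then exp (- 2 * \<beta>) else 1))"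
    proof (intro prod.cong refl)
      fix e assume e: "e \<in> rectE R"
      then have "fst e \<in> rectV R" "snd e \<in> rectV R" using rectE_D[of "fst e" "snd e" R] by auto
      then show "(case e of (u, v) \<Rightarrow> exp (\<beta> * real_of_int (\<sigma> u * \<sigma> v))) = exp \<beta> * (if disagree \<sigma> e then exp (- 2 * \<beta>) else 1)"
        using spin_cases[OF s, of "fst e"] spin_cases[OF s, of "snd e"]
        by (cases e) (auto simp: disagree_def exp_add[symmetric])
    qed
    also have "\<dots> = exp \<beta> ^ card (rectE R) * (\<Prod>e\<in>{e \<in> rectE R. disagree \<sigma> e}. exp (- 2 * \<beta>))"
      unfolding prod.distrib prod.inter_filter[OF finite_rectE] by simp
    also have "\<dots> = exp \<beta> ^ card (rectE R) * exp (- 2 * \<beta>) ^ card (contour \<sigma>)"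
      unfolding disagree_edges[OF s] by (subst prod_constant, subst card_image)
        (auto intro: inj_on_subset[OF inj_dual_edge] simp: contour_def)
    finally show "(\<Prod>(u, v)\<in>rectE R. exp (\<beta> * real_of_int (\<sigma> u * \<sigma> v))) = exp \<beta> ^ card (rectE R) * exp (- 2 * \<beta>) ^ card (contour \<sigma>)" .
  qed
  also have "\<dots> = exp \<beta> ^ card (rectE R) * (\<Sum>\<sigma>\<in>Omega Plus R. exp (- 2 * \<beta>) ^ card (contour \<sigma>))"
    by (simp add: sum_distrib_left)
  also have "(\<Sum>\<sigma>\<in>Omega Plus R. exp (- 2 * \<beta>) ^ card (contour \<sigma>)) = evenpoly (rectE R') (exp (- 2 * \<beta>))"
    unfolding evenpoly_def
    by (rule sum.reindex_bij_witness[of _ spin_of contour])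
       (simp_all add: spin_of_contour contour_even contour_spin_of spin_of_Plus)
  finally show ?thesis .
qed

end

section \<open>Closed walks and rooted closed paths\<close>

fun dv :: "dir \<Rightarrow> vtx" where
  "dv East = (1, 0)" | "dv North = (0, 1)" | "dv West = (-1, 0)" | "dv South = (0, -1)"

lemma stp_dv: "stp v k = v + dv k"
  by (cases v; cases k) simp_all

lemma dv_inj: "dv j = dv k \<longleftrightarrow> j = k"
  by (cases j; cases k) simp_all

lemma dv_opp: "dv (opp k) = - dv k"
  by (cases k) simp_all

lemma adj_iff_stp: "adj u v \<longleftrightarrow> (\<exists>k. v = stp u k)"
proof -
  obtain x y x' y' where 1: "u = (x, y)" "v = (x', y')" by (cases u; cases v) blast
  have "(\<exists>k. v = stp u k) \<longleftrightarrow> v = stp u East \<or> v = stp u North \<or> v = stp u West \<or> v = stp u South"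
    using all_dir[of "\<lambda>k. v \<noteq> stp u k"] by blast
  moreover have "\<bar>x - x'\<bar> + \<bar>y - y'\<bar> = 1 \<longleftrightarrow> (x' = x + 1 \<and> y' = y) \<or> (x' = x \<and> y' = y + 1) \<or> (x' = x - 1 \<and> y' = y) \<or> (x' = x \<and> y' = y - 1)"
    by arith
  ultimately show ?thesis by (simp only: adj_def 1 fst_conv snd_conv stp.simps prod.inject)
qed

definition dirof :: "vtx \<Rightarrow> vtx \<Rightarrow> dir" where
  "dirof u v = (THE k. v = stp u k)"

lemma dirof_stp [simp]: "dirof u (stp u k) = k"
  unfolding dirof_def stp_dv by (rule the_equality) (auto simp: dv_inj)

lemma stp_dirof: "adj u v \<Longrightarrow> stp u (dirof u v) = v"
  by (auto simp: adj_iff_stp)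

text \<open>The direction carried by \<open>p\<close> is walked first and the last entry of the list
  is not walked: it is the directed edge at which the walk arrives.\<close>

fun endp :: "vtx \<times> dir \<Rightarrow> dir list \<Rightarrow> vtx \<times> dir" where
  "endp p [] = p"
| "endp p (d # ds) = endp (stp (fst p) (snd p), d) ds"

fun chn :: "dir \<Rightarrow> dir list \<Rightarrow> real" where
  "chn d [] = 1"
| "chn d (d' # ds) = kwc d d' * chn d' ds"

lemma finite_dir_lists [simp]: "finite {ds :: dir list. length ds = r}"
  using finite_lists_length_eq[of "UNIV :: dir set" r] by simp

lemma sum_lists_Suc: "(\<Sum>ds | length ds = Suc r. f ds) = (\<Sum>d\<in>UNIV. \<Sum>ds | length ds = r. f (d # ds :: dir list))"
proof -
  have eq: "{ds :: dir list. length ds = Suc r} = (\<lambda>(d, ds). d # ds) ` (UNIV \<times> {ds. length ds = r})"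
    by (auto simp: length_Suc_conv image_iff)
  have "inj_on (\<lambda>(d, ds). d # ds) (UNIV \<times> {ds :: dir list. length ds = r})"
    by (auto simp: inj_on_def)
  then show ?thesis unfolding eq
    by (subst sum.reindex) (auto simp: sum.cartesian_product intro!: sum.cong)
qed

lemma kwop_UNIV_pow:
  "(kwop UNIV ^^ r) f (u, d) = (\<Sum>ds | length ds = r. chn d ds * f (endp (u, d) ds))"
proof (induction r arbitrary: u d)
  case (Suc r)
  have "(kwop UNIV ^^ Suc r) f (u, d) = (\<Sum>d'\<in>UNIV. kwc d d' * (kwop UNIV ^^ r) f (stp u d, d'))"
    by (simp add: kwop_def)
  also have "\<dots> = (\<Sum>ds | length ds = Suc r. chn d ds * f (endp (u, d) ds))"
    unfolding Suc sum_lists_Suc by (simp add: sum_distrib_left mult.assoc)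
  finally show ?case .
qed simp

lemma endp_eq: "ds \<noteq> [] \<Longrightarrow> endp (u, d) ds = (u + dv d + sum_list (map dv (butlast ds)), last ds)"
  by (induction ds arbitrary: u d) (auto simp: stp_dv add.assoc)

definition cw :: "dir list \<Rightarrow> real" where
  "cw ds = (\<Prod>i<length ds. kwc (ds ! i) (ds ! ((i + 1) mod length ds)))"

lemma chn_prod: "chn d ds = (\<Prod>i<length ds. kwc ((d # ds) ! i) (ds ! i))"
proof (induction ds arbitrary: d)
  case (Cons d' ds)
  have "(\<Prod>i<length (d' # ds). kwc ((d # d' # ds) ! i) ((d' # ds) ! i)) = kwc d d' * (\<Prod>i<length ds. kwc ((d' # ds) ! i) (ds ! i))"
    unfolding length_Cons prod.lessThan_Suc_shift by simp
  then show ?case using Cons by simp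
qed simp

lemma chn_last: "ds \<noteq> [] \<Longrightarrow> chn (last ds) ds = cw ds"
proof -
  assume "ds \<noteq> []"
  then obtain n where n: "length ds = Suc n" by (cases ds) auto
  have "last ds = ds ! n" using n \<open>ds \<noteq> []\<close> by (simp add: last_conv_nth)
  then have "chn (last ds) ds = kwc (ds ! n) (ds ! 0) * (\<Prod>i<n. kwc (ds ! i) (ds ! Suc i))"
    unfolding chn_prod n prod.lessThan_Suc_shift by simp
  moreover have "cw ds = (\<Prod>i<n. kwc (ds ! i) (ds ! Suc i)) * kwc (ds ! n) (ds ! 0)"
    unfolding cw_def n prod.lessThan_Suc by simp
  ultimately show ?thesis by simp
qed

definition kwtrace0 :: "nat \<Rightarrow> real" where
  "kwtrace0 r = (\<Sum>d\<in>UNIV. (kwop UNIV ^^ r) (dlt ((0, 0), d)) ((0, 0), d))"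

text \<open>Returning to the starting directed edge forces its direction to be
  \<open>last ds\<close>. That direction is walked at the beginning instead of the end, so the total
  displacement is the sum over \<open>ds\<close> and the chain of phases closes to the cyclic
  product \<open>cw\<close>.\<close>

lemma kwtrace0_eq:
  assumes r: "r > 0"
  shows "kwtrace0 r = (\<Sum>ds | length ds = r \<and> sum_list (map dv ds) = 0. cw ds)"
proof -
  have "kwtrace0 r = (\<Sum>ds | length ds = r. \<Sum>d\<in>UNIV. chn d ds * dlt ((0, 0), d) (endp ((0, 0), d) ds))"
    unfolding kwtrace0_def kwop_UNIV_pow by (rule sum.swap)
  also have "\<dots> = (\<Sum>ds | length ds = r. if sum_list (map dv ds) = 0 then cw ds else 0)"
  proof (intro sum.cong refl)
    fix ds :: "dir list" assume "ds \<in> {ds. length ds = r}"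
    then have ne: "ds \<noteq> []" using r by auto
    then have sl: "sum_list (map dv ds) = dv (last ds) + sum_list (map dv (butlast ds))"
    proof -
      have "sum_list (map dv (butlast ds @ [last ds])) = dv (last ds) + sum_list (map dv (butlast ds))"
        by (simp add: add.commute)
      then show ?thesis using append_butlast_last_id[OF ne] by simp
    qed
    have "(\<Sum>d\<in>UNIV. chn d ds * dlt ((0, 0), d) (endp ((0, 0), d) ds)) =
       (\<Sum>d\<in>UNIV. if d = last ds then (if sum_list (map dv ds) = 0 then cw ds else 0) else 0)"
      by (intro sum.cong refl) (auto simp: endp_eq[OF ne] dlt_def sl chn_last[OF ne] zero_prod_def[symmetric])
    then show "(\<Sum>d\<in>UNIV. chn d ds * dlt ((0, 0), d) (endp ((0, 0), d) ds)) = (if sum_list (map dv ds) = 0 then cw ds else 0)"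
      by simp
  qed
  also have "\<dots> = (\<Sum>ds | length ds = r \<and> sum_list (map dv ds) = 0. cw ds)"
    by (subst sum.inter_filter[symmetric]) auto
  finally show ?thesis .
qed

section \<open>Closed paths as cyclic lists of directions\<close>

lemma closed_length: "is_closed p \<Longrightarrow> length p > 0"
  by (simp add: is_closed_def)

lemma closed_adj: "is_closed p \<Longrightarrow> i < length p \<Longrightarrow> adj (p ! i) (p ! ((i + 1) mod length p))"
  by (simp add: is_closed_def)

definition dirs :: "vtx list \<Rightarrow> dir list" where
  "dirs p = map (\<lambda>i. dirof (p ! i) (p ! ((i + 1) mod length p))) [0..<length p]"

definition verts :: "dir list \<Rightarrow> vtx list" where
  "verts ds = map (\<lambda>i. sum_list (map dv (take i ds))) [0..<length ds]"

definition rooted :: "nat \<Rightarrow> vtx list set" where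
  "rooted r = {p. length p = r \<and> is_closed p \<and> p ! 0 = (0, 0)}"

lemma length_dirs [simp]: "length (dirs p) = length p"
  by (simp add: dirs_def)

lemma length_verts [simp]: "length (verts ds) = length ds"
  by (simp add: verts_def)

lemma dirs_step: "is_closed p \<Longrightarrow> i < length p \<Longrightarrow> p ! ((i + 1) mod length p) = stp (p ! i) (dirs p ! i)"
  using stp_dirof[OF closed_adj[of p i]] by (simp add: dirs_def)

lemma dirs_step2:
  assumes "is_closed p" "i < length p"
  shows "p ! ((i + 2) mod length p) = stp (stp (p ! i) (dirs p ! i)) (dirs p ! ((i + 1) mod length p))"
proof -
  have "(i + 1) mod length p < length p" using assms by (intro mod_less_divisor) auto
  from dirs_step[OF assms(1) this] show ?thesis
    by (simp add: dirs_step[OF assms, symmetric] mod_Suc_eq)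
qed

lemma dirs_nonbacktracking:
  assumes "is_closed p" "i < length p"
  shows "dirs p ! ((i + 1) mod length p) \<noteq> opp (dirs p ! i)"
proof
  assume "dirs p ! ((i + 1) mod length p) = opp (dirs p ! i)"
  then have "p ! ((i + 2) mod length p) = p ! i" unfolding dirs_step2[OF assms] by simp
  with assms show False by (simp add: is_closed_def)
qed

lemma verts_step:
  assumes "sum_list (map dv ds) = 0" "i < length ds"
  shows "verts ds ! ((i + 1) mod length ds) = stp (verts ds ! i) (ds ! i)"
proof -
  have 1: "sum_list (map dv (take (Suc i) ds)) = sum_list (map dv (take i ds)) + dv (ds ! i)"
    using assms(2) by (simp add: take_Suc_conv_app_nth)
  show ?thesis
  proof (cases "Suc i < length ds")
    case True
    then show ?thesis using 1 by (simp add: verts_def stp_dv)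
  next
    case False
    then have "Suc i = length ds" using assms(2) by simp
    moreover have "0 < length ds" using assms(2) by linarith
    ultimately show ?thesis using 1 assms by (simp add: verts_def stp_dv)
  qed
qed

lemma dirs_verts:
  assumes "sum_list (map dv ds) = 0"
  shows "dirs (verts ds) = ds"
  by (rule nth_equalityI) (use verts_step[OF assms] in \<open>simp_all add: dirs_def\<close>)

lemma closed_verts:
  assumes "sum_list (map dv ds) = 0" "ds \<noteq> []"
    and nb: "\<And>i. i < length ds \<Longrightarrow> ds ! ((i + 1) mod length ds) \<noteq> opp (ds ! i)"
  shows "is_closed (verts ds)"
  unfolding is_closed_def
proof (intro conjI allI impI)
  show "verts ds \<noteq> []" using assms(2) by (simp add: verts_def)
  fix i assume "i < length (verts ds)"
  then have i: "i < length ds" by simp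
  then have i1: "(i + 1) mod length ds < length ds" by (intro mod_less_divisor) auto
  show "adj (verts ds ! i) (verts ds ! ((i + 1) mod length (verts ds)))"
    using verts_step[OF assms(1) i] by (auto simp: adj_iff_stp)
  have "verts ds ! ((i + 2) mod length ds) = stp (stp (verts ds ! i) (ds ! i)) (ds ! ((i + 1) mod length ds))"
    using verts_step[OF assms(1) i1] unfolding verts_step[OF assms(1) i] by (simp add: mod_Suc_eq)
  also have "\<dots> \<noteq> verts ds ! i"
  proof
    assume "stp (stp (verts ds ! i) (ds ! i)) (ds ! ((i + 1) mod length ds)) = verts ds ! i"
    then have "dv (ds ! ((i + 1) mod length ds)) = - dv (ds ! i)"
      by (simp add: stp_dv add.assoc eq_neg_iff_add_eq_0 add.commute)
    then show False using nb[OF i] dv_inj dv_opp by metis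
  qed
  finally show "verts ds ! ((i + 2) mod length (verts ds)) \<noteq> verts ds ! i" by simp
qed

lemma verts_dirs:
  assumes p: "is_closed p" "p ! 0 = (0, 0)"
  shows "verts (dirs p) = p" and "sum_list (map dv (dirs p)) = 0"
proof -
  have *: "i < length p \<Longrightarrow> sum_list (map dv (take i (dirs p))) = p ! i" for i
  proof (induction i)
    case 0
    then show ?case using p(2) by (simp add: zero_prod_def)
  next
    case (Suc i)
    then show ?case using dirs_step[OF p(1), of i] by (simp add: take_Suc_conv_app_nth stp_dv)
  qed
  then show "verts (dirs p) = p" by (intro nth_equalityI) (simp_all add: verts_def)
  obtain n where n: "length p = Suc n" using closed_length[OF p(1)] by (cases "length p") auto
  have "take (Suc n) (dirs p) = take n (dirs p) @ [dirs p ! n]"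
    by (rule take_Suc_conv_app_nth) (simp add: n)
  moreover have "take (Suc n) (dirs p) = dirs p" using n by simp
  ultimately have "sum_list (map dv (dirs p)) = sum_list (map dv (take n (dirs p) @ [dirs p ! n]))" by metis
  also have "\<dots> = p ! n + dv (dirs p ! n)" using *[of n] n by simp
  also have "\<dots> = p ! 0" using dirs_step[OF p(1), of n] n by (simp add: stp_dv)
  finally show "sum_list (map dv (dirs p)) = 0" using p(2) by (simp add: zero_prod_def)
qed

section \<open>Turning angles and the real gauge\<close>

fun ang :: "dir \<Rightarrow> real" where
  "ang East = 0" | "ang North = pi / 2" | "ang West = pi" | "ang South = 3 * pi / 2"

fun cdir :: "dir \<Rightarrow> complex" where
  "cdir East = 1" | "cdir North = \<i>" | "cdir West = -1" | "cdir South = -\<i>"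

lemma cvec_stp: "cvec u (stp u k) = cdir k"
  by (cases u; cases k) (simp_all add: cvec_def complex_eq_iff)

text \<open>With \<open>ang\<close> taking values from 0 up to 2 pi, the principal turning angle is
  the difference of the two angles except between South and East, where it is off by 2 pi. Half of
  this excess produces the entries -1.\<close>

lemma kwc_phase:
  assumes "d' \<noteq> opp d"
  shows "complex_of_real (kwc d d') = cis (Arg (cdir d' * cnj (cdir d)) / 2) * cis ((ang d - ang d') / 2)"
proof -
  have [simp]: "Arg \<i> = pi / 2" "Arg (- \<i>) = - (pi / 2)" by (simp_all add: Arg_ii Arg_minus_ii)
  define z where "z = Arg (cdir d' * cnj (cdir d)) + (ang d - ang d')"
  have z: "z = 0 \<and> kwc d d' = 1 \<or> (z = 2 * pi \<or> z = - (2 * pi)) \<and> kwc d d' = -1"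
    using assms unfolding z_def by (cases d; cases d'; simp)
  have "cis (- pi) = -1" using cis_cnj[of pi] by simp
  then have "complex_of_real (kwc d d') = cis (z / 2)" using z by auto
  then show ?thesis by (simp add: cis_mult z_def add_divide_distrib)
qed

lemma sum_cyc:
  fixes F :: "nat \<Rightarrow> 'a :: comm_monoid_add"
  assumes per: "\<And>n. F (n mod r) = F n"
  shows "(\<Sum>i<r. F (i + k)) = (\<Sum>i<r. F i)"
proof (induction k)
  case (Suc k)
  show ?case
  proof (cases r)
    case (Suc m)
    have "m + Suc k = k + r" using Suc by simp
    then have "F (m + Suc k) = F k" using per[of "k + r"] per[of k] by (metis mod_add_self2)
    then have "(\<Sum>i<r. F (i + Suc k)) = (\<Sum>i<m. F (Suc i + k)) + F k"
      unfolding Suc sum.lessThan_Suc by simp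
    also have "\<dots> = F k + (\<Sum>i<m. F (Suc i + k))" by (rule add.commute)
    also have "\<dots> = (\<Sum>i<r. F (i + k))" unfolding Suc sum.lessThan_Suc_shift[of "\<lambda>i. F (i + k)"] by simp
    finally show ?thesis using Suc.IH by simp
  qed simp
qed simp

text \<open>The gauge factors telescope around a closed path. In particular the exponential of half
  the winding is real.\<close>

lemma phase_winding:
  assumes p: "is_closed p"
  shows "exp (\<i> * complex_of_real (winding p / 2)) = complex_of_real (cw (dirs p))"
proof -
  let ?r = "length p" and ?e = "dirs p"
  have r: "?r > 0" using p by (rule closed_length)
  have "complex_of_real (cw ?e) = (\<Prod>i<?r. cis (turn_angle (p ! i) (p ! ((i + 1) mod ?r)) (p ! ((i + 2) mod ?r)) / 2)
      * cis ((ang (?e ! i) - ang (?e ! ((i + 1) mod ?r))) / 2))"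
    unfolding cw_def length_dirs of_real_prod
  proof (intro prod.cong refl)
    fix i assume "i \<in> {..<?r}"
    then have i: "i < ?r" by simp
    show "complex_of_real (kwc (?e ! i) (?e ! ((i + 1) mod ?r))) =
      cis (turn_angle (p ! i) (p ! ((i + 1) mod ?r)) (p ! ((i + 2) mod ?r)) / 2) * cis ((ang (?e ! i) - ang (?e ! ((i + 1) mod ?r))) / 2)"
      unfolding dirs_step2[OF p i] dirs_step[OF p i] turn_angle_def cvec_stp
      by (rule kwc_phase) (rule dirs_nonbacktracking[OF p i])
  qed
  also have "\<dots> = cis (\<Sum>i<?r. turn_angle (p ! i) (p ! ((i + 1) mod ?r)) (p ! ((i + 2) mod ?r)) / 2)
     * cis (\<Sum>i<?r. (ang (?e ! i) - ang (?e ! ((i + 1) mod ?r))) / 2)"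
  proof -
    have "(\<Prod>i\<in>A. cis (f i)) = cis (sum f A)" for f :: "nat \<Rightarrow> real" and A
      by (induction A rule: infinite_finite_induct) (simp_all add: cis_mult)
    then show ?thesis by (simp add: prod.distrib)
  qed
  also have "(\<Sum>i<?r. (ang (?e ! i) - ang (?e ! ((i + 1) mod ?r))) / 2) = 0"
  proof -
    have "(\<Sum>i<?r. ang (?e ! ((i + 1) mod ?r))) = (\<Sum>i<?r. ang (?e ! (i mod ?r)))"
      by (rule sum_cyc[of "\<lambda>i. ang (?e ! (i mod ?r))" ?r 1]) simp
    then show ?thesis by (simp add: sum_divide_distrib[symmetric] sum_subtractf)
  qed
  finally show ?thesis
    by (simp add: winding_def sum_divide_distrib[symmetric] cis_conv_exp)
qed

lemma finite_rooted [simp]: "finite (rooted r)"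
proof (rule finite_subset)
  show "rooted r \<subseteq> verts ` {ds. length ds = r}"
  proof
    fix p assume "p \<in> rooted r"
    then show "p \<in> verts ` {ds. length ds = r}"
      by (intro image_eqI[of _ _ "dirs p"]) (auto simp: rooted_def verts_dirs)
  qed
qed simp

text \<open>The trace runs over all closed direction lists; those that backtrack, also at the root,
  carry a factor \<open>kwc d (opp d) = 0\<close>, and the others are the rooted closed
  paths.\<close>

lemma kwtrace0_rooted:
  assumes r: "r > 0"
  shows "complex_of_real (kwtrace0 r) = (\<Sum>p\<in>rooted r. exp (\<i> * complex_of_real (winding p / 2)))"
proof -
  let ?C = "{ds. length ds = r \<and> sum_list (map dv ds) = 0}"
  let ?N = "{ds. length ds = r \<and> sum_list (map dv ds) = 0 \<and> (\<forall>i<r. ds ! ((i + 1) mod r) \<noteq> opp (ds ! i))}"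
  have kw0: "kwc d (opp d) = 0" for d by (cases d) simp_all
  have "kwtrace0 r = (\<Sum>ds\<in>?N. cw ds)"
    unfolding kwtrace0_eq[OF r]
  proof (rule sum.mono_neutral_right)
    show "finite ?C" by (rule finite_subset[OF _ finite_dir_lists[of r]]) auto
    show "\<forall>ds\<in>?C - ?N. cw ds = 0"
    proof
      fix ds assume "ds \<in> ?C - ?N"
      then obtain i where "i < r" "length ds = r" "ds ! ((i + 1) mod r) = opp (ds ! i)" by auto
      then show "cw ds = 0" unfolding cw_def by (auto simp: kw0 intro!: bexI[of _ i])
    qed
  qed auto
  also have "\<dots> = (\<Sum>p\<in>rooted r. cw (dirs p))"
  proof (rule sum.reindex_bij_witness[of _ dirs verts])
    fix ds assume ds: "ds \<in> ?N"
    then show "dirs (verts ds) = ds" by (intro dirs_verts) auto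
    then show "cw (dirs (verts ds)) = cw ds" by simp
    have "is_closed (verts ds)" using ds r by (intro closed_verts) auto
    moreover have "verts ds ! 0 = (0, 0)" using ds r by (simp add: verts_def zero_prod_def)
    ultimately show "verts ds \<in> rooted r" using ds by (simp add: rooted_def)
  next
    fix p assume "p \<in> rooted r"
    then have p: "is_closed p" "p ! 0 = (0, 0)" "length p = r" by (auto simp: rooted_def)
    show "verts (dirs p) = p" by (rule verts_dirs[OF p(1,2)])
    show "dirs p \<in> ?N" using verts_dirs(2)[OF p(1,2)] dirs_nonbacktracking[OF p(1)] p(3) by auto
  qed
  finally have "complex_of_real (kwtrace0 r) = (\<Sum>p\<in>rooted r. complex_of_real (cw (dirs p)))" by simp
  also have "\<dots> = (\<Sum>p\<in>rooted r. exp (\<i> * complex_of_real (winding p / 2)))"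
    by (intro sum.cong refl phase_winding[symmetric]) (simp add: rooted_def)
  finally show ?thesis .
qed

section \<open>From rooted closed paths to loops\<close>

definition orb :: "'a list \<Rightarrow> 'a list set" where
  "orb q = range (\<lambda>k. rotate k q) \<union> range (\<lambda>k. rotate k (rev q))"

lemma rotate_inverse': "rotate (length q - j mod length q) (rotate j q) = q"
proof (cases "q = []")
  case False
  let ?r = "length q"
  have "(?r - j mod ?r + j) mod ?r = (?r - j mod ?r + j mod ?r) mod ?r"
    by (simp add: mod_add_right_eq)
  also have "?r - j mod ?r + j mod ?r = ?r"
    using False by (simp add: less_imp_le)
  finally have "(?r - j mod ?r + j) mod ?r = 0" by simp
  then have "rotate (?r - j mod ?r) (rotate j q) = q"
    unfolding rotate_rotate by (rule rotate_id)
  then show ?thesis by blast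
qed simp

lemma rotate_inverse: "\<exists>k. rotate k (rotate j q) = q"
  using rotate_inverse' by blast

lemma rotate_cancel:
  assumes "length p = length q" "rotate j p = rotate j q"
  shows "p = q"
  using rotate_inverse'[of p j] unfolding assms rotate_inverse' by (rule sym)

lemma rev_rotate: "\<exists>j'. rev (rotate j q) = rotate j' (rev q)"
proof (cases "q = [] \<or> j mod length q = 0")
  case True
  then have "rotate j q = q" by auto
  then show ?thesis by (intro exI[of _ 0]) simp
next
  case False
  then have q: "q \<noteq> []" by auto
  let ?r = "length q"
  have j: "0 < j mod ?r" "j mod ?r < ?r" using False q by auto
  then have "(?r - j mod ?r) mod ?r = ?r - j mod ?r" by (intro mod_less) linarith
  then have "rotate (?r - j mod ?r) (rev q) = rev (rotate (j mod ?r) q)"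
    unfolding rotate_rev using j by simp
  also have "rotate (j mod ?r) q = rotate j q" by (rule rotate_conv_mod[symmetric])
  finally show ?thesis by (intro exI) (rule sym)
qed

lemma orb_rotate: "rotate k q \<in> orb q" and orb_rotate_rev: "rotate k (rev q) \<in> orb q"
  unfolding orb_def by blast+

lemma orb_self: "q \<in> orb q"
  using orb_rotate[of 0 q] by simp

lemma orb_subset: "q' \<in> orb q \<Longrightarrow> orb q' \<subseteq> orb q"
proof -
  assume q': "q' \<in> orb q"
  have "rotate k q' \<in> orb q \<and> rotate k (rev q') \<in> orb q" for k
  proof -
    consider j where "q' = rotate j q" | j where "q' = rotate j (rev q)" using q' unfolding orb_def by blast
    then show ?thesis
    proof cases
      case 1
      obtain i where "rev (rotate j q) = rotate i (rev q)" using rev_rotate by blast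
      then show ?thesis by (simp only: 1 rotate_rotate orb_rotate orb_rotate_rev simp_thms)
    next
      case 2
      obtain i where "rev (rotate j (rev q)) = rotate i (rev (rev q))" using rev_rotate by blast
      then show ?thesis by (simp only: 2 rotate_rotate orb_rotate orb_rotate_rev simp_thms rev_rev_ident)
    qed
  qed
  then show ?thesis unfolding orb_def[of q'] by blast
qed

lemma orb_sym: "q' \<in> orb q \<Longrightarrow> q \<in> orb q'"
proof -
  assume "q' \<in> orb q"
  then consider j where "q' = rotate j q" | j where "q' = rotate j (rev q)" unfolding orb_def by blast
  then show ?thesis
  proof cases
    case 1
    obtain k where "rotate k q' = q" using rotate_inverse[of j q] 1 by blast
    then show ?thesis using orb_rotate[of k q'] by simp
  next
    case 2
    obtain i where i: "rev q' = rotate i q" using rev_rotate[of j "rev q"] 2 by auto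
    obtain k where "rotate k (rotate i q) = q" using rotate_inverse by blast
    then show ?thesis using orb_rotate_rev[of k q'] i by simp
  qed
qed

lemma orb_eq: "q' \<in> orb q \<Longrightarrow> orb q' = orb q"
  using orb_subset[of q' q] orb_subset[of q q'] orb_sym[of q' q] by blast

lemma length_orb: "q' \<in> orb q \<Longrightarrow> length q' = length q"
  by (auto simp: orb_def)

text \<open>Reading the list at every natural index turns rotations into shifts and makes the cyclic
  conditions uniform, without a special case at the end of the list.\<close>

definition cyc :: "'a list \<Rightarrow> nat \<Rightarrow> 'a" where
  "cyc q n = q ! (n mod length q)"

lemma cyc_rotate: "q \<noteq> [] \<Longrightarrow> cyc (rotate k q) n = cyc q (n + k)"
  by (simp add: cyc_def nth_rotate mod_add_right_eq add.commute)

text \<open>Positions \<open>n\<close> and \<open>m\<close> are mirror images when n + m is -1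
  modulo the length; the multiple \<open>K\<close> expresses this congruence in natural
  numbers.\<close>

lemma cyc_rev:
  assumes q: "q \<noteq> []" and nm: "n + m + 1 = length q * K"
  shows "cyc (rev q) n = cyc q m"
proof -
  let ?r = "length q"
  have r: "n mod ?r < ?r" "m mod ?r < ?r" using q by auto
  have "(n mod ?r + m mod ?r + 1) mod ?r = 0"
  proof -
    have "(n mod ?r + m mod ?r + 1) mod ?r = (n + m + 1) mod ?r"
      by (subst mod_add_left_eq[symmetric], subst mod_add_eq, rule mod_add_left_eq)
    then show ?thesis by (simp only: nm mod_mult_self1_is_0)
  qed
  then obtain k where k: "n mod ?r + m mod ?r + 1 = ?r * k" by auto
  have "?r * k < ?r * 2" using k r by linarith
  then have "k < 2" by simp
  moreover have "k \<noteq> 0" using k by (intro notI) simp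
  ultimately have "k = 1" by simp
  then have "m mod ?r = ?r - Suc (n mod ?r)" using k by simp
  then show ?thesis using r by (simp add: cyc_def rev_nth)
qed

lemma closed_cyc: "is_closed q \<longleftrightarrow> q \<noteq> [] \<and> (\<forall>n. adj (cyc q n) (cyc q (n + 1)) \<and> cyc q (n + 2) \<noteq> cyc q n)"
proof (cases "q = []")
  case False
  have "(\<forall>i<length q. adj (q ! i) (q ! ((i + 1) mod length q)) \<and> q ! ((i + 2) mod length q) \<noteq> q ! i) \<longleftrightarrow>
     (\<forall>n. adj (cyc q n) (cyc q (n + 1)) \<and> cyc q (n + 2) \<noteq> cyc q n)" (is "?A \<longleftrightarrow> ?B")
  proof
    assume A: ?A
    show ?B
    proof
      fix n
      have "n mod length q < length q" using False by simp
      with A have "adj (q ! (n mod length q)) (q ! ((n mod length q + 1) mod length q)) \<and> q ! ((n mod length q + 2) mod length q) \<noteq> q ! (n mod length q)"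
        by blast
      then show "adj (cyc q n) (cyc q (n + 1)) \<and> cyc q (n + 2) \<noteq> cyc q n"
        unfolding cyc_def mod_add_left_eq .
    qed
  next
    assume B: ?B
    show ?A
    proof (intro allI impI)
      fix i assume "i < length q"
      then show "adj (q ! i) (q ! ((i + 1) mod length q)) \<and> q ! ((i + 2) mod length q) \<noteq> q ! i"
        using B[rule_format, of i] unfolding cyc_def by simp
    qed
  qed
  then show ?thesis by (simp add: is_closed_def)
qed (simp add: is_closed_def)

lemma adj_sym: "adj u v \<longleftrightarrow> adj v u"
  unfolding adj_def by (simp add: abs_minus_commute)

lemma closed_rotate: "is_closed q \<Longrightarrow> is_closed (rotate k q)"
proof -
  assume q: "is_closed q"
  then have ne: "q \<noteq> []" by (simp add: is_closed_def)
  have "adj (cyc (rotate k q) n) (cyc (rotate k q) (n + 1)) \<and> cyc (rotate k q) (n + 2) \<noteq> cyc (rotate k q) n" for n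
  proof -
    have "adj (cyc q (n + k)) (cyc q (n + k + 1))" "cyc q (n + k + 2) \<noteq> cyc q (n + k)" using q unfolding closed_cyc by blast+
    moreover have "n + k + 1 = n + 1 + k" "n + k + 2 = n + 2 + k" by simp_all
    ultimately show ?thesis unfolding cyc_rotate[OF ne] by metis
  qed
  then show ?thesis using ne by (simp add: closed_cyc)
qed

lemma cyc_rev_window:
  assumes q: "q \<noteq> []"
  obtains m where "cyc (rev q) n = cyc q (m + 2)" "cyc (rev q) (n + 1) = cyc q (m + 1)" "cyc (rev q) (n + 2) = cyc q m"
proof -
  let ?r = "length q"
  define m where "m = ?r * (n + 3) - (n + 3)"
  have "n + 3 \<le> ?r * (n + 3)" using q by (cases q) simp_all
  then have "(n + 3) + m = ?r * (n + 3)" unfolding m_def by (rule le_add_diff_inverse)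
  then have "n + (m + 2) + 1 = ?r * (n + 3)" "(n + 1) + (m + 1) + 1 = ?r * (n + 3)" "(n + 2) + m + 1 = ?r * (n + 3)"
    by linarith+
  from this[THEN cyc_rev[OF q]] show ?thesis by (rule that)
qed

lemma closed_rev: "is_closed q \<Longrightarrow> is_closed (rev q)"
proof -
  assume q: "is_closed q"
  then have ne: "q \<noteq> []" by (simp add: is_closed_def)
  have "adj (cyc (rev q) n) (cyc (rev q) (n + 1)) \<and> cyc (rev q) (n + 2) \<noteq> cyc (rev q) n" for n
  proof -
    obtain m where "cyc (rev q) n = cyc q (m + 2)" "cyc (rev q) (n + 1) = cyc q (m + 1)" "cyc (rev q) (n + 2) = cyc q m"
      using cyc_rev_window[OF ne] by blast
    moreover have "adj (cyc q (m + 1)) (cyc q (m + 1 + 1))" "cyc q (m + 2) \<noteq> cyc q m" using q unfolding closed_cyc by blast+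
    moreover have "m + 1 + 1 = m + 2" by simp
    ultimately show ?thesis using adj_sym by metis
  qed
  then show ?thesis using ne by (simp add: closed_cyc)
qed

lemma closed_orb: "is_closed q \<Longrightarrow> q' \<in> orb q \<Longrightarrow> is_closed q'"
  using closed_rotate closed_rev by (auto simp: orb_def)

lemma winding_cyc: "winding q = (\<Sum>i<length q. turn_angle (cyc q i) (cyc q (i + 1)) (cyc q (i + 2)))"
  unfolding winding_def cyc_def by (intro sum.cong) auto

lemma turn_periodic: "turn_angle (cyc q (n mod length q)) (cyc q (n mod length q + 1)) (cyc q (n mod length q + 2)) =
    turn_angle (cyc q n) (cyc q (n + 1)) (cyc q (n + 2))"
  unfolding cyc_def mod_add_left_eq mod_mod_trivial ..

lemma winding_rotate: "winding (rotate k q) = winding q"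
proof -
  define F where "F n = turn_angle (cyc q n) (cyc q (n + 1)) (cyc q (n + 2))" for n
  have "winding (rotate k q) = (\<Sum>i<length q. F (i + k))"
    unfolding winding_cyc F_def length_rotate
  proof (intro sum.cong refl)
    fix i assume "i \<in> {..<length q}"
    then have "q \<noteq> []" by auto
    then show "turn_angle (cyc (rotate k q) i) (cyc (rotate k q) (i + 1)) (cyc (rotate k q) (i + 2)) =
        turn_angle (cyc q (i + k)) (cyc q (i + k + 1)) (cyc q (i + k + 2))"
      by (simp add: cyc_rotate)
  qed
  also have "\<dots> = (\<Sum>i<length q. F i)"
    by (rule sum_cyc) (simp only: F_def turn_periodic)
  finally show ?thesis by (simp add: winding_cyc F_def)
qed

lemma turn_reverse:
  assumes "adj u v" "adj v w" "w \<noteq> u"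
  shows "turn_angle w v u = - turn_angle u v w"
proof -
  obtain d where d: "v = stp u d" using assms(1) adj_iff_stp by blast
  obtain d' where d': "w = stp v d'" using assms(2) adj_iff_stp by blast
  have "d' \<noteq> opp d" using assms(3) d d' by auto
  moreover have "cvec v u = cdir (opp d)" using cvec_stp[of v "opp d"] d by simp
  moreover have "cvec w v = cdir (opp d')" using cvec_stp[of w "opp d'"] d' by simp
  moreover have "cvec u v = cdir d" "cvec v w = cdir d'" using cvec_stp d d' by auto
  moreover have "Arg \<i> = pi / 2" "Arg (- \<i>) = - (pi / 2)" by (simp_all add: Arg_ii Arg_minus_ii)
  ultimately show ?thesis unfolding turn_angle_def by (cases d; cases d'; simp)
qed

lemma winding_rev:
  assumes q: "is_closed q"
  shows "winding (rev q) = - winding q"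
proof -
  let ?r = "length q"
  define F where "F n = turn_angle (cyc q n) (cyc q (n + 1)) (cyc q (n + 2))" for n
  have ne: "q \<noteq> []" using q by (simp add: is_closed_def)
  then have r: "?r > 0" by simp
  have "winding (rev q) = (\<Sum>i<?r. - F ((?r - Suc i) + (2 * ?r - 2)))"
    unfolding winding_cyc length_rev
  proof (intro sum.cong refl)
    fix i assume "i \<in> {..<?r}"
    then have i: "i < ?r" by simp
    define m where "m = (?r - Suc i) + (2 * ?r - 2)"
    have m: "i + m + 3 = ?r * 3" using i by (simp add: m_def)
    have "cyc (rev q) i = cyc q (m + 2)" "cyc (rev q) (i + 1) = cyc q (m + 1)" "cyc (rev q) (i + 2) = cyc q m"
      by (rule cyc_rev[OF ne, where K = 3], use m in linarith)+
    moreover have "adj (cyc q m) (cyc q (m + 1))" "adj (cyc q (m + 1)) (cyc q (m + 1 + 1))" "cyc q (m + 2) \<noteq> cyc q m"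
      using q unfolding closed_cyc by blast+
    moreover have "m + 1 + 1 = m + 2" by simp
    ultimately show "turn_angle (cyc (rev q) i) (cyc (rev q) (i + 1)) (cyc (rev q) (i + 2)) = - F m"
      unfolding F_def using turn_reverse by metis
  qed
  also have "\<dots> = - (\<Sum>i<?r. F (i + (2 * ?r - 2)))"
    unfolding sum_negf using sum.nat_diff_reindex[of "\<lambda>i. F (i + (2 * ?r - 2))" ?r] by simp
  also have "(\<Sum>i<?r. F (i + (2 * ?r - 2))) = (\<Sum>i<?r. F i)"
    by (rule sum_cyc) (simp only: F_def turn_periodic)
  finally show ?thesis by (simp add: winding_cyc F_def)
qed

definition phase :: "vtx list \<Rightarrow> complex" where
  "phase q = exp (\<i> * complex_of_real (winding q / 2))"

text \<open>Reversal negates the winding and so conjugates the phase, which is real by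
  \<open>phase_winding\<close>. Thus unoriented loops have a well-defined sign.\<close>

lemma phase_rev: "is_closed q \<Longrightarrow> phase (rev q) = phase q"
proof -
  assume q: "is_closed q"
  have "phase (rev q) = cnj (phase q)"
    by (simp add: phase_def winding_rev[OF q] exp_cnj)
  also have "\<dots> = phase q" unfolding phase_def phase_winding[OF q] by simp
  finally show ?thesis .
qed

lemma phase_orb: "is_closed q \<Longrightarrow> q' \<in> orb q \<Longrightarrow> phase q' = phase q"
  using phase_rev by (auto simp: orb_def phase_def winding_rotate)

section \<open>Translations and lexicographically smallest representatives\<close>

definition trl :: "vtx \<Rightarrow> vtx list \<Rightarrow> vtx list" where
  "trl t q = map (\<lambda>v. v + t) q"

lemma length_trl [simp]: "length (trl t q) = length q"
  by (simp add: trl_def)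

lemma trl_trl: "trl s (trl t q) = trl (t + s) q"
  by (simp add: trl_def add.assoc o_def)

lemma trl_0 [simp]: "trl 0 q = q"
  by (simp add: trl_def)

lemma nth_trl: "i < length q \<Longrightarrow> trl t q ! i = q ! i + t"
  by (simp add: trl_def)

lemma cyc_trl: "q \<noteq> [] \<Longrightarrow> cyc (trl t q) n = cyc q n + t"
  by (simp add: cyc_def nth_trl)

lemma rotate_trl: "rotate k (trl t q) = trl t (rotate k q)"
  by (simp add: trl_def rotate_map)

lemma rev_trl: "rev (trl t q) = trl t (rev q)"
  by (simp add: trl_def rev_map)

lemma orb_trl: "orb (trl t q) = trl t ` orb q"
  by (simp add: orb_def rotate_trl rev_trl image_Un image_image)

lemma adj_trl: "adj (u + t) (v + t) \<longleftrightarrow> adj u v"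
  by (simp add: adj_def)

lemma closed_trl: "is_closed (trl t q) \<longleftrightarrow> is_closed q"
proof (cases "q = []")
  case False
  moreover from False have "trl t q \<noteq> []" by (simp add: trl_def)
  ultimately show ?thesis by (simp add: closed_cyc cyc_trl adj_trl)
qed (simp add: trl_def)

lemma phase_trl: "phase (trl t q) = phase q"
proof (cases "q = []")
  case False
  have "turn_angle (u + t) (v + t) (w + t) = turn_angle u v w" for u v w
    by (simp add: turn_angle_def cvec_def)
  then show ?thesis using False by (simp add: phase_def winding_cyc cyc_trl)
qed (simp add: trl_def)

abbreviation "ptr \<equiv> {(u, v). pt_less u v}"

lemma lexord_trl: "(l, w) \<in> lexord ptr \<Longrightarrow> (trl t l, trl t w) \<in> lexord ptr"
proof -
  have *: "pt_less a b \<Longrightarrow> pt_less (a + t) (b + t)" for a b by (auto simp: pt_less_def)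
  assume "(l, w) \<in> lexord ptr"
  then consider a v where "w = l @ a # v" | u a b v x where "pt_less a b" "l = u @ a # v" "w = u @ b # x"
    unfolding lexord_def by auto
  then show ?thesis
  proof cases
    case 1
    then have "trl t w = trl t l @ (a + t) # trl t v" by (simp add: trl_def)
    then show ?thesis unfolding lexord_def by blast
  next
    case 2
    then have "trl t l = trl t u @ (a + t) # trl t v" "trl t w = trl t u @ (b + t) # trl t x" by (simp_all add: trl_def)
    then show ?thesis unfolding lexord_def using *[OF 2(1)] by blast
  qed
qed

lemma lex_le_trl: "list_lex_le l w \<Longrightarrow> list_lex_le (trl t l) (trl t w)"
  unfolding list_lex_le_def using lexord_trl by blast

lemma lex_le_refl: "list_lex_le l l"
  by (simp add: list_lex_le_def)

lemma trans_ptr: "trans ptr"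
  by (auto simp: trans_def pt_less_def)

lemma lex_le_trans: "list_lex_le l w \<Longrightarrow> list_lex_le w z \<Longrightarrow> list_lex_le l z"
  using lexord_trans[OF _ _ trans_ptr] by (auto simp: list_lex_le_def)

lemma lex_le_antisym: "list_lex_le l w \<Longrightarrow> list_lex_le w l \<Longrightarrow> l = w"
proof -
  have "(x, x) \<notin> lexord ptr" for x by (rule lexord_irreflexive) (simp add: pt_less_def)
  then show "list_lex_le l w \<Longrightarrow> list_lex_le w l \<Longrightarrow> l = w"
    using lexord_trans[OF _ _ trans_ptr] by (auto simp: list_lex_le_def)
qed

lemma lex_le_total: "list_lex_le l w \<or> list_lex_le w l"
proof -
  have "\<forall>a b. (a, b) \<in> ptr \<or> a = b \<or> (b, a) \<in> ptr"
    by (auto simp: pt_less_def prod_eq_iff)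
  from lexord_linear[OF this, of l w] show ?thesis by (auto simp: list_lex_le_def)
qed

lemma ex_lex_min: "finite A \<Longrightarrow> A \<noteq> {} \<Longrightarrow> \<exists>m\<in>A. \<forall>x\<in>A. list_lex_le m x"
proof (induction A rule: finite_ne_induct)
  case (insert y A)
  then obtain m where m: "m \<in> A" "\<forall>x\<in>A. list_lex_le m x" by blast
  show ?case
  proof (cases "list_lex_le m y")
    case True
    then show ?thesis using m by auto
  next
    case False
    then have "list_lex_le y m" using lex_le_total by blast
    then show ?thesis using m lex_le_trans lex_le_refl by (intro bexI[of _ y]) blast+
  qed
qed (simp add: lex_le_refl)

lemma is_loop_orb: "is_loop l \<longleftrightarrow> is_closed l \<and> (\<forall>x\<in>orb l. list_lex_le l x)"
proof -
  have "(\<forall>k<length l. list_lex_le l (rotate k l) \<and> list_lex_le l (rotate k (rev l))) \<longleftrightarrow> (\<forall>x\<in>orb l. list_lex_le l x)"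
    if ne: "l \<noteq> []"
  proof
    assume *: "\<forall>k<length l. list_lex_le l (rotate k l) \<and> list_lex_le l (rotate k (rev l))"
    have "list_lex_le l (rotate k l) \<and> list_lex_le l (rotate k (rev l))" for k
    proof -
      have "k mod length l < length l" using ne by simp
      then have "list_lex_le l (rotate (k mod length l) l) \<and> list_lex_le l (rotate (k mod length l) (rev l))" using * by blast
      then show ?thesis by (metis length_rev rotate_conv_mod)
    qed
    then show "\<forall>x\<in>orb l. list_lex_le l x" by (auto simp: orb_def)
  qed (auto simp: orb_def)
  then show ?thesis unfolding is_loop_def is_closed_def by blast
qed

lemma is_loop_trl: "is_loop l \<Longrightarrow> is_loop (trl t l)"
  by (auto simp: is_loop_orb closed_trl orb_trl lex_le_trl)

lemma finite_orb: "finite (orb l)"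
proof -
  have "orb l \<subseteq> {x. set x \<subseteq> set l \<and> length x = length l}" by (auto simp: orb_def)
  then show ?thesis by (rule finite_subset) (simp add: finite_lists_length_eq)
qed

lemma ex_loop: "is_closed p \<Longrightarrow> \<exists>l\<in>orb p. is_loop l"
proof -
  assume p: "is_closed p"
  obtain m where m: "m \<in> orb p" "\<forall>x\<in>orb p. list_lex_le m x"
    using ex_lex_min[OF finite_orb] orb_self by blast
  then have "is_loop m" using closed_orb[OF p] orb_eq[OF m(1)] by (simp add: is_loop_orb)
  with m show ?thesis by blast
qed

lemma loop_unique: "is_loop l \<Longrightarrow> is_loop m \<Longrightarrow> m \<in> orb l \<Longrightarrow> m = l"
  using orb_sym[of m l] lex_le_antisym[of m l] unfolding is_loop_orb by blast

text \<open>Otherwise the cyclic indices of \<open>l\<close> admit a reflection that preserves the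
  vertices. About an index it identifies the two neighbours of that index, which is a backtrack;
  about the middle of a step it identifies the two ends of an edge.\<close>

lemma reversal_free:
  assumes l: "is_closed l"
  shows "rotate k l \<noteq> rotate j (rev l)"
proof
  assume eq: "rotate k l = rotate j (rev l)"
  have ne: "l \<noteq> []" using l by (simp add: is_closed_def)
  obtain k' where "rotate k' (rotate k l) = l" using rotate_inverse by blast
  then obtain m where m: "l = rotate m (rev l)" using eq by (metis rotate_rotate)
  have refl: "cyc l i = cyc l j" if "i + m + j + 1 = length l * K" for i j K
    using cyc_rev[OF ne that] cyc_rotate[of "rev l" m i] m ne by simp
  \<comment> \<open>The reflection sends i to c - i modulo the length. The multiple of the length is
    taken large so that \<open>c\<close> is at least 2 and the even case leaves room for a
    predecessor.\<close>
  define c where "c = length l * (m + 3) - (m + 1)"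
  have le: "m + 3 \<le> length l * (m + 3)" using ne by (cases l) simp_all
  then have "(m + 1) + c = length l * (m + 3)" unfolding c_def by (intro le_add_diff_inverse) linarith
  then have c: "c + m + 1 = length l * (m + 3)" "c \<ge> 2" using le by linarith+
  show False
  proof (cases "even c")
    case True
    then obtain h where h: "c = 2 * h" by blast
    then have "h \<ge> 1" using c(2) by simp
    then obtain i where i: "h = Suc i" by (cases h) auto
    have s: "i + m + (i + 2) + 1 = length l * (m + 3)" using c(1) h i by linarith
    have "cyc l i = cyc l (i + 2)" by (rule refl[OF s])
    then show False using l unfolding closed_cyc by metis
  next
    case False
    then obtain i where i: "c = 2 * i + 1" by (elim oddE)
    have s: "i + m + (i + 1) + 1 = length l * (m + 3)" using c(1) i by linarith
    have "cyc l i = cyc l (i + 1)" by (rule refl[OF s])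
    moreover have "adj (cyc l i) (cyc l (i + 1))" using l unfolding closed_cyc by blast
    ultimately show False by (simp add: adj_def)
  qed
qed

text \<open>Minimality is defined only among periods that divide the length. It extends to every
  positive \<open>p\<close>, because by Bezout the gcd of \<open>p\<close> and the length is again a
  period.\<close>

lemma smallest_period_props:
  assumes ne: "l \<noteq> []"
  shows "0 < smallest_period l" "smallest_period l dvd length l" "rotate (smallest_period l) l = l"
    and "\<And>p. 0 < p \<Longrightarrow> rotate p l = l \<Longrightarrow> smallest_period l \<le> p"
proof -
  let ?P = "\<lambda>p. 0 < p \<and> p dvd length l \<and> rotate p l = l"
  have "?P (length l)" using ne by simp
  then have "?P (smallest_period l)" unfolding smallest_period_def by (rule LeastI[of ?P])
  then show "0 < smallest_period l" "smallest_period l dvd length l" "rotate (smallest_period l) l = l" by auto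
  fix p assume p: "0 < p" "rotate p l = l"
  have iter: "rotate (p * n) l = l" for n
    by (induction n) (simp_all add: p(2) rotate_rotate[symmetric])
  obtain x y where xy: "p * x = length l * y + gcd p (length l)" using p(1) bezout_nat[of p "length l"] by auto
  have "rotate (gcd p (length l)) l = rotate (p * x) l"
    unfolding xy by (metis mod_mult_self4 rotate_conv_mod)
  then have "?P (gcd p (length l))" using iter p(1) by simp
  then have "smallest_period l \<le> gcd p (length l)" unfolding smallest_period_def by (rule Least_le)
  also have "\<dots> \<le> p" using p(1) by (simp add: gcd_le1_nat)
  finally show "smallest_period l \<le> p" .
qed

lemma card_rotations:
  assumes ne: "l \<noteq> []"
  shows "card (range (\<lambda>k. rotate k l)) = smallest_period l"
proof -
  let ?s = "smallest_period l"
  note sp = smallest_period_props[OF ne]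
  have iter: "rotate (?s * n) l = l" for n
    by (induction n) (simp_all add: sp(3) rotate_rotate[symmetric])
  have "rotate k l = rotate (k mod ?s) l" for k
  proof -
    have "rotate k l = rotate (k mod ?s + ?s * (k div ?s)) l" by simp
    also have "\<dots> = rotate (k mod ?s) l" by (simp only: rotate_rotate[symmetric] iter)
    finally show ?thesis .
  qed
  then have "range (\<lambda>k. rotate k l) = (\<lambda>k. rotate k l) ` {..<?s}"
    using sp(1) by (auto simp: image_iff) (metis mod_less_divisor lessThan_iff)
  moreover have "inj_on (\<lambda>k. rotate k l) {..<?s}"
  proof -
    have "j = k" if jk: "j \<le> k" "k < ?s" "rotate j l = rotate k l" for j k
    proof (rule ccontr)
      assume "j \<noteq> k"
      then have d: "0 < k - j" using jk by simp
      have "rotate j (rotate (k - j) l) = rotate j l" using jk by (simp add: rotate_rotate)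
      then have "rotate (k - j) l = l" by (rule rotate_cancel[rotated]) simp
      then have "?s \<le> k - j" using sp(4)[OF d] by blast
      then show False using jk by linarith
    qed
    then show ?thesis by (intro linorder_inj_onI) (auto simp: less_le)
  qed
  ultimately show ?thesis by (simp add: card_image)
qed

text \<open>Rotations and reversed rotations are equally many and, by \<open>reversal_free\<close>,
  disjoint.\<close>

lemma card_orb:
  assumes l: "is_closed l"
  shows "card (orb l) = 2 * smallest_period l"
proof -
  have ne: "l \<noteq> []" using l by (simp add: is_closed_def)
  have "range (\<lambda>k. rotate k (rev l)) = rev ` range (\<lambda>k. rotate k l)"
  proof
    show "rev ` range (\<lambda>k. rotate k l) \<subseteq> range (\<lambda>k. rotate k (rev l))" using rev_rotate by fastforce
    show "range (\<lambda>k. rotate k (rev l)) \<subseteq> rev ` range (\<lambda>k. rotate k l)"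
      using rotate_rev by blast
  qed
  then have "card (range (\<lambda>k. rotate k (rev l))) = smallest_period l"
    using card_rotations[OF ne] by (simp add: card_image)
  moreover have "range (\<lambda>k. rotate k l) \<inter> range (\<lambda>k. rotate k (rev l)) = {}"
    using reversal_free[OF l] by auto
  ultimately show ?thesis
    using finite_orb[of l] card_rotations[OF ne] unfolding orb_def by (subst card_Un_disjoint) auto
qed

lemma loops_at_origin_iff: "l \<in> loops_at_origin r \<longleftrightarrow> l \<in> rooted r \<and> is_loop l"
  by (auto simp: loops_at_origin_def rooted_def is_loop_def)

text \<open>A rooted path need not start at its smallest vertex, so the loop in its orbit usually
  starts elsewhere than at the origin. The lexicographic order is invariant under translations;
  hence every translation class of loops has one member starting at the origin, and moving the root
  of each member of its orbit to the origin reaches every rooted path once.\<close>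

lemma bij_rooted:
  assumes r: "r > 0"
  shows "bij_betw (\<lambda>(l, q). trl (- (q ! 0)) q) (SIGMA l:loops_at_origin r. orb l) (rooted r)"
  unfolding bij_betw_def
proof
  show "inj_on (\<lambda>(l, q). trl (- (q ! 0)) q) (SIGMA l:loops_at_origin r. orb l)"
  proof (rule inj_onI)
    fix a b assume a: "a \<in> (SIGMA l:loops_at_origin r. orb l)" and b: "b \<in> (SIGMA l:loops_at_origin r. orb l)"
      and eq: "(\<lambda>(l, q). trl (- (q ! 0)) q) a = (\<lambda>(l, q). trl (- (q ! 0)) q) b"
    obtain l q where 1: "a = (l, q)" "l \<in> loops_at_origin r" "q \<in> orb l" using a by auto
    obtain m p where 2: "b = (m, p)" "m \<in> loops_at_origin r" "p \<in> orb m" using b by auto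
    \<comment> \<open>Two preimages of one rooted path differ by a translation; it carries one loop
      to the other, and both start at the origin, so it is zero.\<close>
    define t where "t = - (p ! 0) + q ! 0"
    have "trl (q ! 0) (trl (- (q ! 0)) q) = trl (q ! 0) (trl (- (p ! 0)) p)" using eq 1 2 by simp
    then have q: "q = trl t p" by (simp add: trl_trl t_def)
    have "orb l = orb q" using orb_eq[OF 1(3)] by simp
    also have "\<dots> = trl t ` orb p" by (simp add: q orb_trl)
    also have "\<dots> = trl t ` orb m" using orb_eq[OF 2(3)] by simp
    also have "\<dots> = orb (trl t m)" by (simp add: orb_trl)
    finally have "trl t m \<in> orb l" using orb_self by blast
    then have ml: "trl t m = l"
      using loop_unique is_loop_trl 1(2) 2(2) by (simp add: loops_at_origin_iff)
    have "l ! 0 = 0" "m ! 0 = 0" "length m > 0" using 1(2) 2(2) r by (auto simp: loops_at_origin_def zero_prod_def)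
    then have "t = 0" using nth_trl[of 0 m t] ml by simp
    then show "a = b" using ml q 1 2 by simp
  qed
  show "(\<lambda>(l, q). trl (- (q ! 0)) q) ` (SIGMA l:loops_at_origin r. orb l) = rooted r"
  proof (intro equalityI subsetI)
    fix p assume "p \<in> (\<lambda>(l, q). trl (- (q ! 0)) q) ` (SIGMA l:loops_at_origin r. orb l)"
    then obtain l q where 1: "l \<in> loops_at_origin r" "q \<in> orb l" "p = trl (- (q ! 0)) q" by auto
    have "is_closed q" "length q = r" using 1 closed_orb length_orb by (auto simp: loops_at_origin_iff rooted_def)
    then show "p \<in> rooted r" using 1(3) r by (simp add: rooted_def closed_trl nth_trl zero_prod_def)
  next
    fix p assume p: "p \<in> rooted r"
    then have cp: "is_closed p" "length p = r" "p ! 0 = 0" by (auto simp: rooted_def zero_prod_def)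
    obtain m where m: "m \<in> orb p" "is_loop m" using ex_loop[OF cp(1)] by blast
    have lm: "length m = r" using length_orb[OF m(1)] cp by simp
    define l where "l = trl (- (m ! 0)) m"
    have "is_loop l" unfolding l_def by (rule is_loop_trl[OF m(2)])
    moreover have "length l = r" "l ! 0 = (0, 0)" using lm r by (simp_all add: l_def nth_trl zero_prod_def)
    ultimately have l: "l \<in> loops_at_origin r" by (simp add: loops_at_origin_def)
    define q where "q = trl (- (m ! 0)) p"
    have "q \<in> orb l" using orb_sym[OF m(1)] by (simp add: q_def l_def orb_trl)
    moreover have "trl (- (q ! 0)) q = p" using cp r by (simp add: q_def nth_trl trl_trl)
    ultimately show "p \<in> (\<lambda>(l, q). trl (- (q ! 0)) q) ` (SIGMA l:loops_at_origin r. orb l)"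
      using l by (intro image_eqI[of _ _ "(l, q)"]) auto
  qed
qed

text \<open>A loop with smallest period s has multiplicity m = r / s and an orbit of 2 s rooted
  paths with the same phase, so its weight with 1 / m is the total of its orbit divided by 2
  r.\<close>

theorem fcirc_eq:
  assumes r: "r > 0"
  shows "fcirc r x = - complex_of_real (x ^ r * kwtrace0 r / (2 * real r))"
proof -
  have fin: "finite (loops_at_origin r)"
    by (rule finite_subset[OF _ finite_rooted[of r]]) (auto simp: loops_at_origin_iff)
  have "complex_of_real (kwtrace0 r) = (\<Sum>p\<in>rooted r. phase p)"
    unfolding phase_def by (rule kwtrace0_rooted[OF r])
  also have "\<dots> = (\<Sum>a\<in>(SIGMA l:loops_at_origin r. orb l). phase ((\<lambda>(l, q). trl (- (q ! 0)) q) a))"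
    by (rule sum.reindex_bij_betw[OF bij_rooted[OF r], symmetric])
  also have "\<dots> = (\<Sum>(l, q)\<in>(SIGMA l:loops_at_origin r. orb l). phase l)"
    by (intro sum.cong refl) (auto simp: phase_trl phase_orb loops_at_origin_iff rooted_def)
  also have "\<dots> = (\<Sum>l\<in>loops_at_origin r. \<Sum>q\<in>orb l. phase l)"
    by (rule sum.Sigma[symmetric]) (use fin finite_orb in auto)
  also have "\<dots> = (\<Sum>l\<in>loops_at_origin r. of_nat (2 * smallest_period l) * phase l)"
    by (intro sum.cong refl) (simp add: card_orb loops_at_origin_iff rooted_def)
  finally have T: "complex_of_real (kwtrace0 r) = (\<Sum>l\<in>loops_at_origin r. of_nat (2 * smallest_period l) * phase l)" .
  have "fcirc r x = (\<Sum>l\<in>loops_at_origin r. - (complex_of_real (x ^ r) / (2 * of_nat r)) * (of_nat (2 * smallest_period l) * phase l))"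
    unfolding fcirc_def
  proof (intro sum.cong refl)
    fix l assume l: "l \<in> loops_at_origin r"
    then have len: "length l = r" and ne: "l \<noteq> []" using r by (auto simp: loops_at_origin_def)
    note sp = smallest_period_props[OF ne]
    have rm: "r = smallest_period l * mult_loop l" using sp(2) len by (simp add: mult_loop_def)
    then have m: "mult_loop l > 0" using r by (cases "mult_loop l") auto
    have "complex_of_nat r = of_nat (smallest_period l) * of_nat (mult_loop l)" using rm by (metis of_nat_mult)
    then show "loop_weight l x = - (complex_of_real (x ^ r) / (2 * of_nat r)) * (of_nat (2 * smallest_period l) * phase l)"
      using m sp(1) unfolding loop_weight_def sgn_loop_def phase_def[symmetric] len by (simp add: field_simps)
  qed
  also have "\<dots> = - (complex_of_real (x ^ r) / (2 * of_nat r)) * complex_of_real (kwtrace0 r)"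
    unfolding T sum_distrib_left ..
  finally show ?thesis by simp
qed

section \<open>Traces in large rectangles\<close>

fun shrink :: "int \<Rightarrow> rect \<Rightarrow> rect" where
  "shrink n (a, b, c, d) = (a + n, b - n, c + n, d - n)"

lemma stp_shrink: "v \<in> rectV (shrink (n + 1) R) \<Longrightarrow> stp v k \<in> rectV (shrink n R)"
  by (cases R; cases v; cases k) (auto simp: in_rectV)

lemma shrink_mono: "n \<ge> 0 \<Longrightarrow> rectV (shrink n R) \<subseteq> rectV R"
  by (cases R) (auto simp: rectV_def)

lemma dedges_rectE: "(v, k) \<in> dedges (rectE R) \<longleftrightarrow> v \<in> rectV R \<and> stp v k \<in> rectV R"
  by (simp add: dedges_def ed_in_rectE)

lemma shrink_dedges: "v \<in> rectV (shrink 1 R) \<Longrightarrow> (v, k) \<in> dedges (rectE R)"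
  using stp_shrink[of v 0 R k] shrink_mono[of 1 R] shrink_mono[of 0 R] by (auto simp: dedges_rectE)

lemma shrink_antimono: "m \<le> n \<Longrightarrow> rectV (shrink n R) \<subseteq> rectV (shrink m R)"
  by (cases R) (auto simp: rectV_def)

text \<open>One application moves the walk by one site, so from depth r + 1 all sites entered in
  \<open>r\<close> applications have depth at least 1, and there all four outgoing edges belong to
  the rectangle.\<close>

lemma kwop_local:
  "u \<in> rectV (shrink (int r + 1) R) \<Longrightarrow>
    (kwop (dedges (rectE R)) ^^ r) f (u, d) = (kwop UNIV ^^ r) f (u, d)"
proof (induction r arbitrary: u d)
  case (Suc r)
  have v: "stp u d \<in> rectV (shrink (int r + 1) R)"
    using stp_shrink[of u "int r + 1" R d] Suc.prems by (simp add: add.commute)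
  then have "stp u d \<in> rectV (shrink 1 R)" using shrink_antimono[of 1 "int r + 1" R] by auto
  then have "(stp u d, d') \<in> dedges (rectE R)" for d' by (rule shrink_dedges)
  then show ?case using Suc.IH[OF v] by (simp add: kwop_def)
qed simp

definition kwdiag :: "nat \<Rightarrow> dir \<Rightarrow> real" where
  "kwdiag r d = (kwop UNIV ^^ r) (dlt ((0, 0), d)) ((0, 0), d)"

lemma kwdiag_translate: "(kwop UNIV ^^ r) (dlt (u, d)) (u, d) = kwdiag r d"
  unfolding kwdiag_def kwop_UNIV_pow
proof (intro sum.cong refl arg_cong2[where f = "(*)"])
  fix ds :: "dir list"
  show "dlt (u, d) (endp (u, d) ds) = dlt ((0, 0), d) (endp ((0, 0), d) ds)"
    by (cases "ds = []") (auto simp: dlt_def endp_eq zero_prod_def[symmetric] add.assoc)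
qed

lemma kwdiag_local:
  assumes "u \<in> rectV (shrink (int r + 1) R)"
  shows "(kwop (dedges (rectE R)) ^^ r) (dlt (u, d)) (u, d) = kwdiag r d"
  using kwop_local[OF assms] kwdiag_translate by simp

lemma finite_dedges_rectE [simp]: "finite (dedges (rectE R))"
  by (rule kw_graph.finite_dedges[OF kw_graph_rect])

text \<open>The bound is borrowed from a finite square around the origin, large enough that its
  diagonal entry is the one of the lattice; this avoids an operator norm on an infinite-dimensional
  space.\<close>

lemma kwdiag_bound: "\<bar>kwdiag r d\<bar> \<le> (1 + sqrt 2) ^ r"
proof -
  define R :: rect where "R = (- int r - 1, int r + 1, - int r - 1, int r + 1)"
  have 0: "(0, 0) \<in> rectV (shrink (int r + 1) R)" by (simp add: R_def in_rectV)
  then have "(0, 0) \<in> rectV (shrink 1 R)" using shrink_antimono[of 1 "int r + 1" R] by auto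
  then have "((0, 0), d) \<in> dedges (rectE R)" by (rule shrink_dedges)
  from kwop_dlt_bound[OF finite_dedges_rectE this, of r] show ?thesis
    using kwdiag_local[OF 0] by simp
qed

lemma kwtrace0_diag: "kwtrace0 r = (\<Sum>d\<in>UNIV. kwdiag r d)"
  by (simp add: kwtrace0_def kwdiag_def)

lemma card_dir: "card (UNIV :: dir set) = 4"
  by (simp add: UNIV_dir)

lemma kwtrace0_bound: "\<bar>kwtrace0 r\<bar> \<le> 4 * (1 + sqrt 2) ^ r"
proof -
  have "\<bar>kwtrace0 r\<bar> \<le> (\<Sum>d\<in>(UNIV :: dir set). (1 + sqrt 2) ^ r)"
    unfolding kwtrace0_diag by (rule order_trans[OF sum_abs]) (intro sum_mono kwdiag_bound)
  then show ?thesis by (simp add: card_dir)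
qed

text \<open>Sites of depth r + 1 contribute \<open>kwtrace0 r\<close> exactly. At any other site the
  finite and the lattice contribution are each a sum of at most four bounded entries, hence the
  8.\<close>

lemma kwtr_approx:
  "\<bar>kwtr (dedges (rectE R)) r - card (rectV R) * kwtrace0 r\<bar>
    \<le> 8 * (1 + sqrt 2) ^ r * card (rectV R - rectV (shrink (int r + 1) R))"
proof -
  let ?D = "dedges (rectE R)" and ?S = "rectV (shrink (int r + 1) R)" and ?V = "rectV R"
  define q where "q = (1 + sqrt 2 :: real) ^ r"
  define g where "g v = (\<Sum>d\<in>UNIV. if (v, d) \<in> ?D then (kwop ?D ^^ r) (dlt (v, d)) (v, d) else 0)" for v
  have SV: "?S \<subseteq> ?V" by (rule shrink_mono) simp
  have "kwtr ?D r = (\<Sum>p\<in>{p \<in> ?V \<times> UNIV. p \<in> ?D}. (kwop ?D ^^ r) (dlt p) p)"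
    unfolding kwtr_def by (intro sum.cong) (auto simp: dedges_rectE)
  also have "\<dots> = (\<Sum>p\<in>?V \<times> UNIV. if p \<in> ?D then (kwop ?D ^^ r) (dlt p) p else 0)"
    by (rule sum.inter_filter) simp
  also have "\<dots> = (\<Sum>v\<in>?V. g v)"
    unfolding g_def sum.cartesian_product by (intro sum.cong refl) (auto split: prod.split)
  finally have "kwtr ?D r - card ?V * kwtrace0 r = (\<Sum>v\<in>?V. g v - kwtrace0 r)"
    by (simp add: sum_subtractf)
  also have "\<dots> = (\<Sum>v\<in>?V - ?S. g v - kwtrace0 r)"
  proof (rule sum.mono_neutral_right)
    show "\<forall>v\<in>?V - (?V - ?S). g v - kwtrace0 r = 0"
    proof
      fix v assume "v \<in> ?V - (?V - ?S)"
      then have v: "v \<in> ?S" by auto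
      then have "v \<in> rectV (shrink 1 R)" using shrink_antimono[of 1 "int r + 1" R] by auto
      then have "(v, d) \<in> ?D" for d by (rule shrink_dedges)
      then show "g v - kwtrace0 r = 0" using kwdiag_local[OF v] by (simp add: g_def kwtrace0_diag)
    qed
  qed auto
  finally have "\<bar>kwtr ?D r - card ?V * kwtrace0 r\<bar> \<le> (\<Sum>v\<in>?V - ?S. \<bar>g v - kwtrace0 r\<bar>)" by simp
  also have "\<dots> \<le> (\<Sum>v\<in>?V - ?S. 8 * q)"
  proof (intro sum_mono)
    fix v
    have "\<bar>g v\<bar> \<le> (\<Sum>d\<in>(UNIV :: dir set). q)"
      unfolding g_def
    proof (rule order_trans[OF sum_abs], intro sum_mono)
      fix d :: dir
      have "q \<ge> 0" by (simp add: q_def)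
      then show "\<bar>if (v, d) \<in> ?D then (kwop ?D ^^ r) (dlt (v, d)) (v, d) else 0\<bar> \<le> q"
        using kwop_dlt_bound[OF finite_dedges_rectE, of "(v, d)" R r] by (simp add: q_def)
    qed
    then show "\<bar>g v - kwtrace0 r\<bar> \<le> 8 * q"
      using kwtrace0_bound[of r] by (simp add: card_dir q_def)
  qed
  finally show ?thesis by (simp add: q_def mult_ac)
qed

lemma card_dedges_le: "card (dedges (rectE R)) \<le> 4 * card (rectV R)"
proof -
  have "card (dedges (rectE R)) \<le> card (rectV R \<times> (UNIV :: dir set))"
  proof (rule card_mono)
    show "dedges (rectE R) \<subseteq> rectV R \<times> UNIV"
    proof
      fix p assume "p \<in> dedges (rectE R)"
      then show "p \<in> rectV R \<times> UNIV" by (cases p) (simp add: dedges_rectE)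
    qed
  qed simp
  then show ?thesis by (simp add: card_cartesian_product card_dir)
qed

lemma card_dedges_ge: "4 * card (rectV (shrink 1 R)) \<le> card (dedges (rectE R))"
proof -
  have "card (rectV (shrink 1 R) \<times> (UNIV :: dir set)) \<le> card (dedges (rectE R))"
    by (intro card_mono subsetI) (auto intro: shrink_dedges)
  then show ?thesis by (simp add: card_cartesian_product card_dir)
qed

lemma card_dedges: "card (dedges (rectE R)) = 2 * card (rectE R)"
proof -
  interpret kw_graph "rectE R" "fst (snd R)" by (rule kw_graph_rect)
  have "real (card (dedges (rectE R))) = 2 * real (card (rectE R))" using sum_dedges[of "\<lambda>_. 1"] by simp
  then show ?thesis by linarith
qed

lemma rectE_card_le: "card (rectE R) \<le> 2 * card (rectV R)"
  using card_dedges_le[of R] card_dedges[of R] by linarith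

lemma boundary_subset: "rect_boundary R \<subseteq> rectV R - rectV (shrink 1 R)"
proof
  fix u assume u: "u \<in> rect_boundary R"
  then obtain w where w: "u \<in> rectV R" "adj u w" "w \<notin> rectV R" by (auto simp: rect_boundary_def)
  then obtain k where "w = stp u k" using adj_iff_stp by blast
  then have "u \<notin> rectV (shrink 1 R)" using shrink_dedges[of u R k] w by (auto simp: dedges_rectE)
  then show "u \<in> rectV R - rectV (shrink 1 R)" using w by simp
qed

section \<open>The limit along rectangles\<close>

lemma ex_rect: "finite F \<Longrightarrow> \<exists>R. F \<subseteq> rectV R"
proof -
  assume F: "finite F"
  define M where "M = (\<Sum>v\<in>F. \<bar>fst v\<bar> + \<bar>snd v\<bar>)"
  have "F \<subseteq> rectV (-M, M, -M, M)"
  proof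
    fix v assume "v \<in> F"
    then have "\<bar>fst v\<bar> + \<bar>snd v\<bar> \<le> M" unfolding M_def using F by (intro member_le_sum) auto
    then show "v \<in> rectV (-M, M, -M, M)" by (cases v) (auto simp: in_rectV)
  qed
  then show ?thesis by blast
qed

lemma eventually_rect: "finite F \<Longrightarrow> eventually (\<lambda>R. F \<subseteq> rectV R) rect_filter"
proof -
  assume "finite F"
  then have "rect_filter \<le> principal {R. F \<subseteq> rectV R}" unfolding rect_filter_def by (intro INF_lower) simp
  then show ?thesis by (rule filter_leD) (simp add: eventually_principal)
qed

lemma eventually_rect_iff: "eventually P rect_filter \<longleftrightarrow> (\<exists>F. finite F \<and> (\<forall>R. F \<subseteq> rectV R \<longrightarrow> P R))"
proof -
  have "eventually P rect_filter \<longleftrightarrow> (\<exists>F\<in>{F. finite F}. eventually P (principal {R. F \<subseteq> rectV R}))"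
    unfolding rect_filter_def
  proof (rule eventually_INF_base)
    show "{F :: vtx set. finite F} \<noteq> {}" by auto
    fix A B :: "vtx set" assume "A \<in> {F. finite F}" "B \<in> {F. finite F}"
    then show "\<exists>x\<in>{F. finite F}. principal {R. x \<subseteq> rectV R} \<le> inf (principal {R. A \<subseteq> rectV R}) (principal {R. B \<subseteq> rectV R})"
      by (intro bexI[of _ "A \<union> B"]) auto
  qed
  then show ?thesis by (simp add: eventually_principal)
qed

lemma rect_filter_neq_bot [simp]: "rect_filter \<noteq> bot"
proof
  assume "rect_filter = bot"
  then have "eventually (\<lambda>_. False) rect_filter" by simp
  then obtain F where F: "finite F" "\<forall>R. F \<subseteq> rectV R \<longrightarrow> False" unfolding eventually_rect_iff by blast
  then show False using ex_rect[OF F(1)] by blast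
qed

section \<open>Asymptotics of volumes, edges and boundaries\<close>

definition wd :: "rect \<Rightarrow> real" where "wd R = (case R of (a, b, c, d) \<Rightarrow> real_of_int (b - a + 1))"
definition ht :: "rect \<Rightarrow> real" where "ht R = (case R of (a, b, c, d) \<Rightarrow> real_of_int (d - c + 1))"

lemma wd_at_top: "filterlim wd at_top rect_filter" and ht_at_top: "filterlim ht at_top rect_filter"
proof -
  have *: "eventually (\<lambda>R. Z \<le> wd R \<and> Z \<le> ht R) rect_filter" for Z
  proof -
    define M where "M = \<lceil>\<bar>Z\<bar>\<rceil>"
    have M: "Z \<le> real_of_int M" "M \<ge> 0" unfolding M_def by linarith+
    have "eventually (\<lambda>R. {(0, 0), (M, M)} \<subseteq> rectV R) rect_filter" by (rule eventually_rect) simp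
    then show ?thesis
    proof eventually_elim
      case (elim R)
      obtain a b c d where R: "R = (a, b, c, d)" by (cases R)
      have "M \<le> b - a + 1" "M \<le> d - c + 1" using elim by (auto simp: R in_rectV)
      then have "real_of_int M \<le> wd R" "real_of_int M \<le> ht R" unfolding wd_def ht_def R by (simp_all only: prod.case of_int_le_iff)
      then show ?case using M by linarith
    qed
  qed
  have "eventually (\<lambda>R. Z \<le> wd R) rect_filter" "eventually (\<lambda>R. Z \<le> ht R) rect_filter" for Z
    by (rule eventually_mono[OF *[of Z]], simp)+
  then show "filterlim wd at_top rect_filter" "filterlim ht at_top rect_filter"
    unfolding filterlim_at_top by blast+
qed

lemma card_rectV: "wd R \<ge> 0 \<Longrightarrow> ht R \<ge> 0 \<Longrightarrow> real (card (rectV R)) = wd R * ht R"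
  by (cases R) (auto simp: wd_def ht_def rectV_def card_cartesian_product)

lemma wd_shrink: "wd (shrink n R) = wd R - 2 * real_of_int n" and ht_shrink: "ht (shrink n R) = ht R - 2 * real_of_int n"
  by (cases R; simp add: wd_def ht_def)+

lemma shrink_ratio:
  assumes n: "n \<ge> 0"
  shows "((\<lambda>R. card (rectV (shrink n R)) / card (rectV R)) \<longlongrightarrow> 1) rect_filter"
proof -
  let ?m = "2 * real_of_int n"
  have "((\<lambda>R. (1 - ?m / wd R) * (1 - ?m / ht R)) \<longlongrightarrow> (1 - 0) * (1 - 0)) rect_filter"
    by (intro tendsto_intros real_tendsto_divide_at_top[OF tendsto_const] wd_at_top ht_at_top)
  moreover have "eventually (\<lambda>R. wd R \<ge> ?m + 1 \<and> ht R \<ge> ?m + 1) rect_filter"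
    using wd_at_top ht_at_top unfolding filterlim_at_top by (intro eventually_conj) blast+
  then have "eventually (\<lambda>R. (1 - ?m / wd R) * (1 - ?m / ht R) = card (rectV (shrink n R)) / card (rectV R)) rect_filter"
  proof eventually_elim
    case (elim R)
    have pos: "wd R > 0" "ht R > 0" using elim n by auto
    have "real (card (rectV R)) = wd R * ht R" using pos by (intro card_rectV) auto
    moreover have "real (card (rectV (shrink n R))) = (wd R - ?m) * (ht R - ?m)"
      using elim card_rectV[of "shrink n R"] by (simp add: wd_shrink ht_shrink)
    ultimately show ?case using pos by (simp add: field_simps)
  qed
  ultimately show ?thesis by (auto intro: Lim_transform_eventually)
qed

lemma eventually_card_pos: "eventually (\<lambda>R. card (rectV R) > 0) rect_filter"
  by (rule eventually_mono[OF eventually_rect[of "{(0, 0)}"]]) (auto simp: card_gt_0_iff)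

lemma shell_ratio:
  assumes n: "n \<ge> 0"
  shows "((\<lambda>R. card (rectV R - rectV (shrink n R)) / card (rectV R)) \<longlongrightarrow> 0) rect_filter"
proof -
  have "((\<lambda>R. 1 - card (rectV (shrink n R)) / card (rectV R)) \<longlongrightarrow> 1 - 1) rect_filter"
    by (intro tendsto_diff tendsto_const shrink_ratio n)
  moreover have "eventually (\<lambda>R. 1 - card (rectV (shrink n R)) / card (rectV R) =
      card (rectV R - rectV (shrink n R)) / card (rectV R)) rect_filter"
    using eventually_card_pos
  proof eventually_elim
    case (elim R)
    have "card (rectV R - rectV (shrink n R)) = card (rectV R) - card (rectV (shrink n R))"
      by (rule card_Diff_subset) (use shrink_mono[OF n] in auto)
    moreover have "card (rectV (shrink n R)) \<le> card (rectV R)" by (rule card_mono) (use shrink_mono[OF n] in auto)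
    moreover have "rectV R \<noteq> {}" using elim by auto
    ultimately show ?case using elim by (simp add: of_nat_diff diff_divide_distrib)
  qed
  ultimately show ?thesis by (auto intro: Lim_transform_eventually)
qed

lemma kwtr_ratio: "((\<lambda>R. kwtr (dedges (rectE R)) r / card (rectV R)) \<longlongrightarrow> kwtrace0 r) rect_filter"
proof (rule LIM_zero_cancel, rule Lim_null_comparison)
  show "((\<lambda>R. 8 * (1 + sqrt 2) ^ r * (card (rectV R - rectV (shrink (int r + 1) R)) / card (rectV R))) \<longlongrightarrow> 0) rect_filter"
    by (intro tendsto_mult_right_zero shell_ratio) simp
  show "eventually (\<lambda>R. norm (kwtr (dedges (rectE R)) r / card (rectV R) - kwtrace0 r)
    \<le> 8 * (1 + sqrt 2) ^ r * (card (rectV R - rectV (shrink (int r + 1) R)) / card (rectV R))) rect_filter"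
    using eventually_card_pos
  proof eventually_elim
    case (elim R)
    have "rectV R \<noteq> {}" using elim by auto
    then have "kwtr (dedges (rectE R)) r / card (rectV R) - kwtrace0 r =
       (kwtr (dedges (rectE R)) r - card (rectV R) * kwtrace0 r) / card (rectV R)"
      by (simp add: field_simps)
    then have "norm (kwtr (dedges (rectE R)) r / card (rectV R) - kwtrace0 r) =
       \<bar>kwtr (dedges (rectE R)) r - card (rectV R) * kwtrace0 r\<bar> / card (rectV R)"
      by (simp only: real_norm_def abs_divide abs_of_nat)
    also have "\<dots> \<le> (8 * (1 + sqrt 2) ^ r * card (rectV R - rectV (shrink (int r + 1) R))) / card (rectV R)"
      by (intro divide_right_mono kwtr_approx) simp
    finally show ?case by simp
  qed
qed

lemma edge_ratio: "((\<lambda>R. card (rectE R) / card (rectV R)) \<longlongrightarrow> 2) rect_filter"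
proof (rule tendsto_sandwich)
  show "((\<lambda>R. 2 * (card (rectV (shrink 1 R)) / card (rectV R))) \<longlongrightarrow> 2) rect_filter"
    using tendsto_mult[OF tendsto_const[of 2] shrink_ratio[of 1]] by simp
  show "((\<lambda>R. 2 :: real) \<longlongrightarrow> 2) rect_filter" by simp
  show "eventually (\<lambda>R. 2 * (card (rectV (shrink 1 R)) / card (rectV R)) \<le> card (rectE R) / card (rectV R)) rect_filter"
  proof (rule always_eventually, rule allI)
    fix R
    have "2 * card (rectV (shrink 1 R)) \<le> card (rectE R)" using card_dedges_ge[of R] card_dedges[of R] by linarith
    then have "real (2 * card (rectV (shrink 1 R))) / card (rectV R) \<le> card (rectE R) / card (rectV R)"
      by (intro divide_right_mono) (simp_all only: of_nat_le_iff of_nat_0_le_iff)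
    then show "2 * (card (rectV (shrink 1 R)) / card (rectV R)) \<le> card (rectE R) / card (rectV R)" by simp
  qed
  show "eventually (\<lambda>R. card (rectE R) / card (rectV R) \<le> 2) rect_filter"
    using eventually_card_pos
  proof eventually_elim
    case (elim R)
    have "real (card (rectE R)) \<le> 2 * real (card (rectV R))" using rectE_card_le[of R] by linarith
    then show ?case using elim by (simp add: field_simps)
  qed
qed

lemma boundary_ratio: "((\<lambda>R. card (rect_boundary R) / card (rectV R)) \<longlongrightarrow> 0) rect_filter"
proof (rule Lim_null_comparison[OF always_eventually])
  show "((\<lambda>R. card (rectV R - rectV (shrink 1 R)) / card (rectV R)) \<longlongrightarrow> 0) rect_filter" by (rule shell_ratio) simp
  show "\<forall>R. norm (card (rect_boundary R) / card (rectV R)) \<le> card (rectV R - rectV (shrink 1 R)) / card (rectV R)"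
  proof
    fix R
    have "card (rect_boundary R) \<le> card (rectV R - rectV (shrink 1 R))"
      by (rule card_mono[OF _ boundary_subset]) simp
    then show "norm (card (rect_boundary R) / card (rectV R)) \<le> card (rectV R - rectV (shrink 1 R)) / card (rectV R)"
      by (simp add: divide_right_mono)
  qed
qed

definition loopsum :: "real \<Rightarrow> real" where
  "loopsum x = (\<Sum>k. - (x ^ Suc k * kwtrace0 (Suc k) / (2 * real (Suc k))))"

text \<open>Tannery's theorem: each coefficient per site converges, and the norm bound supplies a
  geometric majorant that does not depend on the rectangle. The limiting series inherits absolute
  convergence.\<close>

lemma ln_evenpoly_limit:
  assumes x: "0 \<le> x" "x * (1 + sqrt 2) < 1"
  shows "((\<lambda>R. ln (evenpoly (rectE R) x) / card (rectV R)) \<longlongrightarrow> loopsum x) rect_filter" (is ?lim)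
    and "summable (\<lambda>k. norm (x ^ Suc k * kwtrace0 (Suc k) / (2 * real (Suc k))))" (is ?summ)
proof -
  define a where "a k R = - (x ^ Suc k * (kwtr (dedges (rectE R)) (Suc k) / card (rectV R)) / (2 * real (Suc k)))" for k R
  define b where "b k = - (x ^ Suc k * kwtrace0 (Suc k) / (2 * real (Suc k)))" for k
  define M where "M k = 4 * (x * (1 + sqrt 2)) ^ Suc k" for k
  have q: "0 \<le> x * (1 + sqrt 2)" using x by simp
  have lim: "((\<lambda>R. a k R) \<longlongrightarrow> b k) rect_filter" for k
    unfolding a_def b_def by (intro tendsto_intros kwtr_ratio) simp
  have bound: "norm (a k R) \<le> M k" for k R
  proof -
    have "\<bar>kwtr (dedges (rectE R)) (Suc k)\<bar> \<le> 4 * card (rectV R) * (1 + sqrt 2) ^ Suc k"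
    proof (rule order_trans[OF kwtr_bound[OF finite_dedges_rectE]])
      have "real (card (dedges (rectE R))) \<le> 4 * real (card (rectV R))" using card_dedges_le[of R] by linarith
      then show "real (card (dedges (rectE R))) * (1 + sqrt 2) ^ Suc k \<le> 4 * card (rectV R) * (1 + sqrt 2) ^ Suc k"
        by (intro mult_right_mono) simp_all
    qed
    \<comment> \<open>For an empty rectangle the quotient is 0 by convention, so the majorant holds
      for every \<open>R\<close> and not only eventually.\<close>
    then have 1: "\<bar>kwtr (dedges (rectE R)) (Suc k)\<bar> / card (rectV R) \<le> 4 * (1 + sqrt 2) ^ Suc k"
      by (cases "card (rectV R) = 0") (simp_all add: divide_le_eq mult_ac)
    have "norm (a k R) = x ^ Suc k * (\<bar>kwtr (dedges (rectE R)) (Suc k)\<bar> / card (rectV R)) / (2 * real (Suc k))"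
      using x by (simp add: a_def abs_mult)
    also have "\<dots> \<le> x ^ Suc k * (\<bar>kwtr (dedges (rectE R)) (Suc k)\<bar> / card (rectV R)) / 1"
      using x by (intro divide_left_mono) auto
    also have "\<dots> \<le> x ^ Suc k * (4 * (1 + sqrt 2) ^ Suc k)"
      using x 1 by (simp only: div_by_1, intro mult_left_mono) auto
    finally show ?thesis by (simp add: M_def power_mult_distrib mult_ac)
  qed
  have "summable M" unfolding M_def
    using summable_mult[OF summable_geometric, of "x * (1 + sqrt 2)" "4 * (x * (1 + sqrt 2))"] q x by (simp add: mult.assoc)
  then have *: "eventually (\<lambda>R. summable (\<lambda>k. norm (a k R))) rect_filter \<and> summable (\<lambda>n. norm (b n)) \<and>
      ((\<lambda>R. suminf (\<lambda>k. a k R)) \<longlongrightarrow> suminf b) rect_filter"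
    by (intro tannerys_theorem[OF lim] always_eventually allI) (simp_all only: case_prod_unfold bound rect_filter_neq_bot not_False_eq_True)
  then show ?summ by (simp add: b_def del: of_nat_Suc power_Suc)
  have "suminf (\<lambda>k. a k R) = ln (evenpoly (rectE R) x) / card (rectV R)" for R
  proof -
    have "(\<lambda>k. - (x ^ Suc k * kwtr (dedges (rectE R)) (Suc k) / (2 * real (Suc k))) / card (rectV R)) sums (ln (evenpoly (rectE R) x) / card (rectV R))"
      by (intro sums_divide kw_graph.ln_evenpoly[OF kw_graph_rect] x)
    then have "a_sum sums (ln (evenpoly (rectE R) x) / card (rectV R))" if "a_sum = (\<lambda>k. a k R)" for a_sum
      unfolding that a_def by (simp add: field_simps del: of_nat_Suc power_Suc)
    then show ?thesis by (simp add: sums_iff)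
  qed
  moreover have "suminf b = loopsum x" unfolding loopsum_def b_def[abs_def] ..
  ultimately show ?lim using * by simp
qed

section \<open>The free energy\<close>

definition pressure :: "bcond \<Rightarrow> real \<Rightarrow> rect \<Rightarrow> real" where
  "pressure bc \<beta> R = ln (Zpart bc R \<beta>) / card (rectV R)"

lemma fe_finite_pressure: "fe_finite bc \<beta> R = - (1 / \<beta>) * pressure bc \<beta> R"
  by (simp add: fe_finite_def pressure_def)

lemma evenpoly_rect_pos: "0 \<le> x \<Longrightarrow> evenpoly (rectE R) x > 0"
  by (rule kw_graph.evenpoly_pos[OF kw_graph_rect])

lemma pressure_Free_high:
  assumes x: "0 \<le> tanh \<beta>" "tanh \<beta> * (1 + sqrt 2) < 1"
  shows "(pressure Free \<beta> \<longlongrightarrow> ln (2 * (cosh \<beta>)\<^sup>2) + loopsum (tanh \<beta>)) rect_filter"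
proof -
  have c: "cosh \<beta> > 0" by simp
  have "((\<lambda>R. ln 2 + card (rectE R) / card (rectV R) * ln (cosh \<beta>) + ln (evenpoly (rectE R) (tanh \<beta>)) / card (rectV R))
      \<longlongrightarrow> ln 2 + 2 * ln (cosh \<beta>) + loopsum (tanh \<beta>)) rect_filter"
    by (intro tendsto_intros edge_ratio ln_evenpoly_limit x)
  moreover have "ln (2 * (cosh \<beta>)\<^sup>2) = ln 2 + 2 * ln (cosh \<beta>)"
    using c by (simp add: ln_mult ln_realpow)
  moreover have "eventually (\<lambda>R. ln 2 + card (rectE R) / card (rectV R) * ln (cosh \<beta>) + ln (evenpoly (rectE R) (tanh \<beta>)) / card (rectV R)
      = pressure Free \<beta> R) rect_filter"
    using eventually_card_pos
  proof eventually_elim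
    case (elim R)
    then have V: "rectV R \<noteq> {}" by auto
    have "ln (Zpart Free R \<beta>) = card (rectV R) * ln 2 + card (rectE R) * ln (cosh \<beta>) + ln (evenpoly (rectE R) (tanh \<beta>))"
      unfolding high_temperature using c evenpoly_rect_pos[OF x(1), of R] by (simp add: ln_mult ln_realpow)
    then show ?case using V by (simp add: pressure_def field_simps)
  qed
  ultimately show ?thesis by (auto intro: Lim_transform_eventually)
qed

fun dual_rect :: "rect \<Rightarrow> rect" where
  "dual_rect (a, b, c, d) = (a, b - 1, c, d - 1)"

lemma dual_rect_filter: "filterlim dual_rect rect_filter rect_filter"
  unfolding filterlim_iff
proof (intro allI impI)
  fix P assume "eventually P rect_filter"
  then obtain F where F: "finite F" "\<And>R. F \<subseteq> rectV R \<Longrightarrow> P R" unfolding eventually_rect_iff by blast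
  \<comment> \<open>A rectangle that contains \<open>v\<close> and v + (1, 1) keeps \<open>v\<close>
    after its right and upper sides are moved in by one.\<close>
  have "finite (F \<union> (\<lambda>v. v + (1, 1)) ` F)" using F(1) by simp
  from eventually_rect[OF this] show "eventually (\<lambda>R. P (dual_rect R)) rect_filter"
  proof eventually_elim
    case (elim R)
    obtain a b c d where R: "R = (a, b, c, d)" by (cases R)
    have "F \<subseteq> rectV (dual_rect R)"
    proof
      fix v assume "v \<in> F"
      then have "v \<in> rectV R" "v + (1, 1) \<in> rectV R" using elim by auto
      then show "v \<in> rectV (dual_rect R)" unfolding R by (cases v) (auto simp: in_rectV)
    qed
    then show ?case by (rule F(2))
  qed
qed

lemma dual_rect_ratio: "((\<lambda>R. card (rectV (dual_rect R)) / card (rectV R)) \<longlongrightarrow> 1) rect_filter"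
proof (rule tendsto_sandwich)
  have sub: "rectV (shrink 1 R) \<subseteq> rectV (dual_rect R)" "rectV (dual_rect R) \<subseteq> rectV R" for R
    by (cases R; auto simp: rectV_def)+
  show "((\<lambda>R. card (rectV (shrink 1 R)) / card (rectV R)) \<longlongrightarrow> 1) rect_filter" by (rule shrink_ratio) simp
  show "((\<lambda>R. 1 :: real) \<longlongrightarrow> 1) rect_filter" by simp
  show "eventually (\<lambda>R. card (rectV (shrink 1 R)) / card (rectV R) \<le> card (rectV (dual_rect R)) / card (rectV R)) rect_filter"
    by (intro always_eventually allI divide_right_mono of_nat_mono card_mono sub) auto
  show "eventually (\<lambda>R. card (rectV (dual_rect R)) / card (rectV R) \<le> 1) rect_filter"
  proof (intro always_eventually allI)
    fix R
    have "card (rectV (dual_rect R)) \<le> card (rectV R)" by (intro card_mono sub) simp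
    then show "card (rectV (dual_rect R)) / card (rectV R) \<le> 1"
      by (cases "rectV R = {}") (simp_all add: divide_le_eq_1 card_gt_0_iff)
  qed
qed

lemma pressure_Plus_low:
  assumes x: "exp (- 2 * \<beta>) * (1 + sqrt 2) < 1"
  shows "(pressure Plus \<beta> \<longlongrightarrow> 2 * \<beta> + loopsum (exp (- 2 * \<beta>))) rect_filter"
proof -
  define x where "x = exp (- 2 * \<beta>)"
  have x0: "0 \<le> x" by (simp add: x_def)
  have "((\<lambda>R. ln (evenpoly (rectE (dual_rect R)) x) / card (rectV (dual_rect R))) \<longlongrightarrow> loopsum x) rect_filter"
    using filterlim_compose[OF ln_evenpoly_limit(1)[OF x0] dual_rect_filter] assms by (simp add: x_def)
  then have "((\<lambda>R. card (rectE R) / card (rectV R) * \<beta> + ln (evenpoly (rectE (dual_rect R)) x) / card (rectV (dual_rect R)) * (card (rectV (dual_rect R)) / card (rectV R)))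
      \<longlongrightarrow> 2 * \<beta> + loopsum x * 1) rect_filter"
    by (intro tendsto_intros edge_ratio dual_rect_ratio)
  moreover have "eventually (\<lambda>R. wd R \<ge> 2) rect_filter" "eventually (\<lambda>R. ht R \<ge> 2) rect_filter"
    using wd_at_top ht_at_top unfolding filterlim_at_top by blast+
  then have "eventually (\<lambda>R. card (rectE R) / card (rectV R) * \<beta> + ln (evenpoly (rectE (dual_rect R)) x) / card (rectV (dual_rect R)) * (card (rectV (dual_rect R)) / card (rectV R))
      = pressure Plus \<beta> R) rect_filter"
  proof eventually_elim
    case (elim R)
    obtain a b c d where R: "R = (a, b, c, d)" by (cases R)
    have sides: "a < b" "c < d" using elim by (auto simp: R wd_def ht_def)
    then interpret low_temp a b c d by unfold_locales
    have "dual_rect R = (a, b - 1, c, d - 1)" by (simp add: R)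
    then have Z: "Zpart Plus R \<beta> = exp \<beta> ^ card (rectE R) * evenpoly (rectE (dual_rect R)) x"
      using low_temperature[of \<beta>] by (simp add: R x_def)
    have "ln (Zpart Plus R \<beta>) = card (rectE R) * \<beta> + ln (evenpoly (rectE (dual_rect R)) x)"
      unfolding Z using evenpoly_rect_pos[OF x0, of "dual_rect R"] by (simp add: ln_mult ln_realpow)
    moreover have "(a, c) \<in> rectV (dual_rect R)" using sides by (simp add: R in_rectV)
    then have "rectV (dual_rect R) \<noteq> {}" by auto
    ultimately show ?case by (simp add: pressure_def add_divide_distrib)
  qed
  ultimately show ?thesis by (auto intro: Lim_transform_eventually simp: x_def)
qed

text \<open>Changing the boundary condition costs a bounded amount per boundary vertex, and the
  boundary is negligible against the volume.\<close>

lemma pressure_diff: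
  assumes "\<beta> \<ge> 0"
  shows "((\<lambda>R. pressure Free \<beta> R - pressure Plus \<beta> R) \<longlongrightarrow> 0) rect_filter"
proof (rule Lim_null_comparison[OF always_eventually])
  show "((\<lambda>R. (ln 2 + 8 * \<beta>) * (card (rect_boundary R) / card (rectV R))) \<longlongrightarrow> 0) rect_filter"
    by (intro tendsto_mult_right_zero boundary_ratio)
  show "\<forall>R. norm (pressure Free \<beta> R - pressure Plus \<beta> R) \<le> (ln 2 + 8 * \<beta>) * (card (rect_boundary R) / card (rectV R))"
  proof
    fix R
    have "ln (Zpart Plus R \<beta>) \<le> ln (Zpart Free R \<beta>)"
      using Zpart_Plus_le Zpart_pos by (simp add: ln_le_cancel_iff)
    then have "\<bar>ln (Zpart Free R \<beta>) - ln (Zpart Plus R \<beta>)\<bar> \<le> (ln 2 + 8 * \<beta>) * card (rect_boundary R)"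
      using Zpart_Free_le[OF assms, of R] by linarith
    then have "\<bar>ln (Zpart Free R \<beta>) - ln (Zpart Plus R \<beta>)\<bar> / card (rectV R) \<le> (ln 2 + 8 * \<beta>) * card (rect_boundary R) / card (rectV R)"
      by (rule divide_right_mono) simp
    then show "norm (pressure Free \<beta> R - pressure Plus \<beta> R) \<le> (ln 2 + 8 * \<beta>) * (card (rect_boundary R) / card (rectV R))"
      by (simp add: pressure_def diff_divide_distrib[symmetric])
  qed
qed

lemma pressure_all_bc:
  assumes b: "\<beta> \<ge> 0" and lim: "(pressure bc \<beta> \<longlongrightarrow> p) rect_filter"
  shows "(pressure bc' \<beta> \<longlongrightarrow> p) rect_filter"
proof -
  have "(pressure Free \<beta> \<longlongrightarrow> p) rect_filter \<longleftrightarrow> (pressure Plus \<beta> \<longlongrightarrow> p) rect_filter"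
  proof
    assume "(pressure Free \<beta> \<longlongrightarrow> p) rect_filter"
    from tendsto_diff[OF this pressure_diff[OF b]] show "(pressure Plus \<beta> \<longlongrightarrow> p) rect_filter" by simp
  next
    assume "(pressure Plus \<beta> \<longlongrightarrow> p) rect_filter"
    from tendsto_add[OF this pressure_diff[OF b]] show "(pressure Free \<beta> \<longlongrightarrow> p) rect_filter" by simp
  qed
  then show ?thesis using lim by (cases bc; cases bc') auto
qed

lemma pressure_lipschitz: "\<bar>pressure bc \<beta> R - pressure bc \<gamma> R\<bar> \<le> 2 * \<bar>\<beta> - \<gamma>\<bar>"
proof -
  have E: "real (card (rectE R)) \<le> 2 * card (rectV R)" using rectE_card_le[of R] by linarith
  have "\<bar>ln (Zpart bc R \<beta>) - ln (Zpart bc R \<gamma>)\<bar> \<le> \<bar>\<beta> - \<gamma>\<bar> * card (rectE R)"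
    using Zpart_lipschitz[of bc R \<beta> \<gamma>] Zpart_lipschitz[of bc R \<gamma> \<beta>] by (simp add: abs_minus_commute abs_le_iff)
  also have "\<dots> \<le> \<bar>\<beta> - \<gamma>\<bar> * (2 * card (rectV R))" by (intro mult_left_mono E) simp
  finally have "\<bar>ln (Zpart bc R \<beta>) - ln (Zpart bc R \<gamma>)\<bar> / card (rectV R) \<le> \<bar>\<beta> - \<gamma>\<bar> * (2 * card (rectV R)) / card (rectV R)"
    by (rule divide_right_mono) simp
  also have "\<dots> \<le> 2 * \<bar>\<beta> - \<gamma>\<bar>" by simp
  finally show ?thesis by (simp add: pressure_def diff_divide_distrib[symmetric])
qed

text \<open>Intended for the critical point, where the expansions stop: uniform closeness makes the
  limits at nearby temperatures a Cauchy sequence, and their limit is also that of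
  \<open>g\<close>.\<close>

lemma limit_of_uniform_approximations:
  fixes g :: "'a \<Rightarrow> real"
  assumes F: "F \<noteq> bot" and h: "\<And>n. (h n \<longlongrightarrow> L n) F"
    and e: "\<And>n x. \<bar>g x - h n x\<bar> \<le> e n" "e \<longlonglongrightarrow> 0"
  shows "\<exists>l. (g \<longlongrightarrow> l) F"
proof -
  have LL: "\<bar>L m - L n\<bar> \<le> e m + e n" for m n
  proof (rule tendsto_upperbound[OF _ _ F])
    show "((\<lambda>x. \<bar>h m x - h n x\<bar>) \<longlongrightarrow> \<bar>L m - L n\<bar>) F" by (intro tendsto_intros h)
    have "\<bar>h m x - h n x\<bar> \<le> e m + e n" for x using e(1)[of x m] e(1)[of x n] by linarith
    then show "eventually (\<lambda>x. \<bar>h m x - h n x\<bar> \<le> e m + e n) F" by simp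
  qed
  have "Cauchy L"
  proof (rule metric_CauchyI)
    fix r :: real assume "r > 0"
    then have "eventually (\<lambda>n. dist (e n) 0 < r / 2) sequentially" using e(2) by (intro tendstoD) auto
    then obtain N where N: "\<And>n. n \<ge> N \<Longrightarrow> \<bar>e n\<bar> < r / 2" by (auto simp: eventually_sequentially)
    show "\<exists>M. \<forall>m\<ge>M. \<forall>n\<ge>M. dist (L m) (L n) < r"
    proof (intro exI[of _ N] allI impI)
      fix m n assume "m \<ge> N" "n \<ge> N"
      then have "\<bar>e m\<bar> < r / 2" "\<bar>e n\<bar> < r / 2" using N by auto
      then show "dist (L m) (L n) < r" using LL[of m n] unfolding dist_real_def by linarith
    qed
  qed
  then obtain l where l: "L \<longlonglongrightarrow> l" using real_Cauchy_convergent convergent_def by blast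
  have "(g \<longlongrightarrow> l) F"
  proof (rule tendstoI)
    fix r :: real assume r: "r > 0"
    have "eventually (\<lambda>n. dist (e n) 0 < r / 3 \<and> dist (L n) l < r / 3) sequentially"
      using r by (intro eventually_conj tendstoD[OF e(2)] tendstoD[OF l]) auto
    then obtain n where n: "\<bar>e n\<bar> < r / 3" "\<bar>L n - l\<bar> < r / 3" by (auto simp: eventually_sequentially dist_real_def)
    have "eventually (\<lambda>x. dist (h n x) (L n) < r / 3) F" using r by (intro tendstoD[OF h]) simp
    then show "eventually (\<lambda>x. dist (g x) l < r) F"
    proof eventually_elim
      case (elim x)
      then show ?case using n e(1)[of x n] unfolding dist_real_def by linarith
    qed
  qed
  then show ?thesis by blast
qed

section \<open>Analyticity\<close>

text \<open>The real parts of the Taylor coefficients of a local holomorphic extension serve as real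
  coefficients, since the function is real on the real axis.\<close>

lemma real_analytic_onI:
  assumes "\<And>x. x \<in> S \<Longrightarrow> \<exists>\<delta>>0. \<exists>F. F holomorphic_on ball (complex_of_real x) \<delta> \<and>
      (\<forall>y. \<bar>y - x\<bar> < \<delta> \<longrightarrow> F (complex_of_real y) = complex_of_real (f y))"
  shows "real_analytic_on S f"
  unfolding real_analytic_on_def
proof
  fix x assume "x \<in> S"
  then obtain \<delta> F where d: "\<delta> > 0" and F: "F holomorphic_on ball (complex_of_real x) \<delta>"
    and eq: "\<And>y. \<bar>y - x\<bar> < \<delta> \<Longrightarrow> F (complex_of_real y) = complex_of_real (f y)"
    using assms by blast
  define a where "a n = (deriv ^^ n) F (complex_of_real x) / fact n" for n
  have "(\<lambda>n. Re (a n) * (y - x) ^ n) sums f y" if y: "\<bar>y - x\<bar> < \<delta>" for y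
  proof -
    have "complex_of_real y \<in> ball (complex_of_real x) \<delta>"
      using y by (simp add: dist_norm norm_of_real of_real_diff[symmetric] abs_minus_commute del: of_real_diff)
    from holomorphic_power_series[OF F this]
    have "(\<lambda>n. a n * (complex_of_real y - complex_of_real x) ^ n) sums complex_of_real (f y)"
      by (simp add: a_def eq[OF y])
    from sums_Re[OF this] show ?thesis
      by (simp add: of_real_diff[symmetric] of_real_power[symmetric] del: of_real_diff of_real_power)
  qed
  with d show "\<exists>\<delta>>0. \<exists>c. \<forall>y. \<bar>y - x\<bar> < \<delta> \<longrightarrow> (\<lambda>n. c n * (y - x) ^ n) sums f y"
    by (intro exI[of _ \<delta>] exI[of _ "\<lambda>n. Re (a n)"] conjI allI impI)
qed

text \<open>The term at n = 0 has denominator 0 and is 0 by convention, so the power series may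
  start there although loop lengths start at 1.\<close>

definition cloopsum :: "complex \<Rightarrow> complex" where
  "cloopsum w = (\<Sum>n. complex_of_real (- (kwtrace0 n / (2 * real n))) * w ^ n)"

lemma sqrt2_bound: "x < sqrt 2 - 1 \<longleftrightarrow> x * (1 + sqrt 2) < 1"
proof -
  have p: "1 + sqrt (2::real) > 0" by (simp add: add_pos_nonneg)
  have "(sqrt 2 - 1) * (1 + sqrt 2) = (1::real)" by (simp add: algebra_simps)
  then show ?thesis using mult_less_cancel_right_pos[OF p, of x "sqrt 2 - 1"] by simp
qed

lemma cloopsum_sums:
  assumes w: "norm w < sqrt 2 - 1"
  shows "(\<lambda>n. complex_of_real (- (kwtrace0 n / (2 * real n))) * w ^ n) sums cloopsum w"
proof -
  have "summable (\<lambda>k. norm (norm w ^ Suc k * kwtrace0 (Suc k) / (2 * real (Suc k))))"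
    using w by (intro ln_evenpoly_limit(2)) (simp_all add: sqrt2_bound)
  then have "summable (\<lambda>k. norm (complex_of_real (- (kwtrace0 (Suc k) / (2 * real (Suc k)))) * w ^ Suc k))"
    by (simp add: norm_mult norm_divide norm_power abs_mult mult_ac del: of_nat_Suc power_Suc of_real_divide)
  then have "summable (\<lambda>n. norm (complex_of_real (- (kwtrace0 n / (2 * real n))) * w ^ n))"
    by (subst (asm) summable_Suc_iff)
  then show ?thesis unfolding cloopsum_def by (rule summable_sums[OF summable_norm_cancel])
qed

lemma cloopsum_holomorphic: "cloopsum holomorphic_on ball 0 (sqrt 2 - 1)"
proof (rule power_series_holomorphic[where a = "\<lambda>n. complex_of_real (- (kwtrace0 n / (2 * real n)))"])
  fix w :: complex assume "w \<in> ball 0 (sqrt 2 - 1)"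
  then have "norm w < sqrt 2 - 1" by simp
  from cloopsum_sums[OF this]
  show "(\<lambda>n. complex_of_real (- (kwtrace0 n / (2 * real n))) * (w - 0) ^ n) sums cloopsum w"
    by (simp only: diff_zero)
qed

lemma cloopsum_of_real:
  assumes x: "0 \<le> x" "x < sqrt 2 - 1"
  shows "(\<lambda>k. fcirc (Suc k) x) sums complex_of_real (loopsum x)"
    and "summable (\<lambda>k. norm (fcirc (Suc k) x))"
    and "cloopsum (complex_of_real x) = complex_of_real (loopsum x)"
proof -
  define b where "b k = x ^ Suc k * kwtrace0 (Suc k) / (2 * real (Suc k))" for k
  have fc: "fcirc (Suc k) x = complex_of_real (- b k)" for k
    unfolding b_def using fcirc_eq[of "Suc k" x] by (simp del: of_nat_Suc power_Suc)
  have s: "summable (\<lambda>k. norm (b k))"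
    unfolding b_def using x by (intro ln_evenpoly_limit(2)) (simp_all add: sqrt2_bound)
  then show "summable (\<lambda>k. norm (fcirc (Suc k) x))" by (simp add: fc)
  have "(\<lambda>k. - b k) sums loopsum x"
    using summable_sums[OF summable_minus[OF summable_norm_cancel[OF s]]] unfolding loopsum_def b_def .
  then show 1: "(\<lambda>k. fcirc (Suc k) x) sums complex_of_real (loopsum x)"
    unfolding fc by (rule sums_of_real)
  have "(\<lambda>n. complex_of_real (- (kwtrace0 n / (2 * real n))) * complex_of_real x ^ n) sums cloopsum (complex_of_real x)"
    using x by (intro cloopsum_sums) simp
  from iffD2[OF sums_Suc_iff, of "\<lambda>n. complex_of_real (- (kwtrace0 n / (2 * real n))) * complex_of_real x ^ n" "cloopsum (complex_of_real x)"] this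
  have "(\<lambda>n. complex_of_real (- (kwtrace0 (Suc n) / (2 * real (Suc n)))) * complex_of_real x ^ Suc n) sums cloopsum (complex_of_real x)"
    by simp
  also have "(\<lambda>n. complex_of_real (- (kwtrace0 (Suc n) / (2 * real (Suc n)))) * complex_of_real x ^ Suc n) = (\<lambda>k. fcirc (Suc k) x)"
    unfolding fc b_def by (simp add: mult.commute del: of_nat_Suc power_Suc)
  finally show "cloopsum (complex_of_real x) = complex_of_real (loopsum x)" using 1 sums_unique2 by blast
qed

lemma analytic_high:
  assumes x: "0 < x" "x < \<beta>c" and bc: "tanh \<beta>c = sqrt 2 - 1"
    and f: "\<And>y. 0 < y \<Longrightarrow> y < \<beta>c \<Longrightarrow> f y = - (1 / y) * (ln (2 * (cosh y)\<^sup>2) + loopsum (tanh y))"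
  shows "\<exists>\<delta>>0. \<exists>F. F holomorphic_on ball (complex_of_real x) \<delta> \<and>
      (\<forall>y. \<bar>y - x\<bar> < \<delta> \<longrightarrow> F (complex_of_real y) = complex_of_real (f y))"
proof -
  define C where "C z = 2 * ((exp z + exp (- z)) / 2)\<^sup>2" for z :: complex
  define T where "T z = (exp z - exp (- z)) / (exp z + exp (- z))" for z :: complex
  \<comment> \<open>The last condition is |tanh z| < sqrt 2 - 1 cleared of its denominator: the set
    is then visibly open, and strictness excludes zeros of cosh. The positive real part keeps
    \<open>C z\<close> off the branch cut of \<open>Ln\<close>.\<close>
  define U where "U = {z. z \<noteq> 0 \<and> 0 < Re (C z) \<and> norm (exp z - exp (- z)) < (sqrt 2 - 1) * norm (exp z + exp (- z))}"
  define F where "F z = - (1 / z) * (Ln (C z) + cloopsum (T z))" for z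
  have "open U" unfolding U_def C_def
    by (intro open_Collect_conj open_Collect_less open_Collect_neq continuous_intros) simp_all
  have Uy: "complex_of_real y \<in> U" and Fy: "F (complex_of_real y) = complex_of_real (f y)" if y: "0 < y" "y < \<beta>c" for y
  proof -
    have m: "exp (- complex_of_real y) = complex_of_real (exp (- y))"
      using exp_of_real[of "- y", where ?'a = complex] by (simp only: of_real_minus)
    have e: "exp (complex_of_real y) + exp (- complex_of_real y) = complex_of_real (exp y + exp (- y))"
      "exp (complex_of_real y) - exp (- complex_of_real y) = complex_of_real (exp y - exp (- y))"
      by (simp_all only: m exp_of_real of_real_add of_real_diff)
    have p: "exp y + exp (- y) > 0" by (simp add: add_pos_pos)
    have ch: "cosh y = (exp y + exp (- y)) / 2" by (simp add: cosh_def)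
    have th: "tanh y = (exp y - exp (- y)) / (exp y + exp (- y))"
    proof -
      have "(u / 2) / (v / 2) = u / v" for u v :: real by simp
      moreover have "sinh y = (exp y - exp (- y)) / 2" by (simp add: sinh_def)
      ultimately show ?thesis unfolding tanh_def ch by (simp only:)
    qed
    have C: "C (complex_of_real y) = complex_of_real (2 * (cosh y)\<^sup>2)" unfolding C_def e ch
      by (simp only: of_real_mult of_real_power of_real_divide of_real_numeral)
    have T: "T (complex_of_real y) = complex_of_real (tanh y)" unfolding T_def e th by (simp only: of_real_divide)
    have t: "0 \<le> tanh y" "tanh y < sqrt 2 - 1" using y by (simp_all add: bc[symmetric])
    have "exp y - exp (- y) \<ge> 0" using y by simp
    moreover have "exp y - exp (- y) < (sqrt 2 - 1) * (exp y + exp (- y))"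
      using t(2) p unfolding th by (simp add: divide_less_eq)
    ultimately show "complex_of_real y \<in> U" unfolding U_def mem_Collect_eq e C
      using y p by (simp only: norm_of_real) simp
    have L: "Ln (complex_of_real (2 * (cosh y)\<^sup>2)) = complex_of_real (ln (2 * (cosh y)\<^sup>2))"
      by (rule Ln_of_real) simp
    show "F (complex_of_real y) = complex_of_real (f y)"
      unfolding F_def C T cloopsum_of_real(3)[OF t] f[OF y] L by simp
  qed
  have "F holomorphic_on U"
  proof -
    have ne: "exp z + exp (- z) \<noteq> 0" if "z \<in> U" for z
    proof
      assume 0: "exp z + exp (- z) = 0"
      have "norm (exp z - exp (- z)) < (sqrt 2 - 1) * norm (exp z + exp (- z))" using that by (simp only: U_def mem_Collect_eq)
      then show False unfolding 0 by simp
    qed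
    have "T holomorphic_on U" unfolding T_def by (intro holomorphic_intros ne)
    moreover have "T ` U \<subseteq> ball 0 (sqrt 2 - 1)"
    proof
      fix w assume "w \<in> T ` U"
      then obtain z where z: "z \<in> U" "w = T z" by blast
      have "norm (exp z + exp (- z)) > 0" using ne[OF z(1)] by simp
      then show "w \<in> ball 0 (sqrt 2 - 1)" using z by (simp add: T_def norm_divide U_def divide_less_eq)
    qed
    ultimately have "(\<lambda>z. cloopsum (T z)) holomorphic_on U"
      using holomorphic_on_compose_gen[OF _ cloopsum_holomorphic] by (simp add: o_def)
    moreover have "C holomorphic_on U" unfolding C_def by (intro holomorphic_intros) simp_all
    moreover have "C z \<notin> \<real>\<^sub>\<le>\<^sub>0" if "z \<in> U" for z using that by (auto simp: U_def complex_nonpos_Reals_iff)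
    moreover have "z \<noteq> 0" if "z \<in> U" for z using that by (simp add: U_def)
    ultimately show ?thesis unfolding F_def by (intro holomorphic_intros)
  qed
  obtain e where e: "e > 0" "ball (complex_of_real x) e \<subseteq> U"
    using openE[OF \<open>open U\<close> Uy[OF x]] by blast
  \<comment> \<open>The radius is also cut down so that the real points of the ball stay in the
    interval where the formula for \<open>f\<close> is assumed.\<close>
  define \<delta> where "\<delta> = min e (min x (\<beta>c - x))"
  have "\<delta> > 0" using e x by (simp add: \<delta>_def)
  moreover have "F holomorphic_on ball (complex_of_real x) \<delta>"
    using \<open>F holomorphic_on U\<close> e by (elim holomorphic_on_subset) (auto simp: \<delta>_def)
  moreover have "F (complex_of_real y) = complex_of_real (f y)" if "\<bar>y - x\<bar> < \<delta>" for y
    using that by (intro Fy) (auto simp: \<delta>_def)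
  ultimately show ?thesis by blast
qed

lemma analytic_low:
  assumes x: "\<beta>c < x" "0 < \<beta>c" and bc: "exp (- 2 * \<beta>c) = sqrt 2 - 1"
    and f: "\<And>y. \<beta>c < y \<Longrightarrow> f y = - (1 / y) * (2 * y + loopsum (exp (- 2 * y)))"
  shows "\<exists>\<delta>>0. \<exists>F. F holomorphic_on ball (complex_of_real x) \<delta> \<and>
      (\<forall>y. \<bar>y - x\<bar> < \<delta> \<longrightarrow> F (complex_of_real y) = complex_of_real (f y))"
proof -
  define T where "T z = exp (- 2 * z)" for z :: complex
  define U where "U = {z. z \<noteq> 0 \<and> norm (T z) < sqrt 2 - 1}"
  define F where "F z = - (1 / z) * (2 * z + cloopsum (T z))" for z
  have "open U" unfolding U_def T_def
    by (intro open_Collect_conj open_Collect_less open_Collect_neq continuous_intros)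
  have Uy: "complex_of_real y \<in> U" and Fy: "F (complex_of_real y) = complex_of_real (f y)" if y: "\<beta>c < y" for y
  proof -
    have T: "T (complex_of_real y) = complex_of_real (exp (- 2 * y))" unfolding T_def by (simp add: exp_of_real[symmetric])
    have t: "0 \<le> exp (- 2 * y)" "exp (- 2 * y) < sqrt 2 - 1" using y by (simp_all add: bc[symmetric])
    show "complex_of_real y \<in> U" unfolding U_def mem_Collect_eq T
      using y x t by (simp only: norm_of_real) simp
    show "F (complex_of_real y) = complex_of_real (f y)"
      unfolding F_def T cloopsum_of_real(3)[OF t] f[OF y] by simp
  qed
  have "F holomorphic_on U"
  proof -
    have "T holomorphic_on U" unfolding T_def by (intro holomorphic_intros)
    moreover have "T ` U \<subseteq> ball 0 (sqrt 2 - 1)" by (auto simp: U_def)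
    ultimately have "(\<lambda>z. cloopsum (T z)) holomorphic_on U"
      using holomorphic_on_compose_gen[OF _ cloopsum_holomorphic] by (simp add: o_def)
    moreover have "z \<noteq> 0" if "z \<in> U" for z using that by (simp add: U_def)
    ultimately show ?thesis unfolding F_def by (intro holomorphic_intros)
  qed
  obtain e where e: "e > 0" "ball (complex_of_real x) e \<subseteq> U"
    using openE[OF \<open>open U\<close> Uy[OF x(1)]] by blast
  define \<delta> where "\<delta> = min e (x - \<beta>c)"
  have "\<delta> > 0" using e x by (simp add: \<delta>_def)
  moreover have "F holomorphic_on ball (complex_of_real x) \<delta>"
    using \<open>F holomorphic_on U\<close> e by (elim holomorphic_on_subset) (auto simp: \<delta>_def)
  moreover have "F (complex_of_real y) = complex_of_real (f y)" if "\<bar>y - x\<bar> < \<delta>" for y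
    using that by (intro Fy) (auto simp: \<delta>_def)
  ultimately show ?thesis by blast
qed

theorem mainTheorem9:
  fixes \<beta>c :: real
  assumes "\<beta>c > 0"
    and "exp (- 2 * \<beta>c) = sqrt 2 - 1"
    and "tanh \<beta>c = sqrt 2 - 1"
  shows "\<exists>f :: real \<Rightarrow> real.
     (\<forall>\<beta> > 0. \<forall>bc. (fe_finite bc \<beta> \<longlongrightarrow> f \<beta>) rect_filter) \<and>
     (\<forall>\<beta> \<in> {0<..<\<beta>c}.
        summable (\<lambda>r. norm (fcirc (Suc r) (tanh \<beta>))) \<and>
        complex_of_real (- \<beta> * f \<beta>) =
          complex_of_real (ln (2 * (cosh \<beta>)\<^sup>2)) + (\<Sum>r. fcirc (Suc r) (tanh \<beta>))) \<and>
     (\<forall>\<beta> \<in> {\<beta>c<..}.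
        summable (\<lambda>r. norm (fcirc (Suc r) (exp (- 2 * \<beta>)))) \<and>
        complex_of_real (- \<beta> * f \<beta>) =
          complex_of_real (2 * \<beta>) + (\<Sum>r. fcirc (Suc r) (exp (- 2 * \<beta>)))) \<and>
     real_analytic_on ({0<..<\<beta>c} \<union> {\<beta>c<..}) f"
proof -
  have th: "0 \<le> tanh \<beta>" "tanh \<beta> < sqrt 2 - 1" if "0 < \<beta>" "\<beta> < \<beta>c" for \<beta>
    using that by (simp_all add: assms(3)[symmetric])
  have ex: "0 \<le> exp (- 2 * \<beta>)" "exp (- 2 * \<beta>) < sqrt 2 - 1" if "\<beta>c < \<beta>" for \<beta>
    using that by (simp_all add: assms(2)[symmetric])
  have high: "(pressure bc \<beta> \<longlongrightarrow> ln (2 * (cosh \<beta>)\<^sup>2) + loopsum (tanh \<beta>)) rect_filter" if "0 < \<beta>" "\<beta> < \<beta>c" for \<beta> bc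
    by (rule pressure_all_bc[OF _ pressure_Free_high]) (use th[OF that] that in \<open>simp_all add: sqrt2_bound\<close>)
  have low: "(pressure bc \<beta> \<longlongrightarrow> 2 * \<beta> + loopsum (exp (- 2 * \<beta>))) rect_filter" if "\<beta>c < \<beta>" for \<beta> bc
    by (rule pressure_all_bc[OF _ pressure_Plus_low]) (use ex(2)[OF that] that assms(1) in \<open>simp_all add: sqrt2_bound\<close>)
  have "\<exists>p. \<forall>bc. (pressure bc \<beta> \<longlongrightarrow> p) rect_filter" if b: "\<beta> > 0" for \<beta>
  proof -
    consider "\<beta> < \<beta>c" | "\<beta> > \<beta>c" | "\<beta> = \<beta>c" by linarith
    then show ?thesis
    proof cases
      case 1
      show ?thesis by (intro exI allI) (rule high[OF b 1])
    next
      case 2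
      show ?thesis by (intro exI allI) (rule low[OF 2])
    next
      case 3
      have "\<exists>p. (pressure Free \<beta>c \<longlongrightarrow> p) rect_filter"
      proof (rule limit_of_uniform_approximations[OF rect_filter_neq_bot])
        show "(pressure Free (\<beta>c + 1 / real (Suc n)) \<longlongrightarrow> 2 * (\<beta>c + 1 / real (Suc n)) + loopsum (exp (- 2 * (\<beta>c + 1 / real (Suc n))))) rect_filter" for n
          by (rule low) simp
        show "\<bar>pressure Free \<beta>c R - pressure Free (\<beta>c + 1 / real (Suc n)) R\<bar> \<le> 2 * (1 / real (Suc n))" for n R
          using pressure_lipschitz[of Free \<beta>c R "\<beta>c + 1 / real (Suc n)"] by simp
        show "(\<lambda>n. 2 * (1 / real (Suc n))) \<longlonglongrightarrow> 0"
          using tendsto_mult_right_zero[OF LIMSEQ_inverse_real_of_nat, of 2] by (simp add: inverse_eq_divide)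
      qed
      then show ?thesis using pressure_all_bc[of \<beta> Free] b unfolding 3 by (meson less_imp_le)
    qed
  qed
  then obtain P where P: "\<And>\<beta> bc. \<beta> > 0 \<Longrightarrow> (pressure bc \<beta> \<longlongrightarrow> P \<beta>) rect_filter" by metis
  define f where "f \<beta> = - (1 / \<beta>) * P \<beta>" for \<beta>
  have Phigh: "P \<beta> = ln (2 * (cosh \<beta>)\<^sup>2) + loopsum (tanh \<beta>)" if "0 < \<beta>" "\<beta> < \<beta>c" for \<beta>
    using tendsto_unique[OF rect_filter_neq_bot P[of \<beta> Free] high[OF that, of Free]] that by simp
  have Plow: "P \<beta> = 2 * \<beta> + loopsum (exp (- 2 * \<beta>))" if "\<beta>c < \<beta>" for \<beta>
    using tendsto_unique[OF rect_filter_neq_bot P[of \<beta> Free] low[OF that, of Free]] that assms(1) by simp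
  show ?thesis
  proof (intro exI[of _ f] conjI ballI allI impI)
    fix \<beta> :: real and bc assume "\<beta> > 0"
    then show "(fe_finite bc \<beta> \<longlongrightarrow> f \<beta>) rect_filter"
      unfolding fe_finite_pressure[abs_def] f_def by (intro tendsto_intros P)
  next
    fix \<beta> assume "\<beta> \<in> {0<..<\<beta>c}"
    then have b: "0 < \<beta>" "\<beta> < \<beta>c" by auto
    show "summable (\<lambda>r. norm (fcirc (Suc r) (tanh \<beta>)))" by (rule cloopsum_of_real(2)[OF th[OF b]])
    show "complex_of_real (- \<beta> * f \<beta>) = complex_of_real (ln (2 * (cosh \<beta>)\<^sup>2)) + (\<Sum>r. fcirc (Suc r) (tanh \<beta>))"
      using sums_unique[OF cloopsum_of_real(1)[OF th[OF b]]] b by (simp add: f_def Phigh[OF b])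
  next
    fix \<beta> assume "\<beta> \<in> {\<beta>c<..}"
    then have b: "\<beta>c < \<beta>" by auto
    show "summable (\<lambda>r. norm (fcirc (Suc r) (exp (- 2 * \<beta>))))" by (rule cloopsum_of_real(2)[OF ex[OF b]])
    show "complex_of_real (- \<beta> * f \<beta>) = complex_of_real (2 * \<beta>) + (\<Sum>r. fcirc (Suc r) (exp (- 2 * \<beta>)))"
      using sums_unique[OF cloopsum_of_real(1)[OF ex[OF b]]] b assms(1) by (simp add: f_def Plow[OF b])
  next
    show "real_analytic_on ({0<..<\<beta>c} \<union> {\<beta>c<..}) f"
    proof (rule real_analytic_onI)
      fix x assume "x \<in> {0<..<\<beta>c} \<union> {\<beta>c<..}"
      then consider "0 < x" "x < \<beta>c" | "\<beta>c < x" by auto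
      then show "\<exists>\<delta>>0. \<exists>F. F holomorphic_on ball (complex_of_real x) \<delta> \<and>
          (\<forall>y. \<bar>y - x\<bar> < \<delta> \<longrightarrow> F (complex_of_real y) = complex_of_real (f y))"
      proof cases
        case 1
        then show ?thesis by (rule analytic_high[OF _ _ assms(3)]) (simp add: f_def Phigh)
      next
        case 2
        then show ?thesis by (rule analytic_low[OF _ assms(1,2)]) (simp add: f_def Plow)
      qed
    qed
  qed
qed

end
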